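(* Fix a time period $T\ge1$ and dimensions $n_x,n_y$. For each $n\ge1$ consider the linear RNN with $n$ hidden units and parameters $(W,F,C)$, $W\in\mathbb{R}^{n\times n}$, $F\in\mathbb{R}^{n\times n_x}$, $C\in\mathbb{R}^{n_y\times n}$, which maps an input sequence $\mathbf{x}=(x_0,\ldots,x_{T-1})$, $x_t\in\mathbb{R}^{n_x}$, to the output sequence $\mathbf{y}=(y_0,\ldots,y_{T-1})$ via $$h_t=\tfrac{1}{\sqrt n}Wh_{t-1}+Fx_t,\qquad y_t=\tfrac{1}{\sqrt n}Ch_t,\qquad t=0,\ldots,T-1,\qquad h_{-1}=0.$$ Assume the parameters are initialized with mutually independent entries $W_{ij}\sim\mathcal{N}(0,\nu_W)$, $F_{ij}\sim\mathcal{N}(0,\nu_F)$, $C_{ki}\sim\mathcal{N}(0,\nu_C)$ for constants $\nu_W,\nu_F,\nu_C>0$. Then, as $n\to\infty$: (a) The impulse response coefficients $L_j=n^{-(j+1)/2}CW^jF\in\mathbb{R}^{n_y\times n_x}$, $j=0,\ldots,T-1$, converge in distribution to independent Gaussian matrices, where the components of the limit of $L_j$ are i.i.d. $\mathcal{N}(0,\nu_C\nu_F\nu_W^j)$. (b) For any input sequences $\mathbf{x},\mathbf{x}'$, the NTK of the RNN (with respect to the parameters $(W,F,C)$ at the random initialization) converges almost surely to the deterministic limit $$K(\mathbf{x},\mathbf{x}')=\mathcal{T}(\mathbf{x})^{\top}D(\rho)\,\mathcal{T}(\mathbf{x}')\otimes I_{n_y},$$ where $$\rho_j=\nu_C\big(j\nu_F\nu_W^{j-1}+\nu_W^j\big)+\nu_F\nu_W^j,\qquad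 j=0,\ldots,T-1,$$ $\mathcal{T}(\mathbf{x})\in\mathbb{R}^{Tn_x\times T}$ is the block upper-triangular Toeplitz matrix whose $(j,t)$ block ($j,t=0,\ldots,T-1$) equals $x_{t-j}$ if $j\le t$ and $0$ otherwise (i.e. first block row $(x_0,x_1,\ldots,x_{T-1})$, second $(0,x_0,\ldots,x_{T-2})$, etc.), and $D(\rho)=\mathrm{diag}(\rho_0I_{n_x},\ldots,\rho_{T-1}I_{n_x})$.
   Context: For a model $\hat y=f(x,\theta)$ with output in $\mathbb{R}^{m_y}$ and initial parameter $\theta^0$, the neural tangent kernel (NTK) is the $m_y\times m_y$ matrix $[K(x,x')]_{ij}=\langle \partial f_i(x,\theta^0)/\partial\theta,\ \partial f_j(x',\theta^0)/\partial\theta\rangle$, the inner product being the sum over all parameter entries (here the entries of $W,F,C$). The output sequence is regarded as the stacked vector $(y_0,\ldots,y_{T-1})\in\mathbb{R}^{Tn_y}$, so that for a $T\times T$ matrix $A$ the $(t,s)$ block of $A\otimes I_{n_y}$ is $A_{ts}I_{n_y}$. For $j=0$ the term $j\nu_F\nu_W^{j-1}$ is interpreted as $0$. *)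

theory Defs
  imports "HOL-Probability.Probability"
begin

text \<open>Matrices / sequences are functions nat \<Rightarrow> nat \<Rightarrow> real, only the entries
inside the stated index bounds being relevant.  An input sequence x is
x t m = m-th component of x_t (t < T, m < nx).\<close>

fun rnn_hidden :: "nat \<Rightarrow> nat \<Rightarrow> (nat \<Rightarrow> nat \<Rightarrow> real) \<Rightarrow> (nat \<Rightarrow> nat \<Rightarrow> real)
    \<Rightarrow> (nat \<Rightarrow> nat \<Rightarrow> real) \<Rightarrow> nat \<Rightarrow> nat \<Rightarrow> real" where
  "rnn_hidden n nx W F x 0 i = (\<Sum>m<nx. F i m * x 0 m)"
| "rnn_hidden n nx W F x (Suc t) i =
     (1 / sqrt (real n)) * (\<Sum>j<n. W i j * rnn_hidden n nx W F x t j)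
     + (\<Sum>m<nx. F i m * x (Suc t) m)"

definition rnn_out :: "nat \<Rightarrow> nat \<Rightarrow> (nat \<Rightarrow> nat \<Rightarrow> real) \<Rightarrow> (nat \<Rightarrow> nat \<Rightarrow> real)
    \<Rightarrow> (nat \<Rightarrow> nat \<Rightarrow> real) \<Rightarrow> (nat \<Rightarrow> nat \<Rightarrow> real) \<Rightarrow> nat \<Rightarrow> nat \<Rightarrow> real" where
  "rnn_out n nx W F C x t k = (1 / sqrt (real n)) * (\<Sum>i<n. C k i * rnn_hidden n nx W F x t i)"

definition upd2 :: "(nat \<Rightarrow> nat \<Rightarrow> real) \<Rightarrow> nat \<Rightarrow> nat \<Rightarrow> real \<Rightarrow> nat \<Rightarrow> nat \<Rightarrow> real" where
  "upd2 A i j a = (\<lambda>i' j'. if i' = i \<and> j' = j then a else A i' j')"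

definition rnn_ntk :: "nat \<Rightarrow> nat \<Rightarrow> nat \<Rightarrow> (nat \<Rightarrow> nat \<Rightarrow> real) \<Rightarrow> (nat \<Rightarrow> nat \<Rightarrow> real)
    \<Rightarrow> (nat \<Rightarrow> nat \<Rightarrow> real) \<Rightarrow> (nat \<Rightarrow> nat \<Rightarrow> real) \<Rightarrow> (nat \<Rightarrow> nat \<Rightarrow> real)
    \<Rightarrow> nat \<Rightarrow> nat \<Rightarrow> nat \<Rightarrow> nat \<Rightarrow> real" where
  "rnn_ntk n nx ny W F C x x' t k s l =
     (\<Sum>i<n. \<Sum>j<n.
        deriv (\<lambda>a. rnn_out n nx (upd2 W i j a) F C x t k) (W i j)
      * deriv (\<lambda>a. rnn_out n nx (upd2 W i j a) F C x' s l) (W i j))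
   + (\<Sum>i<n. \<Sum>m<nx.
        deriv (\<lambda>a. rnn_out n nx W (upd2 F i m a) C x t k) (F i m)
      * deriv (\<lambda>a. rnn_out n nx W (upd2 F i m a) C x' s l) (F i m))
   + (\<Sum>q<ny. \<Sum>i<n.
        deriv (\<lambda>a. rnn_out n nx W F (upd2 C q i a) x t k) (C q i)
      * deriv (\<lambda>a. rnn_out n nx W F (upd2 C q i a) x' s l) (C q i))"

text \<open>rho_j = nuC (j nuF nuW^(j-1) + nuW^j) + nuF nuW^j  (the first summand is 0 for j = 0).\<close>
definition ntk_rho :: "real \<Rightarrow> real \<Rightarrow> real \<Rightarrow> nat \<Rightarrow> real" where
  "ntk_rho \<nu>W \<nu>F \<nu>C j = \<nu>C * (real j * \<nu>F * \<nu>W ^ (j - 1) + \<nu>W ^ j) + \<nu>F * \<nu>W ^ j"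

text \<open>Block Toeplitz matrix T(x) in R^{(T nx) x T}: entry in row (j,m) (block j, component m)
  and column t is (x_{t-j})_m if j \<le> t, else 0.\<close>
definition toeplitz_in :: "(nat \<Rightarrow> nat \<Rightarrow> real) \<Rightarrow> nat \<Rightarrow> nat \<Rightarrow> nat \<Rightarrow> real" where
  "toeplitz_in x j m t = (if j \<le> t then x (t - j) m else 0)"

text \<open>Limit kernel T(x)^T D(rho) T(x') \<otimes> I_{ny}, entry ((t,k),(s,l)).\<close>
definition ntk_limit :: "nat \<Rightarrow> nat \<Rightarrow> real \<Rightarrow> real \<Rightarrow> real \<Rightarrow> (nat \<Rightarrow> nat \<Rightarrow> real)
    \<Rightarrow> (nat \<Rightarrow> nat \<Rightarrow> real) \<Rightarrow> nat \<Rightarrow> nat \<Rightarrow> nat \<Rightarrow> nat \<Rightarrow> real" where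
  "ntk_limit T nx \<nu>W \<nu>F \<nu>C x x' t k s l =
     (\<Sum>j<T. \<Sum>m<nx. toeplitz_in x j m t * ntk_rho \<nu>W \<nu>F \<nu>C j * toeplitz_in x' j m s)
     * (if k = l then 1 else 0)"

fun wpowF :: "nat \<Rightarrow> (nat \<Rightarrow> nat \<Rightarrow> real) \<Rightarrow> (nat \<Rightarrow> nat \<Rightarrow> real) \<Rightarrow> nat \<Rightarrow> nat \<Rightarrow> nat \<Rightarrow> real" where
  "wpowF n W F 0 i m = F i m"
| "wpowF n W F (Suc j) i m = (\<Sum>p<n. W i p * wpowF n W F j p m)"

definition impulse_coeff :: "nat \<Rightarrow> (nat \<Rightarrow> nat \<Rightarrow> real) \<Rightarrow> (nat \<Rightarrow> nat \<Rightarrow> real)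
    \<Rightarrow> (nat \<Rightarrow> nat \<Rightarrow> real) \<Rightarrow> nat \<Rightarrow> nat \<Rightarrow> nat \<Rightarrow> real" where
  "impulse_coeff n W F C j k m = (1 / sqrt (real n)) ^ (Suc j) * (\<Sum>i<n. C k i * wpowF n W F j i m)"

definition converges_in_distribution ::
  "'a measure \<Rightarrow> (nat \<Rightarrow> 'a \<Rightarrow> 'b::topological_space) \<Rightarrow> 'b measure \<Rightarrow> bool" where
  "converges_in_distribution M X \<mu> \<longleftrightarrow>
     (\<forall>f :: 'b \<Rightarrow> real. continuous_on UNIV f \<and> bounded (range f) \<longrightarrow>
        (\<lambda>n. \<integral>\<omega>. f (X n \<omega>) \<partial>M) \<longlonglongrightarrow> (\<integral>v. f v \<partial>\<mu>))"

end

(* Write A = W / sqrt n. Everything is governed by the quadratic forms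
   (1/n) f_m^T A^w f_m', where A^w is a word in A and its transpose and f_m is a column of F,
   resp. the same with C^T in place of F: the entries of the kernel are finite sums of
   products of such forms, and, conditionally on (W, F), the impulse response is Gaussian with
   a covariance made of such forms.

   Gaussian integration by parts in W turns the moments of normalized traces of words into a
   recursion (loop equations) with explicit powers of 1/n. The recursion shows that the
   moments are bounded, that covariances are O(1/n^2), and that the trace of A^b (A^T)^a tends
   to nuW^a if a = b and to 0 otherwise. Integration by parts in F shows that the fourth
   moment of the deviation of a quadratic form from its conditional mean is O(1/n^2). Both
   rates are summable, so almost sure convergence needs no coupling between different n.

   For the impulse response, the conditional characteristic function converges. A
   multivariate Levy theorem is obtained from the one-dimensional one by replacing the
   exponentials by general test functions one coordinate at a time, and then clipping the
   coordinates and applying Stone-Weierstrass. *)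

theory Submission
  imports Defs
begin

section \<open>Gaussian integration by parts\<close>

text \<open>Integration by parts closes only on a sufficiently large class. Differentiating a trace
  of a word either splits it into two traces or merges it with another trace, and it mixes a letter
  with its transpose. Hence the recursion runs over lists of words in both letters, although the
  limits concern single words of a special shape. Working with polynomials in finitely many Gaussian
  variables makes integrability automatic and reduces the rule to monomials.

  Nothing is known about the joint law of the parameters for different n, so a summable rate is
  unavoidable. Variances of traces provide one. The deviation of a quadratic form has a second
  moment of order 1/n only; this is why fourth moments are estimated.

  Convergence in distribution is tested on functions of all triples of naturals, an infinite
  product. Outside the finite index range the coefficients and their limit vanish, so clipping the
  remaining coordinates leads into a compact set on which polynomials in finitely many coordinates
  are dense.\<close>

inductive polyfun :: "'i set \<Rightarrow> (('i \<Rightarrow> real) \<Rightarrow> real) \<Rightarrow> bool" for I where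
  polyfun_const: "polyfun I (\<lambda>_. a)"
| polyfun_add: "polyfun I \<Phi> \<Longrightarrow> polyfun I \<Psi> \<Longrightarrow> polyfun I (\<lambda>g. \<Phi> g + \<Psi> g)"
| polyfun_var_mult: "y \<in> I \<Longrightarrow> polyfun I \<Phi> \<Longrightarrow> polyfun I (\<lambda>g. g y * \<Phi> g)"

lemma polyfun_var: "y \<in> I \<Longrightarrow> polyfun I (\<lambda>g. g y)"
  using polyfun_var_mult[OF _ polyfun_const[of I 1], of y] by simp

lemma polyfun_cmult: "polyfun I \<Phi> \<Longrightarrow> polyfun I (\<lambda>g. a * \<Phi> g)"
proof (induction rule: polyfun.induct)
  case (polyfun_const b)
  then show ?case by (rule polyfun.polyfun_const)
next
  case (polyfun_add \<Phi> \<Psi>)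
  then show ?case using polyfun.polyfun_add[of I] by (simp add: distrib_left)
next
  case (polyfun_var_mult y \<Phi>)
  from polyfun.polyfun_var_mult[OF polyfun_var_mult(1,3)]
  show ?case by (simp add: mult.left_commute)
qed

lemma polyfun_mult: "polyfun I \<Phi> \<Longrightarrow> polyfun I \<Psi> \<Longrightarrow> polyfun I (\<lambda>g. \<Phi> g * \<Psi> g)"
proof (induction rule: polyfun.induct)
  case (polyfun_const b)
  then show ?case by (rule polyfun_cmult)
next
  case (polyfun_add \<Phi> \<Psi>)
  then show ?case using polyfun.polyfun_add[of I] by (simp add: distrib_right)
next
  case (polyfun_var_mult y \<Phi>)
  then show ?case using polyfun.polyfun_var_mult[of y I] by (simp add: mult.assoc)
qed

lemma polyfun_minus: "polyfun I \<Phi> \<Longrightarrow> polyfun I (\<lambda>g. - \<Phi> g)"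
  using polyfun_cmult[of I \<Phi> "-1"] by simp

lemma polyfun_diff: "polyfun I \<Phi> \<Longrightarrow> polyfun I \<Psi> \<Longrightarrow> polyfun I (\<lambda>g. \<Phi> g - \<Psi> g)"
  using polyfun_add[OF _ polyfun_minus] by fastforce

lemma polyfun_divide: "polyfun I \<Phi> \<Longrightarrow> polyfun I (\<lambda>g. \<Phi> g / a)"
  using polyfun_cmult[of I \<Phi> "1 / a"] by simp

lemma polyfun_sum: "(\<And>x. x \<in> S \<Longrightarrow> polyfun I (\<Phi> x)) \<Longrightarrow> polyfun I (\<lambda>g. \<Sum>x\<in>S. \<Phi> x g)"
  by (induction S rule: infinite_finite_induct) (auto intro: polyfun_const polyfun_add)

lemma polyfun_prod_list: "(\<And>x. x \<in> set xs \<Longrightarrow> polyfun I (\<Phi> x)) \<Longrightarrow> polyfun I (\<lambda>g. \<Prod>x\<leftarrow>xs. \<Phi> x g)"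
  by (induction xs) (auto intro: polyfun_const polyfun_mult)

lemma polyfun_power: "polyfun I \<Phi> \<Longrightarrow> polyfun I (\<lambda>g. \<Phi> g ^ p)"
  by (induction p) (auto intro: polyfun_const polyfun_mult)

lemma polyfun_if: "polyfun I \<Phi> \<Longrightarrow> polyfun I \<Psi> \<Longrightarrow> polyfun I (\<lambda>g. if b then \<Phi> g else \<Psi> g)"
  by (cases b) auto

lemmas polyfun_intros = polyfun_const polyfun_add polyfun_var polyfun_mult polyfun_minus
  polyfun_diff polyfun_divide polyfun_sum polyfun_prod_list polyfun_power polyfun_if

text \<open>Integration by parts for a power of one variable, read off the closed formulas for the
  moments. At p = 0 the exponent \<open>p - 1\<close> is truncated to 0, which is harmless because
  the factor p vanishes.\<close>

lemma normal_moment_Suc: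
  fixes p :: nat
  assumes "\<sigma> > 0"
  shows "(LINT x|lborel. normal_density 0 \<sigma> x * x ^ (p + 1))
       = real p * \<sigma>\<^sup>2 * (LINT x|lborel. normal_density 0 \<sigma> x * x ^ (p - 1))"
proof (cases "even p")
  case True
  then obtain k where p: "p = 2 * k" by (auto elim: evenE)
  have 1: "(LINT x|lborel. normal_density 0 \<sigma> x * x ^ (p + 1)) = 0"
    using integral_normal_moment_odd[OF assms, of 0 k] p by simp
  show ?thesis
  proof (cases k)
    case 0
    then show ?thesis using 1 p by simp
  next
    case (Suc k')
    have "(LINT x|lborel. normal_density 0 \<sigma> x * x ^ (p - 1)) = 0"
      using integral_normal_moment_odd[OF assms, of 0 k'] p Suc by simp
    then show ?thesis using 1 by simp
  qed
next
  case False
  then obtain k where p: "p = 2 * k + 1" by (auto elim: oddE)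
  have 1: "(LINT x|lborel. normal_density 0 \<sigma> x * x ^ (p + 1))
      = fact (2 * Suc k) / ((2 / \<sigma>\<^sup>2) ^ Suc k * fact (Suc k))"
    using integral_normal_moment_even[OF assms, of 0 "Suc k"] p by simp
  have 2: "(LINT x|lborel. normal_density 0 \<sigma> x * x ^ (p - 1))
      = fact (2 * k) / ((2 / \<sigma>\<^sup>2) ^ k * fact k)"
    using integral_normal_moment_even[OF assms, of 0 k] p by simp
  have "fact (2 * Suc k) / ((2 / \<sigma>\<^sup>2) ^ Suc k * fact (Suc k))
      = real p * \<sigma>\<^sup>2 * (fact (2 * k) / ((2 / \<sigma>\<^sup>2) ^ k * fact k) :: real)"
    using assms p by (simp add: divide_simps)
  then show ?thesis unfolding 1 2 .
qed

section \<open>Independent centred Gaussian variables\<close>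

locale gaussian_family = prob_space +
  fixes I :: "'i set" and X :: "'i \<Rightarrow> 'a \<Rightarrow> real" and v :: "'i \<Rightarrow> real"
  assumes finI: "finite I"
    and indepX: "indep_vars (\<lambda>_. borel) X I"
    and v_pos: "\<And>x. x \<in> I \<Longrightarrow> v x > 0"
    and distX: "\<And>x. x \<in> I \<Longrightarrow> distributed M lborel (X x) (normal_density 0 (sqrt (v x)))"
begin

lemma moment_eq:
  assumes "x \<in> I"
  shows "integrable M (\<lambda>\<omega>. X x \<omega> ^ p)"
    and "expectation (\<lambda>\<omega>. X x \<omega> ^ p) = (LINT a|lborel. normal_density 0 (sqrt (v x)) a * a ^ p)"
proof -
  have s: "sqrt (v x) > 0" using v_pos[OF assms] by simp
  have "integrable lborel (\<lambda>a. normal_density 0 (sqrt (v x)) a * a ^ p)"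
    using integrable_normal_moment[OF s, of 0 p] by simp
  then show "integrable M (\<lambda>\<omega>. X x \<omega> ^ p)"
    using distributed_integrable[OF distX[OF assms], of "\<lambda>a. a ^ p"] by simp
  show "expectation (\<lambda>\<omega>. X x \<omega> ^ p) = (LINT a|lborel. normal_density 0 (sqrt (v x)) a * a ^ p)"
    using distributed_integral[OF distX[OF assms], of "\<lambda>a. a ^ p"] by simp
qed

lemma moment_Suc:
  assumes "x \<in> I"
  shows "expectation (\<lambda>\<omega>. X x \<omega> ^ (p + 1)) = real p * v x * expectation (\<lambda>\<omega>. X x \<omega> ^ (p - 1))"
  using normal_moment_Suc[of "sqrt (v x)" p] v_pos[OF assms]
  by (simp add: moment_eq(2)[OF assms] del: power_Suc)

lemma monomial_expectation:
  fixes c :: "'i \<Rightarrow> nat"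
  shows "integrable M (\<lambda>\<omega>. \<Prod>y\<in>I. X y \<omega> ^ c y)"
    and "expectation (\<lambda>\<omega>. \<Prod>y\<in>I. X y \<omega> ^ c y) = (\<Prod>y\<in>I. expectation (\<lambda>\<omega>. X y \<omega> ^ c y))"
proof -
  have ind: "indep_vars (\<lambda>_. borel) (\<lambda>y \<omega>. X y \<omega> ^ c y) I"
    by (rule indep_vars_compose2[OF indepX, of "\<lambda>y a. a ^ c y"]) auto
  show "integrable M (\<lambda>\<omega>. \<Prod>y\<in>I. X y \<omega> ^ c y)"
    by (rule indep_vars_integrable[OF finI ind]) (rule moment_eq)
  show "expectation (\<lambda>\<omega>. \<Prod>y\<in>I. X y \<omega> ^ c y) = (\<Prod>y\<in>I. expectation (\<lambda>\<omega>. X y \<omega> ^ c y))"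
    by (rule indep_vars_lebesgue_integral[OF finI ind]) (rule moment_eq)
qed

abbreviation "XX \<equiv> \<lambda>\<omega> y. X y \<omega>"

lemma monomial_var_mult:
  assumes "y \<in> I"
  shows "(\<Prod>z\<in>I. (g z :: real) ^ c z) * (g y * r) = (\<Prod>z\<in>I. g z ^ (c(y := Suc (c y))) z) * r"
proof -
  have "(\<Prod>z\<in>I. g z ^ (c(y := Suc (c y))) z) = (\<Prod>z\<in>I. g z ^ c z * (if z = y then g z else 1))"
    by (intro prod.cong) auto
  also have "\<dots> = (\<Prod>z\<in>I. g z ^ c z) * g y"
    using assms finI by (simp add: prod.distrib prod.delta)
  finally show ?thesis by simp
qed

text \<open>The monomial in front strengthens the induction: multiplication by a variable, the only
  product in \<open>polyfun\<close>, is absorbed into the exponents \<open>c\<close>, and the base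
  case is a pure monomial, where independence applies.\<close>

lemma polyfun_monomial_integrable:
  assumes "polyfun I \<Phi>"
  shows "integrable M (\<lambda>\<omega>. (\<Prod>z\<in>I. X z \<omega> ^ c z) * \<Phi> (XX \<omega>))"
  using assms
proof (induction arbitrary: c rule: polyfun.induct)
  case (polyfun_const a)
  then show ?case using monomial_expectation(1) by simp
next
  case (polyfun_add \<Phi> \<Psi>)
  then show ?case by (simp add: distrib_left)
next
  case (polyfun_var_mult y \<Phi>)
  then show ?case by (subst monomial_var_mult) auto
qed

lemma polyfun_integrable: "polyfun I \<Phi> \<Longrightarrow> integrable M (\<lambda>\<omega>. \<Phi> (XX \<omega>))"
  using polyfun_monomial_integrable[of \<Phi> "\<lambda>_. 0"] by simp

text \<open>By independence the expectation factors over the variables, and only the factor of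
  \<open>x\<close> changes; for it the claim is the recursion \<open>moment_Suc\<close>.\<close>

lemma monomial_ibp:
  assumes x: "x \<in> I"
  shows "expectation (\<lambda>\<omega>. X x \<omega> * (\<Prod>z\<in>I. X z \<omega> ^ c z))
       = v x * expectation (\<lambda>\<omega>. real (c x) * (\<Prod>z\<in>I. X z \<omega> ^ (c(x := c x - 1)) z))"
proof -
  have "expectation (\<lambda>\<omega>. X x \<omega> * (\<Prod>z\<in>I. X z \<omega> ^ c z))
     = expectation (\<lambda>\<omega>. (\<Prod>z\<in>I. X z \<omega> ^ (c(x := Suc (c x))) z))"
    by (intro Bochner_Integration.integral_cong refl)
       (use monomial_var_mult[OF x, of "XX _" c 1] in \<open>simp add: mult.commute del: fun_upd_apply\<close>)
  also have "\<dots> = expectation (\<lambda>\<omega>. X x \<omega> ^ (c x + 1)) * (\<Prod>z\<in>I-{x}. expectation (\<lambda>\<omega>. X z \<omega> ^ c z))"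
    unfolding monomial_expectation(2) by (subst prod.remove[OF finI x]) (auto intro!: prod.cong)
  also have "\<dots> = real (c x) * v x * (expectation (\<lambda>\<omega>. X x \<omega> ^ (c x - 1)) * (\<Prod>z\<in>I-{x}. expectation (\<lambda>\<omega>. X z \<omega> ^ c z)))"
    unfolding moment_Suc[OF x] by simp
  also have "expectation (\<lambda>\<omega>. X x \<omega> ^ (c x - 1)) * (\<Prod>z\<in>I-{x}. expectation (\<lambda>\<omega>. X z \<omega> ^ c z))
     = expectation (\<lambda>\<omega>. (\<Prod>z\<in>I. X z \<omega> ^ (c(x := c x - 1)) z))"
    unfolding monomial_expectation(2) by (subst prod.remove[OF finI x]) (auto intro!: prod.cong)
  finally show ?thesis by simp
qed

lemma monomial_derivative:
  assumes x: "x \<in> I"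
  shows "((\<lambda>a. \<Prod>z\<in>I. (g(x := a)) z ^ c z) has_real_derivative
     real (c x) * (\<Prod>z\<in>I. g z ^ (c(x := c x - 1)) z)) (at (g x))"
proof -
  have 1: "(\<Prod>z\<in>I. (g(x := a)) z ^ c z) = a ^ c x * (\<Prod>z\<in>I-{x}. g z ^ c z)" for a
    by (subst prod.remove[OF finI x]) (auto intro!: prod.cong)
  have 2: "(\<Prod>z\<in>I. g z ^ (c(x := c x - 1)) z) = g x ^ (c x - 1) * (\<Prod>z\<in>I-{x}. g z ^ c z)"
    by (subst prod.remove[OF finI x]) (auto intro!: prod.cong)
  show ?thesis unfolding 1 2 by (auto intro!: derivative_eq_intros)
qed

text \<open>That the partial derivative is again a polynomial is what makes it integrable, without
  any bound on it.\<close>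

lemma polyfun_has_partial:
  assumes "polyfun I \<Phi>" "x \<in> I"
  shows "\<exists>\<Phi>'. polyfun I \<Phi>' \<and> (\<forall>g. ((\<lambda>a. \<Phi> (g(x := a))) has_real_derivative \<Phi>' g) (at (g x)))"
  using assms(1)
proof (induction rule: polyfun.induct)
  case (polyfun_const a)
  show ?case by (rule exI[of _ "\<lambda>_. 0"]) (auto intro: polyfun.polyfun_const)
next
  case (polyfun_add \<Phi> \<Psi>)
  then obtain \<Phi>' \<Psi>' where "polyfun I \<Phi>'" "polyfun I \<Psi>'"
     "\<And>g. ((\<lambda>a. \<Phi> (g(x := a))) has_real_derivative \<Phi>' g) (at (g x))"
     "\<And>g. ((\<lambda>a. \<Psi> (g(x := a))) has_real_derivative \<Psi>' g) (at (g x))" by blast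
  then show ?case
    by (intro exI[of _ "\<lambda>g. \<Phi>' g + \<Psi>' g"]) (auto intro!: polyfun.polyfun_add DERIV_add simp del: fun_upd_apply)
next
  case (polyfun_var_mult y \<Phi>)
  then obtain \<Phi>' where P: "polyfun I \<Phi>'" 
     "\<And>g. ((\<lambda>a. \<Phi> (g(x := a))) has_real_derivative \<Phi>' g) (at (g x))" by blast
  show ?case
  proof (intro exI[of _ "\<lambda>g. (if y = x then 1 else 0) * \<Phi> g + g y * \<Phi>' g"] conjI allI)
    show "polyfun I (\<lambda>g. (if y = x then 1 else 0) * \<Phi> g + g y * \<Phi>' g)"
      using P(1) polyfun_var_mult by (intro polyfun_intros)
    fix g
    have "((\<lambda>a. (g(x := a)) y) has_real_derivative (if y = x then 1 else 0)) (at (g x))"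
      by (cases "y = x") auto
    from DERIV_mult[OF this P(2)[of g]]
    show "((\<lambda>a. (g(x := a)) y * \<Phi> (g(x := a))) has_real_derivative
        (if y = x then 1 else 0) * \<Phi> g + g y * \<Phi>' g) (at (g x))"
      by (simp add: mult.commute add.commute)
  qed
qed

text \<open>Again the monomial in front absorbs multiplications by a variable. The derivative
  \<open>D\<close> is an arbitrary function with the right pointwise property; uniqueness of
  derivatives identifies it in each case.\<close>

lemma ibp_monomial_polyfun:
  assumes x: "x \<in> I" and "polyfun I \<Phi>"
    and "\<And>g. ((\<lambda>a. (\<Prod>z\<in>I. (g(x := a)) z ^ c z) * \<Phi> (g(x := a))) has_real_derivative D g) (at (g x))"
  shows "expectation (\<lambda>\<omega>. X x \<omega> * ((\<Prod>z\<in>I. X z \<omega> ^ c z) * \<Phi> (XX \<omega>))) = v x * expectation (\<lambda>\<omega>. D (XX \<omega>))"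
  using assms(2,3)
proof (induction arbitrary: c D rule: polyfun.induct)
  case (polyfun_const a)
  have "D g = (real (c x) * (\<Prod>z\<in>I. g z ^ (c(x := c x - 1)) z)) * a" for g
    using polyfun_const[of g] DERIV_cmult_right[OF monomial_derivative[OF x, of g c], of a]
    by (rule DERIV_unique)
  then show ?case using monomial_ibp[OF x, of c]
    by (simp add: mult.assoc[symmetric] del: fun_upd_apply)
next
  case (polyfun_add \<Phi> \<Psi>)
  let ?m = "\<lambda>g. \<Prod>z\<in>I. g z ^ c z :: real"
  have pm: "polyfun I (\<lambda>g. ?m g * \<Theta> g)" if "polyfun I \<Theta>" for \<Theta>
    using that
  proof -
    have "polyfun I (\<lambda>g. \<Prod>z\<in>S. g z ^ c z)" if "S \<subseteq> I" for S
      using finite_subset[OF that finI] that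
      by (induction rule: finite_induct) (auto intro!: polyfun_intros)
    from this[of I] that show ?thesis by (intro polyfun_mult) auto
  qed
  \<comment> \<open>The hypothesis differentiates only the sum, so derivatives of the two summands
    have to be produced before the induction hypotheses apply.\<close>
  obtain D1 where D1: "polyfun I D1" 
     "\<And>g. ((\<lambda>a. ?m (g(x := a)) * \<Phi> (g(x := a))) has_real_derivative D1 g) (at (g x))"
    using polyfun_has_partial[OF pm[OF polyfun_add(1)] x] by blast
  obtain D2 where D2: "polyfun I D2" 
     "\<And>g. ((\<lambda>a. ?m (g(x := a)) * \<Psi> (g(x := a))) has_real_derivative D2 g) (at (g x))"
    using polyfun_has_partial[OF pm[OF polyfun_add(2)] x] by blast
  have D: "D g = D1 g + D2 g" for g
    using polyfun_add(5)[of g, unfolded distrib_left] DERIV_add[OF D1(2)[of g] D2(2)[of g]]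
    by (rule DERIV_unique)
  have i1: "integrable M (\<lambda>\<omega>. X x \<omega> * (?m (XX \<omega>) * \<Phi> (XX \<omega>)))"
    using polyfun_integrable[OF polyfun_mult[OF polyfun_var[OF x] pm[OF polyfun_add(1)]]] .
  have i2: "integrable M (\<lambda>\<omega>. X x \<omega> * (?m (XX \<omega>) * \<Psi> (XX \<omega>)))"
    using polyfun_integrable[OF polyfun_mult[OF polyfun_var[OF x] pm[OF polyfun_add(2)]]] .
  have "expectation (\<lambda>\<omega>. X x \<omega> * (?m (XX \<omega>) * (\<Phi> (XX \<omega>) + \<Psi> (XX \<omega>)))) =
     expectation (\<lambda>\<omega>. X x \<omega> * (?m (XX \<omega>) * \<Phi> (XX \<omega>))) + expectation (\<lambda>\<omega>. X x \<omega> * (?m (XX \<omega>) * \<Psi> (XX \<omega>)))"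
    using i1 i2 by (simp add: distrib_left)
  also have "\<dots> = v x * expectation (\<lambda>\<omega>. D1 (XX \<omega>)) + v x * expectation (\<lambda>\<omega>. D2 (XX \<omega>))"
    using polyfun_add(3)[OF D1(2)] polyfun_add(4)[OF D2(2)] by simp
  also have "\<dots> = v x * expectation (\<lambda>\<omega>. D (XX \<omega>))"
    unfolding D using polyfun_integrable[OF D1(1)] polyfun_integrable[OF D2(1)]
    by (simp add: distrib_left)
  finally show ?case .
next
  case (polyfun_var_mult y \<Phi>)
  note m = monomial_var_mult[OF polyfun_var_mult(1)]
  have "expectation (\<lambda>\<omega>. X x \<omega> * ((\<Prod>z\<in>I. X z \<omega> ^ (c(y := Suc (c y))) z) * \<Phi> (XX \<omega>)))
      = v x * expectation (\<lambda>\<omega>. D (XX \<omega>))"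
    by (rule polyfun_var_mult(3)) (use polyfun_var_mult(4) in \<open>simp only: m\<close>)
  then show ?case by (simp only: m[of "\<lambda>z. X z \<omega>" c for \<omega>])
qed

text \<open>Leaving \<open>D\<close> free allows every application to supply the derivative in the
  form in which it is to be summed later.\<close>

lemma gaussian_ibp:
  assumes "x \<in> I" "polyfun I \<Phi>"
    and "\<And>g. ((\<lambda>a. \<Phi> (g(x := a))) has_real_derivative D g) (at (g x))"
  shows "expectation (\<lambda>\<omega>. X x \<omega> * \<Phi> (XX \<omega>)) = v x * expectation (\<lambda>\<omega>. D (XX \<omega>))"
  using ibp_monomial_polyfun[OF assms(1,2), of "\<lambda>_. 0" D] assms(3) by simp

end

section \<open>Words in a matrix and its transpose\<close>

text \<open>Words are lists of Booleans: True stands for the matrix, False for its transpose.\<close>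

definition letter :: "bool \<Rightarrow> (nat \<Rightarrow> nat \<Rightarrow> real) \<Rightarrow> nat \<Rightarrow> nat \<Rightarrow> real" where
  "letter c A i j = (if c then A i j else A j i)"

fun wmat :: "nat \<Rightarrow> (nat \<Rightarrow> nat \<Rightarrow> real) \<Rightarrow> bool list \<Rightarrow> nat \<Rightarrow> nat \<Rightarrow> real" where
  "wmat n A [] i j = (if i = j then 1 else 0)"
| "wmat n A (c # w) i j = (\<Sum>p<n. letter c A i p * wmat n A w p j)"

text \<open>The word of the transposed product: the order is reversed and every letter is switched,
  see \<open>wmat_flip\<close>.\<close>

definition flip :: "bool list \<Rightarrow> bool list" where
  "flip w = rev (map Not w)"

definition ntr :: "nat \<Rightarrow> (nat \<Rightarrow> nat \<Rightarrow> real) \<Rightarrow> bool list \<Rightarrow> real" where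
  "ntr n A w = (\<Sum>i<n. wmat n A w i i) / real n"

lemma length_flip [simp]: "length (flip w) = length w"
  by (simp add: flip_def)

lemma flip_simps [simp]: "flip [] = []" "flip (c # w) = flip w @ [\<not> c]"
  by (simp_all add: flip_def)

lemma flip_replicate [simp]: "flip (replicate k c) = replicate k (\<not> c)"
  by (simp add: flip_def)

lemma wmat_append:
  "i < n \<Longrightarrow> wmat n A (u @ v) i j = (\<Sum>r<n. wmat n A u i r * wmat n A v r j)"
proof (induction u arbitrary: i)
  case Nil
  then show ?case by (simp add: if_distrib[of "\<lambda>x. x * _"] sum.delta cong: if_cong)
next
  case (Cons c u)
  have "wmat n A ((c # u) @ v) i j = (\<Sum>p<n. \<Sum>r<n. letter c A i p * (wmat n A u p r * wmat n A v r j))"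
    using Cons.IH by (simp add: sum_distrib_left)
  also have "\<dots> = (\<Sum>r<n. \<Sum>p<n. letter c A i p * (wmat n A u p r * wmat n A v r j))"
    by (rule sum.swap)
  finally show ?case by (simp add: sum_distrib_right mult.assoc)
qed

lemma wmat_single: "j < n \<Longrightarrow> wmat n A [c] i j = letter c A i j"
  by (simp add: if_distrib[of "\<lambda>x. _ * x"] sum.delta cong: if_cong)

lemma wmat_flip: "i < n \<Longrightarrow> j < n \<Longrightarrow> wmat n A (flip w) i j = wmat n A w j i"
proof (induction w arbitrary: i j)
  case (Cons c w)
  have "wmat n A (flip (c # w)) i j = (\<Sum>r<n. wmat n A w r i * letter (\<not> c) A r j)"
    using Cons by (simp add: wmat_append wmat_single del: wmat.simps(2))
  then show ?case by (auto simp: letter_def mult.commute intro!: sum.cong)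
qed auto

lemma ntr_Nil [simp]: "n \<ge> 1 \<Longrightarrow> ntr n A [] = 1"
  by (simp add: ntr_def)

lemma ntr_append:
  "(\<Sum>i<n. \<Sum>j<n. wmat n A u i j * wmat n A v j i) = real n * ntr n A (u @ v)"
  by (cases "n = 0") (simp_all add: ntr_def wmat_append)

lemma wmat_scale: "wmat n (\<lambda>i j. a * A i j) w i j = a ^ length w * wmat n A w i j"
proof (induction w arbitrary: i)
  case (Cons c w)
  then show ?case by (auto simp: letter_def sum_distrib_left mult_ac intro!: sum.cong)
qed simp

section \<open>Differentiating words and traces in one entry\<close>

fun splits :: "bool list \<Rightarrow> (bool list \<times> bool \<times> bool list) list" where
  "splits [] = []"
| "splits (c # w) = ([], c, w) # map (\<lambda>(u, c', v). (c # u, c', v)) (splits w)"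

lemma splits_length: "(u, c, v) \<in> set (splits w) \<Longrightarrow> length w = length u + length v + 1"
  by (induction w arbitrary: u) auto

lemma splits_append:
  "splits (x @ y) = map (\<lambda>(u, c, v). (u, c, v @ y)) (splits x) @ map (\<lambda>(u, c, v). (x @ u, c, v)) (splits y)"
  by (induction x) (auto simp: case_prod_unfold comp_def)

lemma splits_replicate:
  "splits (replicate k c) = map (\<lambda>d. (replicate d c, c, replicate (k - 1 - d) c)) [0..<k]"
proof (induction k)
  case (Suc k)
  show ?case
  proof (subst upt_conv_Cons)
    show "splits (replicate (Suc k) c) = map (\<lambda>d. (replicate d c, c, replicate (Suc k - 1 - d) c)) (0 # [Suc 0..<Suc k])"
      using Suc unfolding map_Suc_upt[symmetric] by (auto simp: comp_def)
  qed simp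
qed simp

lemma sum_sum_list_swap: "(\<Sum>a\<in>S. \<Sum>x\<leftarrow>xs. f a x) = (\<Sum>x\<leftarrow>xs. \<Sum>a\<in>S. f a x :: real)"
  by (induction xs) (auto simp: sum.distrib)

lemma sum_list_divide: "(\<Sum>x\<leftarrow>xs. f x) / a = (\<Sum>x\<leftarrow>xs. f x / a :: real)"
  by (induction xs) (auto simp: add_divide_distrib)

text \<open>Overwrites exactly the entry that \<open>letter c A i j\<close> reads. Words beginning
  with the matrix and words beginning with its transpose are thereby covered by one
  computation.\<close>

definition upd_letter :: "bool \<Rightarrow> (nat \<Rightarrow> nat \<Rightarrow> real) \<Rightarrow> nat \<Rightarrow> nat \<Rightarrow> real \<Rightarrow> nat \<Rightarrow> nat \<Rightarrow> real" where
  "upd_letter c A i j a = (if c then upd2 A i j a else upd2 A j i a)"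

lemma upd_letter_same [simp]: "upd_letter c A i j (letter c A i j) = A"
  by (auto simp: upd_letter_def upd2_def letter_def fun_eq_iff)

text \<open>The contribution of one occurrence \<open>c'\<close> to the derivative of the (p, q)
  entry of a word: removing the letter leaves the words before and after it, joined at (i, j) if the
  letter is \<open>c\<close> and at (j, i) if it is the opposite one.\<close>

definition split_term where
  "split_term n A c i j p q = (\<lambda>(u, c', v). if c' = c then wmat n A u p i * wmat n A v j q
     else wmat n A u p j * wmat n A v i q)"

lemma letter_derivative:
  "((\<lambda>a. letter c' (upd_letter c A i j a) p q) has_real_derivative
     (if c' = c then (if p = i \<and> q = j then 1 else 0) else (if p = j \<and> q = i then 1 else 0)))
     (at (letter c A i j))"
proof -
  define hit where "hit \<longleftrightarrow> (if c' = c then p = i \<and> q = j else p = j \<and> q = i)"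
  have "letter c' (upd_letter c A i j a) p q = (if hit then a else letter c' A p q)" for a
    by (cases c; cases c') (auto simp: letter_def upd_letter_def upd2_def hit_def)
  then have "((\<lambda>a. letter c' (upd_letter c A i j a) p q) has_real_derivative (if hit then 1 else 0))
     (at (letter c A i j))"
    by (cases hit) auto
  also have "(if hit then 1 else 0 :: real)
     = (if c' = c then (if p = i \<and> q = j then 1 else 0) else (if p = j \<and> q = i then 1 else 0))"
    by (simp add: hit_def)
  finally show ?thesis .
qed

text \<open>The Leibniz rule: each occurrence of a letter is replaced in turn by an elementary
  matrix or its transpose, and \<open>splits\<close> enumerates the occurrences.\<close>

lemma wmat_derivative:
  assumes "i < n" "j < n"
  shows "((\<lambda>a. wmat n (upd_letter c A i j a) w p q) has_real_derivative
     (\<Sum>s\<leftarrow>splits w. split_term n A c i j p q s)) (at (letter c A i j))"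
proof (induction w arbitrary: p)
  case Nil
  show ?case by simp
next
  case (Cons c' w)
  let ?dl = "\<lambda>r. if c' = c then (if p = i \<and> r = j then 1 else 0) else (if p = j \<and> r = i then 1 else 0 :: real)"
  have "((\<lambda>a. \<Sum>r<n. letter c' (upd_letter c A i j a) p r * wmat n (upd_letter c A i j a) w r q) has_real_derivative
     (\<Sum>r<n. ?dl r * wmat n A w r q + letter c' A p r * (\<Sum>s\<leftarrow>splits w. split_term n A c i j r q s))) (at (letter c A i j))"
  proof (rule DERIV_sum)
    fix r
    show "((\<lambda>a. letter c' (upd_letter c A i j a) p r * wmat n (upd_letter c A i j a) w r q) has_real_derivative
     ?dl r * wmat n A w r q + letter c' A p r * (\<Sum>s\<leftarrow>splits w. split_term n A c i j r q s)) (at (letter c A i j))"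
      using DERIV_mult[OF letter_derivative[of c' c A i j p r] Cons.IH[of r]]
      by (simp only: upd_letter_same mult.commute)
  qed
  moreover have "(\<Sum>r<n. ?dl r * wmat n A w r q) = split_term n A c i j p q ([], c', w)"
  proof -
    have delta: "(\<Sum>r<n. (if p = i' \<and> r = j' then 1 else 0) * wmat n A w r q)
        = (if p = i' then wmat n A w j' q else 0)" if "j' < n" for i' j'
    proof (cases "p = i'")
      case True
      have "(\<Sum>r<n. (if r = j' then 1 else 0) * wmat n A w r q) = (\<Sum>r<n. if r = j' then wmat n A w r q else 0)"
        by (intro sum.cong) simp_all
      then show ?thesis using True that by simp
    qed simp
    show ?thesis
    proof (cases "c' = c")
      case True
      have "split_term n A c i j p q ([], c', w) = (if p = i then wmat n A w j q else 0)"
        using True by (simp add: split_term_def)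
      then show ?thesis using delta[OF assms(2), of i] by (simp only: True refl if_True)
    next
      case False
      have "split_term n A c i j p q ([], c', w) = (if p = j then wmat n A w i q else 0)"
        using False by (simp add: split_term_def)
      then show ?thesis using delta[OF assms(1), of j] by (simp only: False if_False)
    qed
  qed
  moreover have "(\<Sum>r<n. letter c' A p r * (\<Sum>s\<leftarrow>splits w. split_term n A c i j r q s))
     = (\<Sum>s\<leftarrow>splits w. split_term n A c i j p q (case s of (u, d, v) \<Rightarrow> (c' # u, d, v)))"
  proof -
    have "(\<Sum>r<n. letter c' A p r * (\<Sum>s\<leftarrow>splits w. split_term n A c i j r q s))
        = (\<Sum>s\<leftarrow>splits w. \<Sum>r<n. letter c' A p r * split_term n A c i j r q s)"
      unfolding sum_list_const_mult[symmetric] sum_sum_list_swap ..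
    also have "\<dots> = (\<Sum>s\<leftarrow>splits w. split_term n A c i j p q (case s of (u, d, v) \<Rightarrow> (c' # u, d, v)))"
      by (intro arg_cong[where f = sum_list] map_cong refl)
         (auto simp: split_term_def sum_distrib_right mult.assoc)
    finally show ?thesis .
  qed
  moreover have "(\<Sum>s\<leftarrow>splits (c' # w). split_term n A c i j p q s) = split_term n A c i j p q ([], c', w)
     + (\<Sum>s\<leftarrow>splits w. split_term n A c i j p q (case s of (u, d, v) \<Rightarrow> (c' # u, d, v)))"
    by (simp add: comp_def)
  ultimately show ?case unfolding sum.distrib wmat.simps(2) by (simp only:)
qed

text \<open>Under the trace the two remaining pieces close up cyclically, which is why
  \<open>v\<close> comes before \<open>u\<close>.\<close>

definition ntr_split_term where
  "ntr_split_term n A c i j = (\<lambda>(u, c', v). (if c' = c then wmat n A (v @ u) j i else wmat n A (v @ u) i j) / real n)"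

lemma ntr_derivative:
  assumes "i < n" "j < n"
  shows "((\<lambda>a. ntr n (upd_letter c A i j a) w) has_real_derivative
     (\<Sum>s\<leftarrow>splits w. ntr_split_term n A c i j s)) (at (letter c A i j))"
proof -
  have "((\<lambda>a. ntr n (upd_letter c A i j a) w) has_real_derivative
     (\<Sum>p<n. \<Sum>s\<leftarrow>splits w. split_term n A c i j p p s) / real n) (at (letter c A i j))"
    unfolding ntr_def by (intro DERIV_cdivide DERIV_sum wmat_derivative assms)
  also have "(\<Sum>p<n. \<Sum>s\<leftarrow>splits w. split_term n A c i j p p s) / real n
     = (\<Sum>s\<leftarrow>splits w. ntr_split_term n A c i j s)"
    unfolding sum_sum_list_swap sum_list_divide
    by (intro arg_cong[where f = sum_list] map_cong refl)
       (auto simp: split_term_def ntr_split_term_def wmat_append assms mult.commute)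
  finally show ?thesis .
qed

fun ntr_prod_deriv where
  "ntr_prod_deriv n A c i j [] = 0"
| "ntr_prod_deriv n A c i j (w # ws) =
     (\<Sum>s\<leftarrow>splits w. ntr_split_term n A c i j s) * (\<Prod>w\<leftarrow>ws. ntr n A w)
     + ntr n A w * ntr_prod_deriv n A c i j ws"

lemma ntr_prod_derivative:
  assumes "i < n" "j < n"
  shows "((\<lambda>a. \<Prod>w\<leftarrow>ws. ntr n (upd_letter c A i j a) w) has_real_derivative
     ntr_prod_deriv n A c i j ws) (at (letter c A i j))"
proof (induction ws)
  case (Cons w ws)
  show ?case
    using DERIV_mult[OF ntr_derivative[OF assms] Cons]
    by (simp add: mult.commute)
qed simp

text \<open>Pairing a letter \<open>c\<close>, followed by \<open>w\<close> in one trace, with a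
  letter of another trace joins the two traces. An equal letter reverses the orientation of
  \<open>w\<close>, an opposite one keeps it.\<close>

definition merged :: "bool \<Rightarrow> bool list \<Rightarrow> bool list \<times> bool \<times> bool list \<Rightarrow> bool list" where
  "merged c w = (\<lambda>(u, c', v). (if c' = c then flip w else w) @ v @ u)"

fun cross :: "bool \<Rightarrow> bool list \<Rightarrow> bool list list \<Rightarrow> bool list list list" where
  "cross c w [] = []"
| "cross c w (x # xs) = map (\<lambda>s. merged c w s # xs) (splits x) @ map ((#) x) (cross c w xs)"

lemma sum_wmat_ntr_split_term:
  assumes "n \<ge> 1"
  shows "(\<Sum>i<n. \<Sum>j<n. wmat n A w j i * ntr_split_term n A c i j s) = ntr n A (merged c w s)"
proof -
  obtain u c' v where s: "s = (u, c', v)" by (cases s) auto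
  have "(\<Sum>i<n. \<Sum>j<n. wmat n A w j i * ntr_split_term n A c i j s)
    = (if c' = c then (\<Sum>i<n. \<Sum>j<n. wmat n A (flip w) i j * wmat n A (v @ u) j i)
       else (\<Sum>j<n. \<Sum>i<n. wmat n A w j i * wmat n A (v @ u) i j)) / real n"
    unfolding s ntr_split_term_def
    by (auto simp: sum_divide_distrib wmat_flip intro: sum.swap)
  also have "\<dots> = ntr n A (merged c w s)"
    using assms by (simp add: ntr_append s merged_def)
  finally show ?thesis .
qed

lemma sum_wmat_ntr_prod_deriv:
  assumes "n \<ge> 1"
  shows "(\<Sum>i<n. \<Sum>j<n. wmat n A w j i * ntr_prod_deriv n A c i j ws)
       = (\<Sum>zs\<leftarrow>cross c w ws. \<Prod>z\<leftarrow>zs. ntr n A z)"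
proof (induction ws)
  case (Cons x xs)
  have "(\<Sum>i<n. \<Sum>j<n. wmat n A w j i * ntr_prod_deriv n A c i j (x # xs))
     = (\<Sum>i<n. \<Sum>j<n. \<Sum>s\<leftarrow>splits x. wmat n A w j i * ntr_split_term n A c i j s) * (\<Prod>w\<leftarrow>xs. ntr n A w)
       + ntr n A x * (\<Sum>i<n. \<Sum>j<n. wmat n A w j i * ntr_prod_deriv n A c i j xs)"
    by (simp add: distrib_left sum.distrib sum_distrib_left sum_distrib_right sum_list_const_mult mult_ac)
  also have "(\<Sum>i<n. \<Sum>j<n. \<Sum>s\<leftarrow>splits x. wmat n A w j i * ntr_split_term n A c i j s)
      = (\<Sum>s\<leftarrow>splits x. ntr n A (merged c w s))"
    unfolding sum_sum_list_swap by (simp add: sum_wmat_ntr_split_term[OF assms])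
  finally show ?case
    unfolding Cons by (simp add: comp_def sum_list_mult_const[symmetric] sum_list_const_mult[symmetric])
qed simp

text \<open>A pairing inside one trace: an opposite letter leaves two free index loops and thus a
  product of two traces, an equal letter leaves only one loop. The missing loop is the relative
  factor 1/n.\<close>

lemma sum_split_term:
  assumes "n \<ge> 1"
  shows "(\<Sum>i<n. \<Sum>j<n. split_term n A c i j j i s)
    = real n ^ 2 * (case s of (u, c', v) \<Rightarrow> if c' = c then ntr n A (flip u @ v) / real n else ntr n A u * ntr n A v)"
proof -
  obtain u c' v where s: "s = (u, c', v)" by (cases s) auto
  show ?thesis
  proof (cases "c' = c")
    case True
    have "(\<Sum>i<n. \<Sum>j<n. split_term n A c i j j i s)
        = (\<Sum>i<n. \<Sum>j<n. wmat n A (flip u) i j * wmat n A v j i)"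
      unfolding s split_term_def using True by (simp add: wmat_flip)
    then show ?thesis using True assms by (simp add: ntr_append s power2_eq_square)
  next
    case False
    have "(\<Sum>i<n. \<Sum>j<n. split_term n A c i j j i s)
        = (\<Sum>j<n. wmat n A u j j) * (\<Sum>i<n. wmat n A v i i)"
      unfolding s split_term_def using False
      by (subst sum.swap) (simp add: sum_product)
    then show ?thesis using False assms by (simp add: s ntr_def power2_eq_square)
  qed
qed

section \<open>Loop equations for trace moments\<close>

lemma bigo_sum_list:
  assumes "\<And>x. x \<in> set xs \<Longrightarrow> f x \<in> O[F](h)"
  shows "(\<lambda>n. \<Sum>x\<leftarrow>xs. f x n :: real) \<in> O[F](h)"
  using assms by (induction xs) (auto intro!: sum_in_bigo)

lemma bigo_cmult:
  fixes f :: "'b \<Rightarrow> real"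
  shows "f \<in> O[F](h) \<Longrightarrow> (\<lambda>n. a * f n) \<in> O[F](h)"
  by (cases "a = 0") simp_all

lemma bigo_cong_ge1:
  fixes f g :: "nat \<Rightarrow> real"
  assumes "g \<in> O(h)" and "\<And>n. n \<ge> 1 \<Longrightarrow> f n = g n"
  shows "f \<in> O(h)"
proof -
  have "eventually (\<lambda>n. f n = g n) sequentially"
    using eventually_ge_at_top[of 1] by eventually_elim (rule assms(2))
  from landau_o.big.in_cong[OF this] assms(1) show ?thesis by simp
qed

lemma tendsto_cong_ge1:
  fixes f g :: "nat \<Rightarrow> real"
  assumes "g \<longlonglongrightarrow> l" and "\<And>n. n \<ge> 1 \<Longrightarrow> f n = g n"
  shows "f \<longlonglongrightarrow> l"
proof -
  have "eventually (\<lambda>n. g n = f n) sequentially"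
    using eventually_ge_at_top[of 1] by eventually_elim (rule assms(2)[symmetric])
  from Lim_transform_eventually[OF assms(1) this] show ?thesis .
qed

text \<open>The trace moments of a Gaussian matrix, seen abstractly as a solution of the
  loop (Schwinger--Dyson) equations obtained by integration by parts.\<close>

locale loop_equations =
  fixes Mo :: "nat \<Rightarrow> bool list list \<Rightarrow> real" and \<nu> :: real
  assumes Mo_Nil: "n \<ge> 1 \<Longrightarrow> Mo n [] = 1"
    and Mo_empty: "n \<ge> 1 \<Longrightarrow> Mo n ([] # ws) = Mo n ws"
    and Mo_step: "n \<ge> 1 \<Longrightarrow> Mo n ((c # w) # ws) =
      \<nu> * ((\<Sum>(u, c', v)\<leftarrow>splits w. if c' = c then Mo n ((flip u @ v) # ws) / real n else Mo n (u # v # ws))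
          + (\<Sum>zs\<leftarrow>cross c w ws. Mo n zs) / real n ^ 2)"
begin

text \<open>The \<open>+ 1\<close> per word makes the size drop when an empty word is removed. It
  still drops when a pair of letters is removed and one word becomes two, since two letters
  disappear and only one new word appears.\<close>

definition wsize :: "bool list list \<Rightarrow> nat" where
  "wsize ws = (\<Sum>w\<leftarrow>ws. length w + 1)"

lemma wsize_simps [simp]: "wsize [] = 0" "wsize (w # ws) = length w + 1 + wsize ws"
  by (simp_all add: wsize_def)

lemma merged_length: "s \<in> set (splits x) \<Longrightarrow> length (merged c w s) + 1 = length w + length x"
  by (cases s) (auto simp: merged_def dest: splits_length)

lemma wsize_cross: "zs \<in> set (cross c w ws) \<Longrightarrow> wsize zs < wsize ((c # w) # ws)"
proof (induction ws arbitrary: zs)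
  case (Cons x xs)
  then consider s where "s \<in> set (splits x)" "zs = merged c w s # xs"
    | ys where "ys \<in> set (cross c w xs)" "zs = x # ys" by auto
  then show ?case
  proof cases
    case 1
    then show ?thesis using merged_length[of s x c w] by simp
  next
    case 2
    then show ?thesis using Cons.IH[of ys] by simp
  qed
qed simp

lemma wsize_splits:
  assumes "(u, c', v) \<in> set (splits w)"
  shows "wsize ((flip u @ v) # ws) < wsize ((c # w) # ws)" "wsize (u # v # ws) < wsize ((c # w) # ws)"
  using splits_length[OF assms] by simp_all

lemma ev_ge1: "eventually (\<lambda>n::nat. n \<ge> 1) sequentially"
  by (rule eventually_ge_at_top)

lemma inverse_in_bigo_1: "(\<lambda>n. 1 / real n ^ k) \<in> O(\<lambda>_. 1)"
proof (rule bigoI[of _ 1])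
  show "\<forall>\<^sub>F n in sequentially. norm (1 / real n ^ k) \<le> 1 * norm (1 :: real)"
    using ev_ge1 by eventually_elim (simp add: divide_simps one_le_power)
qed

text \<open>All coefficients of the recursion \<open>Mo_step\<close> are bounded in n, and every
  term on its right has smaller \<open>wsize\<close>.\<close>

lemma Mo_bounded: "(\<lambda>n. Mo n ws) \<in> O(\<lambda>_. 1)"
proof (induction ws rule: measure_induct_rule[of wsize])
  case (less ws)
  show ?case
  proof (cases ws)
    case Nil
    have "(\<lambda>n. 1 :: real) \<in> O(\<lambda>_. 1)" by simp
    then show ?thesis by (rule bigo_cong_ge1) (simp add: Nil Mo_Nil)
  next
    case (Cons x xs)
    show ?thesis
    proof (cases x)
      case Nil
      have "(\<lambda>n. Mo n xs) \<in> O(\<lambda>_. 1)" using less Cons by simp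
      then show ?thesis
        by (rule bigo_cong_ge1)
           (simp add: Cons Nil Mo_empty)
    next
      case (Cons c w)
      note ws = \<open>ws = x # xs\<close>[unfolded Cons]
      have d: "(\<lambda>n. g n / real n ^ k) \<in> O(\<lambda>_. 1)" if "g \<in> O(\<lambda>_. 1)" for g k
        using landau_o.big.mult[OF that inverse_in_bigo_1[of k]] by simp
      have "(\<lambda>n. \<nu> * ((\<Sum>(u, c', v)\<leftarrow>splits w. if c' = c then Mo n ((flip u @ v) # xs) / real n else Mo n (u # v # xs))
          + (\<Sum>zs\<leftarrow>cross c w xs. Mo n zs) / real n ^ 2)) \<in> O(\<lambda>_. 1)"
      proof (intro bigo_cmult sum_in_bigo bigo_sum_list d)
        fix s assume s: "s \<in> set (splits w)"
        obtain u c' v where s': "s = (u, c', v)" by (cases s) auto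
        have "(\<lambda>n. Mo n ((flip u @ v) # xs) / real n ^ 1) \<in> O(\<lambda>_. 1)" "(\<lambda>n. Mo n (u # v # xs)) \<in> O(\<lambda>_. 1)"
          using wsize_splits[OF s[unfolded s'], of xs c] by (intro less d; simp add: ws)+
        then show "(\<lambda>n. case s of (u, c', v) \<Rightarrow> if c' = c then Mo n ((flip u @ v) # xs) / real n else Mo n (u # v # xs)) \<in> O(\<lambda>_. 1)"
          by (cases "c' = c") (simp_all add: s')
      next
        fix zs assume "zs \<in> set (cross c w xs)"
        then show "(\<lambda>n. Mo n zs) \<in> O(\<lambda>_. 1)" using wsize_cross[of zs c w xs] by (intro less) (simp add: ws)
      qed
      then show ?thesis
        by (rule bigo_cong_ge1)
           (simp add: ws Mo_step)
    qed
  qed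
qed

text \<open>The recursions for \<open>Mo n (ws @ us)\<close> and for
  \<open>Mo n ws * Mo n us\<close> have the same split terms, so their difference obeys the same
  recursion in \<open>ws\<close>. Pairings with other traces, including those with
  \<open>us\<close>, occur only in the cross terms; these are bounded and carry the weight 1/n^2,
  which becomes the order of the error.\<close>

lemma Mo_covariance: "(\<lambda>n. Mo n (ws @ us) - Mo n ws * Mo n us) \<in> O(\<lambda>n. 1 / real n ^ 2)"
proof (induction ws rule: measure_induct_rule[of wsize])
  case (less ws)
  define D where "D ws n = Mo n (ws @ us) - Mo n ws * Mo n us" for ws n
  have IH: "D ws' \<in> O(\<lambda>n. 1 / real n ^ 2)" if "wsize ws' < wsize ws" for ws'
    using less[OF that] unfolding D_def .
  have "D ws \<in> O(\<lambda>n. 1 / real n ^ 2)"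
  proof (cases ws)
    case Nil
    have "(\<lambda>n. 0 :: real) \<in> O(\<lambda>n. 1 / real n ^ 2)" by simp
    then show ?thesis
      by (rule bigo_cong_ge1)
         (simp add: Nil D_def Mo_Nil)
  next
    case (Cons x xs)
    show ?thesis
    proof (cases x)
      case Nil
      have "D xs \<in> O(\<lambda>n. 1 / real n ^ 2)" by (rule IH) (simp add: Cons)
      then show ?thesis
        by (rule bigo_cong_ge1)
           (simp add: D_def Cons Nil Mo_empty)
    next
      case (Cons c w)
      note ws = \<open>ws = x # xs\<close>[unfolded Cons]
      have d: "(\<lambda>n. g n / real n ^ 1) \<in> O(\<lambda>n. 1 / real n ^ 2)" if "g \<in> O(\<lambda>n. 1 / real n ^ 2)" for g
        using landau_o.big.mult[OF that inverse_in_bigo_1[of 1]] by simp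
      have d2: "(\<lambda>n. g n / real n ^ 2) \<in> O(\<lambda>n. 1 / real n ^ 2)" if "g \<in> O(\<lambda>n. 1)" for g
        using landau_o.big.mult[OF that, of "\<lambda>n. 1 / real n ^ 2" "\<lambda>n. 1 / real n ^ 2"] by simp
      have "(\<lambda>n. \<nu> * ((\<Sum>(u, c', v)\<leftarrow>splits w. if c' = c then D ((flip u @ v) # xs) n / real n else D (u # v # xs) n)
          + ((\<Sum>zs\<leftarrow>cross c w (xs @ us). Mo n zs) - (\<Sum>zs\<leftarrow>cross c w xs. Mo n zs) * Mo n us) / real n ^ 2)) \<in> O(\<lambda>n. 1 / real n ^ 2)"
      proof (intro bigo_cmult sum_in_bigo(1) bigo_sum_list d2)
        fix s assume s: "s \<in> set (splits w)"
        obtain u c' v where s': "s = (u, c', v)" by (cases s) auto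
        have "(\<lambda>n. D ((flip u @ v) # xs) n / real n ^ 1) \<in> O(\<lambda>n. 1 / real n ^ 2)" "D (u # v # xs) \<in> O(\<lambda>n. 1 / real n ^ 2)"
          using wsize_splits[OF s[unfolded s'], of xs c] by (intro IH d; simp add: ws)+
        then show "(\<lambda>n. case s of (u, c', v) \<Rightarrow> if c' = c then D ((flip u @ v) # xs) n / real n else D (u # v # xs) n) \<in> O(\<lambda>n. 1 / real n ^ 2)"
          by (cases "c' = c") (simp_all add: s')
      next
        show "(\<lambda>n. (\<Sum>zs\<leftarrow>cross c w (xs @ us). Mo n zs) - (\<Sum>zs\<leftarrow>cross c w xs. Mo n zs) * Mo n us) \<in> O(\<lambda>n. 1)"
          using landau_o.big.mult[OF bigo_sum_list Mo_bounded, of "cross c w xs" "\<lambda>zs n. Mo n zs" "\<lambda>_. 1" us]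
          by (intro sum_in_bigo(2) bigo_sum_list Mo_bounded) (simp_all add: Mo_bounded)
      qed
      moreover have "D ws n = \<nu> * ((\<Sum>(u, c', v)\<leftarrow>splits w. if c' = c then D ((flip u @ v) # xs) n / real n else D (u # v # xs) n)
          + ((\<Sum>zs\<leftarrow>cross c w (xs @ us). Mo n zs) - (\<Sum>zs\<leftarrow>cross c w xs. Mo n zs) * Mo n us) / real n ^ 2)"
        if "n \<ge> 1" for n
      proof -
        have key: "(\<Sum>(u, c', v)\<leftarrow>splits w. if c' = c then D ((flip u @ v) # xs) n / real n else D (u # v # xs) n)
          = (\<Sum>(u, c', v)\<leftarrow>splits w. if c' = c then Mo n ((flip u @ v) # xs @ us) / real n else Mo n (u # v # xs @ us))
          - (\<Sum>(u, c', v)\<leftarrow>splits w. if c' = c then Mo n ((flip u @ v) # xs) / real n else Mo n (u # v # xs)) * Mo n us"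
          unfolding sum_list_mult_const[symmetric] sum_list_subtractf[symmetric]
          by (intro arg_cong[where f = sum_list] map_cong refl) (auto simp: D_def diff_divide_distrib)
        have "D ws n = Mo n ((c # w) # (xs @ us)) - Mo n ((c # w) # xs) * Mo n us"
          by (simp add: D_def ws)
        then show ?thesis
          unfolding key Mo_step[OF that] by (simp add: algebra_simps diff_divide_distrib)
      qed
      ultimately show ?thesis
        by (rule bigo_cong_ge1)
    qed
  qed
  then show ?case unfolding D_def .
qed

lemma bigo_inverse_tendsto: 
  assumes "g \<in> O(\<lambda>n. 1 / real n ^ Suc k)" shows "g \<longlonglongrightarrow> 0"
proof -
  have "(\<lambda>n. 1 / real n ^ Suc k) \<longlonglongrightarrow> 0"
    using tendsto_power[OF lim_1_over_n[where ?'a = real], of "Suc k"] by (simp add: power_one_over del: power_Suc)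
  then have "(\<lambda>n. 1 / real n ^ Suc k) \<in> o(\<lambda>_. 1)" by (intro smalloI_tendsto) auto
  from landau_o.big_small_trans[OF assms this] show ?thesis
    by (auto dest: smalloD_tendsto)
qed

lemma Mo_div_tendsto_0: "(\<lambda>n. Mo n ws / real n) \<longlonglongrightarrow> 0"
  using landau_o.big.mult[OF Mo_bounded[of ws], of "\<lambda>n. 1 / real n" "\<lambda>n. 1 / real n"]
  by (intro bigo_inverse_tendsto[of _ 0]) simp

lemma tendsto_sum_list:
  "(\<And>x. x \<in> set xs \<Longrightarrow> ((\<lambda>n. f n x) \<longlongrightarrow> g x) F) \<Longrightarrow> ((\<lambda>n. \<Sum>x\<leftarrow>xs. f n x :: real) \<longlongrightarrow> (\<Sum>x\<leftarrow>xs. g x)) F"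
proof (induction xs)
  case (Cons x xs)
  then show ?case by (simp add: tendsto_add)
qed simp

text \<open>In a word with a single kind of letter the first letter can be paired with equal letters
  only, and each such pairing costs a factor 1/n.\<close>

lemma Mo_power_tendsto: "(\<lambda>n. Mo n [replicate k c]) \<longlonglongrightarrow> (if k = 0 then 1 else 0)"
proof (cases k)
  case 0
  have "(\<lambda>n. 1::real) \<longlonglongrightarrow> 1" by (rule tendsto_const)
  then have "(\<lambda>n. Mo n [replicate k c]) \<longlonglongrightarrow> 1"
    by (rule tendsto_cong_ge1) (simp add: 0 Mo_empty Mo_Nil)
  then show ?thesis using 0 by simp
next
  case (Suc k')
  have "(\<lambda>n. \<nu> * ((\<Sum>d\<leftarrow>[0..<k']. Mo n [replicate d (\<not> c) @ replicate (k' - 1 - d) c] / real n))) \<longlonglongrightarrow> \<nu> * (\<Sum>d\<leftarrow>[0..<k']. 0)"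
    by (intro tendsto_intros tendsto_sum_list Mo_div_tendsto_0)
  then have "(\<lambda>n. \<nu> * ((\<Sum>d\<leftarrow>[0..<k']. Mo n [replicate d (\<not> c) @ replicate (k' - 1 - d) c] / real n))) \<longlonglongrightarrow> (if k = 0 then 1 else 0)"
    using Suc by simp
  then show ?thesis
    by (rule tendsto_cong_ge1) (simp add: Suc Mo_step splits_replicate comp_def)
qed

text \<open>To leading order the first letter is paired with an opposite letter. If d opposite
  letters precede the partner, the two traces are those of c^b (not c)^d and of (not c)^(a-1-d). The
  second one vanishes in the limit unless d = a - 1, and the first one, by induction, unless d = b.
  So only a = b + 1 survives, with one additional factor \<nu>.\<close>

theorem Mo_mixed_tendsto:
  "(\<lambda>n. Mo n [replicate b c @ replicate a (\<not> c)]) \<longlonglongrightarrow> (if a = b then \<nu> ^ a else 0)"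
proof (induction b arbitrary: a)
  case 0
  then show ?case using Mo_power_tendsto[of a "\<not> c"] by (cases a) simp_all
next
  case (Suc b)
  let ?x = "replicate b c"
  \<comment> \<open>\<open>Mo_covariance\<close> replaces the moment of a product of two traces by
    the product of their moments, to which the induction hypothesis and
    \<open>Mo_power_tendsto\<close> apply.\<close>
  have prod: "(\<lambda>n. Mo n [?x @ replicate d (\<not> c), replicate (a - 1 - d) (\<not> c)]) \<longlonglongrightarrow>
      (if d = b then \<nu> ^ d else 0) * (if a - 1 - d = 0 then 1 else 0)" for d
  proof -
    have "(\<lambda>n. (Mo n ([?x @ replicate d (\<not> c)] @ [replicate (a - 1 - d) (\<not> c)])
         - Mo n [?x @ replicate d (\<not> c)] * Mo n [replicate (a - 1 - d) (\<not> c)])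
         + Mo n [?x @ replicate d (\<not> c)] * Mo n [replicate (a - 1 - d) (\<not> c)]) \<longlonglongrightarrow>
        0 + (if d = b then \<nu> ^ d else 0) * (if a - 1 - d = 0 then 1 else 0)"
      using Mo_covariance unfolding numeral_2_eq_2
      by (intro tendsto_add tendsto_mult Suc Mo_power_tendsto bigo_inverse_tendsto)
    then show ?thesis by simp
  qed
  have sum: "(\<lambda>n. \<Sum>d\<leftarrow>[0..<a]. Mo n [?x @ replicate d (\<not> c), replicate (a - 1 - d) (\<not> c)]) \<longlonglongrightarrow>
      (\<Sum>d\<leftarrow>[0..<a]. (if d = b then \<nu> ^ d else 0) * (if a - 1 - d = 0 then 1 else 0))"
    by (intro tendsto_sum_list prod)
  have "(\<Sum>d\<leftarrow>[0..<a]. (if d = b then \<nu> ^ d else 0) * (if a - 1 - d = 0 then 1 else 0))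
      = (\<Sum>d<a. if d = b then (if a - 1 - d = 0 then \<nu> ^ d else 0) else 0)"
    by (subst sum_list_distinct_conv_sum_set, simp, unfold set_upt atLeast0LessThan, intro sum.cong) auto
  also have "\<dots> = (if a = Suc b then \<nu> ^ b else 0)"
    by (subst sum.delta) auto
  finally have val: "(\<Sum>d\<leftarrow>[0..<a]. (if d = b then \<nu> ^ d else 0) * (if a - 1 - d = 0 then 1 else 0))
     = (if a = Suc b then \<nu> ^ b else 0)" .
  have "(\<lambda>n. \<nu> * ((\<Sum>s\<leftarrow>splits ?x. Mo n [flip (fst s) @ snd (snd s) @ replicate a (\<not> c)] / real n)
       + (\<Sum>d\<leftarrow>[0..<a]. Mo n [?x @ replicate d (\<not> c), replicate (a - 1 - d) (\<not> c)])))
     \<longlonglongrightarrow> \<nu> * ((\<Sum>s\<leftarrow>splits ?x. 0) + (if a = Suc b then \<nu> ^ b else 0))"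
    unfolding val[symmetric] by (intro tendsto_intros tendsto_sum_list Mo_div_tendsto_0 sum prod)
  then have "(\<lambda>n. \<nu> * ((\<Sum>s\<leftarrow>splits ?x. Mo n [flip (fst s) @ snd (snd s) @ replicate a (\<not> c)] / real n)
       + (\<Sum>d\<leftarrow>[0..<a]. Mo n [?x @ replicate d (\<not> c), replicate (a - 1 - d) (\<not> c)])))
     \<longlonglongrightarrow> (if a = Suc b then \<nu> ^ a else 0)"
    by (auto split: if_splits)
  then show ?case
  proof (rule tendsto_cong_ge1)
    fix n :: nat assume n: "n \<ge> 1"
    show "Mo n [replicate (Suc b) c @ replicate a (\<not> c)]
       = \<nu> * ((\<Sum>s\<leftarrow>splits ?x. Mo n [flip (fst s) @ snd (snd s) @ replicate a (\<not> c)] / real n)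
       + (\<Sum>d\<leftarrow>[0..<a]. Mo n [?x @ replicate d (\<not> c), replicate (a - 1 - d) (\<not> c)]))"
      using n by (simp add: Mo_step splits_append splits_replicate comp_def)
  qed
qed

end

section \<open>Concentration of traces and quadratic forms\<close>

context prob_space
begin

text \<open>The sum over n of the even powers has finite expectation, so it is almost surely finite
  and its terms tend to 0. Only the separate laws of the \<open>Z n\<close> enter. The shift to
  \<open>Suc n\<close> avoids n = 0, where integrability is not assumed.\<close>

lemma AE_tendsto_0_if_moments_summable:
  assumes int: "\<And>n. n \<ge> 1 \<Longrightarrow> integrable M (\<lambda>\<omega>. Z n \<omega> ^ (2 * k))" and k: "k \<ge> 1"
    and bigo: "(\<lambda>n. expectation (\<lambda>\<omega>. Z n \<omega> ^ (2 * k) :: real)) \<in> O(\<lambda>n. 1 / real n ^ 2)"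
  shows "AE \<omega> in M. (\<lambda>n. Z n \<omega>) \<longlonglongrightarrow> 0"
proof -
  let ?E = "\<lambda>n. expectation (\<lambda>\<omega>. Z (Suc n) \<omega> ^ (2 * k))"
  have pos: "0 \<le> Z n \<omega> ^ (2 * k)" for n \<omega> by (simp add: power_mult)
  have int': "integrable M (\<lambda>\<omega>. Z (Suc n) \<omega> ^ (2 * k))" for n by (rule int) simp
  have meas [measurable]: "(\<lambda>\<omega>. Z (Suc n) \<omega> ^ (2 * k)) \<in> borel_measurable M" for n
    using int' by (rule borel_measurable_integrable)
  have summ: "summable (\<lambda>n. expectation (\<lambda>\<omega>. Z n \<omega> ^ (2 * k)))"
    by (rule summable_comparison_test_bigo[OF _ bigo]) (use inverse_power_summable[of 2, where ?'a = real] in \<open>simp add: divide_inverse\<close>)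
  then have summ': "summable ?E" by (subst summable_Suc_iff)
  have "(\<integral>\<^sup>+\<omega>. (\<Sum>n. ennreal (Z (Suc n) \<omega> ^ (2 * k))) \<partial>M) = (\<Sum>n. \<integral>\<^sup>+\<omega>. ennreal (Z (Suc n) \<omega> ^ (2 * k)) \<partial>M)"
    by (rule nn_integral_suminf) measurable
  also have "\<dots> = (\<Sum>n. ennreal (?E n))"
    using int' pos by (intro suminf_cong nn_integral_eq_integral) auto
  also have "\<dots> = ennreal (\<Sum>n. ?E n)"
    using summ' by (intro suminf_ennreal2) (auto intro!: integral_nonneg_AE simp: pos)
  finally have "(\<integral>\<^sup>+\<omega>. (\<Sum>n. ennreal (Z (Suc n) \<omega> ^ (2 * k))) \<partial>M) \<noteq> \<infinity>" by simp
  then have "AE \<omega> in M. (\<Sum>n. ennreal (Z (Suc n) \<omega> ^ (2 * k))) \<noteq> \<infinity>"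
    by (intro nn_integral_noteq_infinite) measurable
  then show ?thesis
  proof eventually_elim
    case (elim \<omega>)
    then have "summable (\<lambda>n. Z (Suc n) \<omega> ^ (2 * k))"
      by (intro summable_suminf_not_top) (auto simp: pos)
    then have "(\<lambda>n. Z (Suc n) \<omega> ^ (2 * k)) \<longlonglongrightarrow> 0" by (rule summable_LIMSEQ_zero)
    then have "(\<lambda>n. Z (Suc n) \<omega>) \<longlonglongrightarrow> 0" using k by (subst (asm) power_tendsto_0_iff) auto
    then show ?case by (rule LIMSEQ_imp_Suc)
  qed
qed

lemma integral_double_sum:
  fixes f :: "nat \<Rightarrow> nat \<Rightarrow> 'a \<Rightarrow> real"
  assumes "\<And>i j. i < k \<Longrightarrow> j < l \<Longrightarrow> integrable M (f i j)"
  shows "expectation (\<lambda>\<omega>. \<Sum>i<k. \<Sum>j<l. f i j \<omega>) = (\<Sum>i<k. \<Sum>j<l. expectation (f i j))"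
  using assms by (subst Bochner_Integration.integral_sum) (auto intro!: sum.cong Bochner_Integration.integral_sum)

lemma integral_sum_list:
  fixes f :: "'b \<Rightarrow> 'a \<Rightarrow> real"
  assumes "\<And>x. x \<in> set xs \<Longrightarrow> integrable M (f x)"
  shows "integrable M (\<lambda>\<omega>. \<Sum>x\<leftarrow>xs. f x \<omega>) \<and> expectation (\<lambda>\<omega>. \<Sum>x\<leftarrow>xs. f x \<omega>) = (\<Sum>x\<leftarrow>xs. expectation (f x))"
  using assms by (induction xs) auto

end

text \<open>Whatever expression represents the partial derivative, uniqueness makes it a polynomial;
  this yields integrability of the derivatives computed by hand below.\<close>

lemma (in gaussian_family) polyfun_partial:
  assumes "polyfun I \<Phi>" "x \<in> I"
    and "\<And>g. ((\<lambda>a. \<Phi> (g(x := a))) has_real_derivative D g) (at (g x))"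
  shows "polyfun I D"
proof -
  obtain D' where D': "polyfun I D'" "\<And>g. ((\<lambda>a. \<Phi> (g(x := a))) has_real_derivative D' g) (at (g x))"
    using polyfun_has_partial[OF assms(1,2)] by blast
  have "D g = D' g" for g by (rule DERIV_unique[OF assms(3) D'(2)])
  then have "D = D'" by auto
  then show ?thesis using D'(1) by simp
qed

section \<open>Quadratic forms in Gaussian columns\<close>

definition matW :: "((nat \<times> nat) + (nat \<times> nat) \<Rightarrow> real) \<Rightarrow> nat \<Rightarrow> nat \<Rightarrow> real" where
  "matW g i j = g (Inl (i, j))"

definition matF :: "((nat \<times> nat) + (nat \<times> nat) \<Rightarrow> real) \<Rightarrow> nat \<Rightarrow> nat \<Rightarrow> real" where
  "matF g i m = g (Inr (i, m))"

definition wvec :: "nat \<Rightarrow> (nat \<Rightarrow> nat \<Rightarrow> real) \<Rightarrow> (nat \<Rightarrow> nat \<Rightarrow> real) \<Rightarrow> bool list \<Rightarrow> nat \<Rightarrow> nat \<Rightarrow> real" where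
  "wvec n A B w m i = (\<Sum>j<n. wmat n A w i j * B j m)"

definition qform :: "nat \<Rightarrow> (nat \<Rightarrow> nat \<Rightarrow> real) \<Rightarrow> (nat \<Rightarrow> nat \<Rightarrow> real) \<Rightarrow> nat \<Rightarrow> nat \<Rightarrow> bool list \<Rightarrow> real" where
  "qform n A B m m' w = (\<Sum>i<n. B i m * (wvec n A B w m' i / real n))"

text \<open>Inner products of the vectors that arise as derivatives are again quadratic forms, of
  longer words, so the moment identities below stay within one class of functions.\<close>

lemma qform_flip:
  "qform n A B m m' (flip u @ v) = (\<Sum>i<n. wvec n A B u m i * wvec n A B v m' i) / real n"
proof -
  let ?u = "wmat n A u" and ?v = "wmat n A v"
  have "(\<Sum>i<n. wvec n A B u m i * wvec n A B v m' i)
      = (\<Sum>r<n. \<Sum>i<n. \<Sum>j<n. B i m * (?u r i * ?v r j * B j m'))"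
    unfolding wvec_def sum_product by (simp add: mult_ac)
  also have "\<dots> = (\<Sum>i<n. \<Sum>r<n. \<Sum>j<n. B i m * (?u r i * ?v r j * B j m'))"
    by (rule sum.swap)
  also have "\<dots> = (\<Sum>i<n. \<Sum>j<n. \<Sum>r<n. B i m * (?u r i * ?v r j * B j m'))"
    by (intro sum.cong refl sum.swap)
  also have "\<dots> = (\<Sum>i<n. B i m * wvec n A B (flip u @ v) m' i)"
    unfolding wvec_def by (simp add: wmat_append wmat_flip sum_distrib_left sum_distrib_right)
  finally show ?thesis
    unfolding qform_def by (simp add: sum_divide_distrib[symmetric])
qed

text \<open>One index type carries both matrices: \<open>Inl\<close> the square matrix, already
  divided by sqrt n (hence the variance \<nu> / n), and \<open>Inr\<close> the n by d matrix whose
  columns enter the forms.\<close>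

locale gaussian_matrix =
  gaussian_family M "({..<n} \<times> {..<n}) <+> ({..<n} \<times> {..<d})" X "case_sum (\<lambda>_. \<nu> / real n) (\<lambda>_. \<eta>)"
  for M :: "'a measure" and n d :: nat and X and \<nu> \<eta> :: real +
  assumes n_pos: "n \<ge> 1"
begin

abbreviation "I0 \<equiv> ({..<n} \<times> {..<n}) <+> ({..<n} \<times> {..<d})"
abbreviation "AW \<omega> \<equiv> matW (XX \<omega>)"
abbreviation "BF \<omega> \<equiv> matF (XX \<omega>)"

lemma polyfun_letter: "i < n \<Longrightarrow> j < n \<Longrightarrow> polyfun I0 (\<lambda>g. letter c (matW g) i j)"
  unfolding letter_def matW_def by (intro polyfun_intros) auto

lemma polyfun_wmat: "i < n \<Longrightarrow> polyfun I0 (\<lambda>g. wmat n (matW g) w i j)"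
  by (induction w arbitrary: i) (auto intro!: polyfun_intros polyfun_letter)

lemma polyfun_ntr: "polyfun I0 (\<lambda>g. ntr n (matW g) w)"
  unfolding ntr_def by (intro polyfun_intros polyfun_wmat) auto

lemma polyfun_matF: "i < n \<Longrightarrow> m < d \<Longrightarrow> polyfun I0 (\<lambda>g. matF g i m)"
  unfolding matF_def by (intro polyfun_intros) auto

lemma polyfun_qform: "m < d \<Longrightarrow> m' < d \<Longrightarrow> polyfun I0 (\<lambda>g. qform n (matW g) (matF g) m m' w)"
  unfolding qform_def wvec_def by (intro polyfun_intros polyfun_wmat polyfun_matF) auto

lemma polyfun_ntr_prod: "polyfun I0 (\<lambda>g. \<Prod>w\<leftarrow>ws. ntr n (matW g) w)"
  by (intro polyfun_intros polyfun_ntr)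

definition trace_moment :: "bool list list \<Rightarrow> real" where
  "trace_moment ws = expectation (\<lambda>\<omega>. \<Prod>w\<leftarrow>ws. ntr n (AW \<omega>) w)"

lemma integrable_ntr_prod: "integrable M (\<lambda>\<omega>. \<Prod>w\<leftarrow>ws. ntr n (AW \<omega>) w)"
  by (intro polyfun_integrable[of "\<lambda>g. \<Prod>w\<leftarrow>ws. ntr n (matW g) w"] polyfun_ntr_prod)

text \<open>The first trace is expanded in the entries of its first letter, and each entry is
  integrated by parts against all the rest. If the derivative falls on the same trace,
  \<open>sum_split_term\<close> gives a factor n^2; if it falls on another trace,
  \<open>sum_wmat_ntr_prod_deriv\<close> gives none. Together with the prefactor \<nu> / n^2 this
  produces the weights in the equation.\<close>

lemma trace_moment_step:
  "trace_moment ((c # w) # ws) =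
      \<nu> * ((\<Sum>(u, c', v)\<leftarrow>splits w. if c' = c then trace_moment ((flip u @ v) # ws) / real n
              else trace_moment (u # v # ws))
          + (\<Sum>zs\<leftarrow>cross c w ws. trace_moment zs) / real n ^ 2)"
proof -
  define P where "P A = (\<Prod>w\<leftarrow>ws. ntr n A w)" for A
  define \<Phi> where "\<Phi> i j g = wmat n (matW g) w j i * P (matW g)" for i j g
  define D where "D i j A = (\<Sum>s\<leftarrow>splits w. split_term n A c i j j i s) * P A
     + wmat n A w j i * ntr_prod_deriv n A c i j ws" for i j A
  \<comment> \<open>The variable behind the (i, j) entry of the first letter; for the transpose the
    indices are exchanged.\<close>
  define x :: "nat \<Rightarrow> nat \<Rightarrow> (nat \<times> nat) + (nat \<times> nat)"
    where "x i j = Inl (if c then (i, j) else (j, i))" for i j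
  have upd: "matW (g(x i j := a)) = upd_letter c (matW g) i j a" "letter c (matW g) i j = g (x i j)" for g i j a
    by (auto simp: x_def upd_letter_def upd2_def letter_def matW_def fun_eq_iff)
  have x_in: "x i j \<in> I0" if "i < n" "j < n" for i j using that by (auto simp: x_def)
  have \<Phi>: "polyfun I0 (\<Phi> i j)" if "j < n" for i j
    unfolding \<Phi>_def P_def by (intro polyfun_mult polyfun_wmat polyfun_ntr_prod that)
  have deriv: "((\<lambda>a. \<Phi> i j (g(x i j := a))) has_real_derivative D i j (matW g)) (at (g (x i j)))"
    if "i < n" "j < n" for i j g
    unfolding \<Phi>_def P_def D_def upd
    using DERIV_mult[OF wmat_derivative[OF that, of c "matW g" w j i] ntr_prod_derivative[OF that, of c "matW g" ws]]
    unfolding upd_letter_same unfolding upd by (simp add: mult.commute)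
  have ibp: "expectation (\<lambda>\<omega>. X (x i j) \<omega> * \<Phi> i j (XX \<omega>)) = \<nu> / real n * expectation (\<lambda>\<omega>. D i j (AW \<omega>))"
    if "i < n" "j < n" for i j
    using gaussian_ibp[OF x_in[OF that] \<Phi>[OF that(2)] deriv[OF that]] by (simp add: x_def)
  have intD: "integrable M (\<lambda>\<omega>. D i j (AW \<omega>))" if "i < n" "j < n" for i j
    using polyfun_integrable[OF polyfun_partial[OF \<Phi>[OF that(2)] x_in[OF that] deriv[OF that]]] .
  have intX: "integrable M (\<lambda>\<omega>. X (x i j) \<omega> * \<Phi> i j (XX \<omega>))" if "i < n" "j < n" for i j
    by (intro polyfun_integrable[of "\<lambda>g. g (x i j) * \<Phi> i j g"] polyfun_mult polyfun_var x_in \<Phi> that)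
  have "trace_moment ((c # w) # ws) = expectation (\<lambda>\<omega>. (\<Sum>i<n. \<Sum>j<n. X (x i j) \<omega> * \<Phi> i j (XX \<omega>)) / real n)"
    unfolding trace_moment_def
  proof (intro Bochner_Integration.integral_cong refl)
    fix \<omega>
    have "(\<Prod>w\<leftarrow>(c # w) # ws. ntr n (AW \<omega>) w) = (\<Sum>i<n. \<Sum>j<n. letter c (AW \<omega>) i j * wmat n (AW \<omega>) w j i) / real n * P (AW \<omega>)"
      by (simp add: ntr_def P_def)
    then show "(\<Prod>w\<leftarrow>(c # w) # ws. ntr n (AW \<omega>) w) = (\<Sum>i<n. \<Sum>j<n. X (x i j) \<omega> * \<Phi> i j (XX \<omega>)) / real n"
      by (simp add: \<Phi>_def upd(2) sum_distrib_right mult.assoc)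
  qed
  also have "\<dots> = (\<Sum>i<n. \<Sum>j<n. expectation (\<lambda>\<omega>. X (x i j) \<omega> * \<Phi> i j (XX \<omega>))) / real n"
    using integral_double_sum[OF intX] by simp
  also have "\<dots> = (\<Sum>i<n. \<Sum>j<n. \<nu> / real n * expectation (\<lambda>\<omega>. D i j (AW \<omega>))) / real n"
    using ibp by simp
  \<comment> \<open>One factor 1/n is the normalization of the trace, the other comes from the
    variance of an entry.\<close>
  also have "\<dots> = \<nu> / real n ^ 2 * (\<Sum>i<n. \<Sum>j<n. expectation (\<lambda>\<omega>. D i j (AW \<omega>)))"
    by (simp add: sum_distrib_left[symmetric] sum_divide_distrib[symmetric] power2_eq_square)
  also have "(\<Sum>i<n. \<Sum>j<n. expectation (\<lambda>\<omega>. D i j (AW \<omega>))) = expectation (\<lambda>\<omega>. \<Sum>i<n. \<Sum>j<n. D i j (AW \<omega>))"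
    using integral_double_sum[OF intD] by simp
  also have "(\<lambda>\<omega>. \<Sum>i<n. \<Sum>j<n. D i j (AW \<omega>)) =
     (\<lambda>\<omega>. real n ^ 2 * (\<Sum>s\<leftarrow>splits w. (case s of (u, c', v) \<Rightarrow>
         if c' = c then (\<Prod>w\<leftarrow>(flip u @ v) # ws. ntr n (AW \<omega>) w) / real n else (\<Prod>w\<leftarrow>u # v # ws. ntr n (AW \<omega>) w)))
        + (\<Sum>zs\<leftarrow>cross c w ws. \<Prod>w\<leftarrow>zs. ntr n (AW \<omega>) w))"
  proof
    fix \<omega>
    have "(\<Sum>i<n. \<Sum>j<n. D i j (AW \<omega>)) = (\<Sum>s\<leftarrow>splits w. \<Sum>i<n. \<Sum>j<n. split_term n (AW \<omega>) c i j j i s) * P (AW \<omega>)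
       + (\<Sum>zs\<leftarrow>cross c w ws. \<Prod>w\<leftarrow>zs. ntr n (AW \<omega>) w)"
      unfolding D_def sum.distrib sum_wmat_ntr_prod_deriv[OF n_pos] sum_sum_list_swap[symmetric] sum_distrib_right ..
    also have "(\<Sum>s\<leftarrow>splits w. \<Sum>i<n. \<Sum>j<n. split_term n (AW \<omega>) c i j j i s) * P (AW \<omega>)
       = real n ^ 2 * (\<Sum>s\<leftarrow>splits w. (case s of (u, c', v) \<Rightarrow>
         if c' = c then (\<Prod>w\<leftarrow>(flip u @ v) # ws. ntr n (AW \<omega>) w) / real n else (\<Prod>w\<leftarrow>u # v # ws. ntr n (AW \<omega>) w)))"
      unfolding sum_split_term[OF n_pos] sum_list_mult_const[symmetric] sum_list_const_mult[symmetric]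
      by (intro arg_cong[where f = sum_list] map_cong refl) (auto simp: P_def split: if_split if_split_asm)
    finally show "(\<Sum>i<n. \<Sum>j<n. D i j (AW \<omega>)) = \<dots> + (\<Sum>zs\<leftarrow>cross c w ws. \<Prod>w\<leftarrow>zs. ntr n (AW \<omega>) w)" .
  qed
  also have "expectation \<dots> = real n ^ 2 * (\<Sum>s\<leftarrow>splits w. (case s of (u, c', v) \<Rightarrow>
         if c' = c then trace_moment ((flip u @ v) # ws) / real n else trace_moment (u # v # ws)))
        + (\<Sum>zs\<leftarrow>cross c w ws. trace_moment zs)"
  proof -
    let ?f = "\<lambda>s \<omega>. case s of (u, c', v) \<Rightarrow>
         if c' = c then (\<Prod>w\<leftarrow>(flip u @ v) # ws. ntr n (AW \<omega>) w) / real n else (\<Prod>w\<leftarrow>u # v # ws. ntr n (AW \<omega>) w)"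
    have f: "integrable M (?f s) \<and> expectation (?f s) = (case s of (u, c', v) \<Rightarrow>
         if c' = c then trace_moment ((flip u @ v) # ws) / real n else trace_moment (u # v # ws))" for s
      using integrable_ntr_prod by (auto simp: trace_moment_def split: prod.split simp del: prod_list.Cons list.map)
    note 1 = integral_sum_list[of "splits w" ?f]
    note 2 = integral_sum_list[of "cross c w ws" "\<lambda>zs \<omega>. \<Prod>w\<leftarrow>zs. ntr n (AW \<omega>) w"]
    show ?thesis
      using 1 2 f integrable_ntr_prod unfolding trace_moment_def
      by (subst Bochner_Integration.integral_add) (simp_all del: prod_list.Cons list.map)
  qed
  finally show ?thesis using n_pos by (simp add: field_simps)
qed

text \<open>Here T is the deviation from the conditional mean given W. Each power of T gains a
  factor 1/n over a lower power.\<close>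

lemma qform_deviation_moment:
  fixes p :: nat and w :: "bool list"
  assumes m: "m < d" "m' < d"
  defines "T \<equiv> \<lambda>g. qform n (matW g) (matF g) m m' w - (if m = m' then \<eta> * ntr n (matW g) w else 0)"
  defines "Q' \<equiv> \<lambda>g. qform n (matW g) (matF g) m' m' (flip w @ w)
      + (if m = m' then qform n (matW g) (matF g) m m (flip w @ flip w) else 0)"
  shows "expectation (\<lambda>\<omega>. T (XX \<omega>) ^ Suc p) = real p * (\<eta> / real n) * expectation (\<lambda>\<omega>. T (XX \<omega>) ^ (p - 1) * Q' (XX \<omega>))"
proof -
  define \<delta> :: real where "\<delta> = (if m = m' then 1 else 0)"
  \<comment> \<open>\<open>V i\<close> is the factor of \<open>matF g i m\<close> on the left of the
    form. If m = m' the same variable also occurs on the right, with factor \<open>U i\<close>; this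
    second occurrence is switched on by \<delta>.\<close>
  define V where "V i g = (\<Sum>j<n. wmat n (matW g) w i j * matF g j m') / real n" for i g
  define U where "U i g = (\<Sum>k<n. matF g k m * wmat n (matW g) w k i) / real n" for i g
  define x :: "nat \<Rightarrow> (nat \<times> nat) + (nat \<times> nat)" where "x i = Inr (i, m)" for i
  have T: "T g = (\<Sum>i<n. matF g i m * V i g) - \<delta> * \<eta> * ntr n (matW g) w" for g
    by (simp add: T_def qform_def wvec_def V_def \<delta>_def)
  have x_in: "x i \<in> I0" if "i < n" for i using that m by (auto simp: x_def)
  have updW: "matW (g(x i := a)) = matW g" for g i a
    by (auto simp: matW_def x_def fun_eq_iff)
  have dF: "((\<lambda>a. matF (g(x i := a)) k m'') has_real_derivative (if k = i then (if m'' = m then 1 else 0) else 0)) (at (g (x i)))" for g i k m''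
    by (cases "k = i"; cases "m'' = m") (auto simp: matF_def x_def)
  have delta: "(\<Sum>k<n. f k * (if k = i then a else 0)) = f i * a" if "i < n" for f :: "nat \<Rightarrow> real" and a i
  proof -
    have "(\<Sum>k<n. f k * (if k = i then a else 0)) = (\<Sum>k<n. if k = i then f k * a else 0)"
      by (intro sum.cong) auto
    then show ?thesis using that by simp
  qed
  have dV: "((\<lambda>a. V k (g(x i := a))) has_real_derivative \<delta> * wmat n (matW g) w k i / real n) (at (g (x i)))" if "i < n" for g i k
  proof -
    have "((\<lambda>a. V k (g(x i := a))) has_real_derivative (\<Sum>j<n. wmat n (matW g) w k j * (if j = i then (if m' = m then 1 else 0) else 0)) / real n) (at (g (x i)))"
      unfolding V_def updW by (intro DERIV_cdivide DERIV_sum DERIV_cmult dF)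
    then show ?thesis unfolding delta[OF that] by (simp add: \<delta>_def mult.commute eq_commute)
  qed
  have dT: "((\<lambda>a. T (g(x i := a))) has_real_derivative V i g + \<delta> * U i g) (at (g (x i)))" if "i < n" for g i
  proof -
    have "((\<lambda>a. T (g(x i := a))) has_real_derivative
       (\<Sum>k<n. (if k = i then (if m = m then 1 else 0) else 0) * V k (g(x i := g (x i))) + \<delta> * wmat n (matW g) w k i / real n * matF (g(x i := g (x i))) k m) - 0) (at (g (x i)))"
      unfolding T updW by (intro DERIV_diff DERIV_sum DERIV_mult dF dV that DERIV_const)
    also have "(\<Sum>k<n. (if k = i then (if m = m then 1 else 0) else 0) * V k (g(x i := g (x i))) + \<delta> * wmat n (matW g) w k i / real n * matF (g(x i := g (x i))) k m) - 0
       = (\<Sum>k<n. V k g * (if k = i then 1 else 0)) + \<delta> * U i g"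
      unfolding U_def sum.distrib sum_divide_distrib sum_distrib_left
      by (simp only: fun_upd_triv refl if_True diff_zero mult.commute mult.left_commute times_divide_eq_right times_divide_eq_left)
    finally show ?thesis unfolding delta[OF that] by (simp del: fun_upd_apply)
  qed
  have pT: "polyfun I0 T"
    unfolding T_def by (intro polyfun_intros polyfun_qform polyfun_ntr m)
  have pV: "polyfun I0 (V i)" if "i < n" for i
    unfolding V_def by (intro polyfun_intros polyfun_wmat polyfun_matF m) (use that in auto)
  define D where "D i g = \<delta> * wmat n (matW g) w i i / real n * T g ^ p
      + real p * T g ^ (p - 1) * (V i g + \<delta> * U i g) * V i g" for i g
  have pol: "polyfun I0 (\<lambda>g. V i g * T g ^ p)" if "i < n" for i
    by (intro polyfun_mult polyfun_power pT pV that)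
  have deriv: "((\<lambda>a. V i (g(x i := a)) * T (g(x i := a)) ^ p) has_real_derivative D i g) (at (g (x i)))" if "i < n" for i g
    using DERIV_mult[OF dV[OF that, of i g] DERIV_power[OF dT[OF that, of g], of p]]
    by (simp add: D_def mult_ac)
  have ibp: "expectation (\<lambda>\<omega>. X (x i) \<omega> * (V i (XX \<omega>) * T (XX \<omega>) ^ p)) = \<eta> * expectation (\<lambda>\<omega>. D i (XX \<omega>))" if "i < n" for i
    using gaussian_ibp[OF x_in[OF that] pol[OF that] deriv[OF that]] by (simp add: x_def)
  have intD: "integrable M (\<lambda>\<omega>. D i (XX \<omega>))" if "i < n" for i
    using polyfun_integrable[OF polyfun_partial[OF pol[OF that] x_in[OF that] deriv[OF that]]] .
  have intX: "integrable M (\<lambda>\<omega>. X (x i) \<omega> * (V i (XX \<omega>) * T (XX \<omega>) ^ p))" if "i < n" for i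
    by (intro polyfun_integrable[of "\<lambda>g. g (x i) * (V i g * T g ^ p)"] polyfun_mult[OF polyfun_var] x_in pol that)
  have V: "V i g = wvec n (matW g) (matF g) w m' i / real n" for i g
    by (simp add: V_def wvec_def)
  have U: "U i g = wvec n (matW g) (matF g) (flip w) m i / real n" if "i < n" for i g
    using that by (simp add: U_def wvec_def wmat_flip mult.commute)
  have VV: "(\<Sum>i<n. V i g * V i g) = qform n (matW g) (matF g) m' m' (flip w @ w) / real n" for g
    by (simp add: V qform_flip sum_divide_distrib[symmetric])
  have VU: "(\<Sum>i<n. V i g * U i g) = qform n (matW g) (matF g) m m (flip w @ flip w) / real n" if "m = m'" for g
    using that by (simp add: V U qform_flip sum_divide_distrib[symmetric])
  \<comment> \<open>Differentiating \<open>V\<close> produces the trace term. After multiplication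
    by \<eta> it is exactly what the centring in \<open>T\<close> subtracts, so only the part with
    the gain 1/n remains.\<close>
  have sumD: "(\<Sum>i<n. D i g) = \<delta> * ntr n (matW g) w * T g ^ p + real p / real n * (T g ^ (p - 1) * Q' g)" for g
  proof -
    have "(\<Sum>i<n. D i g) = \<delta> * ntr n (matW g) w * T g ^ p
       + real p * T g ^ (p - 1) * ((\<Sum>i<n. V i g * V i g) + \<delta> * (\<Sum>i<n. V i g * U i g))"
      unfolding D_def ntr_def
      by (simp add: sum.distrib sum_distrib_left sum_distrib_right sum_divide_distrib algebra_simps)
    also have "(\<Sum>i<n. V i g * V i g) + \<delta> * (\<Sum>i<n. V i g * U i g) = Q' g / real n"
      unfolding VV Q'_def using VU by (simp add: \<delta>_def add_divide_distrib)
    finally show ?thesis by simp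
  qed
  have pQ': "polyfun I0 Q'"
    unfolding Q'_def by (intro polyfun_intros polyfun_qform m)
  have i1: "integrable M (\<lambda>\<omega>. \<delta> * ntr n (AW \<omega>) w * T (XX \<omega>) ^ p)"
    by (rule polyfun_integrable[of "\<lambda>g. \<delta> * ntr n (matW g) w * T g ^ p"]) (intro polyfun_intros polyfun_ntr pT)
  have i2: "integrable M (\<lambda>\<omega>. T (XX \<omega>) ^ (p - 1) * Q' (XX \<omega>))"
    by (rule polyfun_integrable[of "\<lambda>g. T g ^ (p - 1) * Q' g"]) (intro polyfun_intros pT pQ')
  have "expectation (\<lambda>\<omega>. T (XX \<omega>) ^ Suc p)
     = expectation (\<lambda>\<omega>. (\<Sum>i<n. X (x i) \<omega> * (V i (XX \<omega>) * T (XX \<omega>) ^ p)) - \<eta> * (\<delta> * ntr n (AW \<omega>) w * T (XX \<omega>) ^ p))"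
  proof (intro Bochner_Integration.integral_cong refl)
    fix \<omega>
    have "T (XX \<omega>) ^ Suc p = ((\<Sum>i<n. X (x i) \<omega> * V i (XX \<omega>)) - \<delta> * \<eta> * ntr n (AW \<omega>) w) * T (XX \<omega>) ^ p"
      using T[of "XX \<omega>"] by (simp add: matF_def x_def)
    then show "T (XX \<omega>) ^ Suc p = (\<Sum>i<n. X (x i) \<omega> * (V i (XX \<omega>) * T (XX \<omega>) ^ p)) - \<eta> * (\<delta> * ntr n (AW \<omega>) w * T (XX \<omega>) ^ p)"
      unfolding left_diff_distrib sum_distrib_right by (simp only: mult_ac)
  qed
  also have "\<dots> = (\<Sum>i<n. \<eta> * expectation (\<lambda>\<omega>. D i (XX \<omega>))) - \<eta> * expectation (\<lambda>\<omega>. \<delta> * ntr n (AW \<omega>) w * T (XX \<omega>) ^ p)"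
    using intX i1 ibp
    by (subst Bochner_Integration.integral_diff) (auto simp: Bochner_Integration.integral_sum intro!: Bochner_Integration.integrable_sum)
  also have "(\<Sum>i<n. \<eta> * expectation (\<lambda>\<omega>. D i (XX \<omega>))) = \<eta> * expectation (\<lambda>\<omega>. \<Sum>i<n. D i (XX \<omega>))"
    using intD by (simp add: Bochner_Integration.integral_sum sum_distrib_left)
  also have "expectation (\<lambda>\<omega>. \<Sum>i<n. D i (XX \<omega>)) = expectation (\<lambda>\<omega>. \<delta> * ntr n (AW \<omega>) w * T (XX \<omega>) ^ p)
      + real p / real n * expectation (\<lambda>\<omega>. T (XX \<omega>) ^ (p - 1) * Q' (XX \<omega>))"
    unfolding sumD using i1 i2 by (subst Bochner_Integration.integral_add) simp_all
  finally show ?thesis by (simp add: algebra_simps)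
qed

text \<open>The deviation identity with p = 0 gives the mean of a form and with p = 1 the second
  moment of its deviation. Adding the conditional mean back costs the factors 2 through (a + b)^2
  \<le> 2 a^2 + 2 b^2.\<close>

lemma qform_second_moment:
  assumes "m < d" "m' < d"
  shows "expectation (\<lambda>\<omega>. qform n (AW \<omega>) (BF \<omega>) m m' w ^ 2)
    \<le> 2 * \<eta>\<^sup>2 * trace_moment [w, w] + 2 * \<eta>\<^sup>2 / real n * (trace_moment [flip w @ w]
        + (if m = m' then trace_moment [flip w @ flip w] else 0))"
proof -
  define t where "t g = (if m = m' then \<eta> * ntr n (matW g) w else 0)" for g
  define T where "T g = qform n (matW g) (matF g) m m' w - t g" for g
  have mean: "expectation (\<lambda>\<omega>. qform n (AW \<omega>) (BF \<omega>) k k' w') = (if k = k' then \<eta> * trace_moment [w'] else 0)"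
    if "k < d" "k' < d" for k k' w'
  proof -
    have 1: "integrable M (\<lambda>\<omega>. qform n (AW \<omega>) (BF \<omega>) k k' w')"
      by (rule polyfun_integrable[OF polyfun_qform[OF that]])
    have 2: "integrable M (\<lambda>\<omega>. ntr n (AW \<omega>) w')"
      by (rule polyfun_integrable[OF polyfun_ntr])
    show ?thesis
      using qform_deviation_moment[OF that, of w' 0] 1 2 by (auto simp: trace_moment_def)
  qed
  have pt: "polyfun I0 t"
    unfolding t_def by (intro polyfun_intros polyfun_ntr)
  have pT: "polyfun I0 T"
    unfolding T_def by (intro polyfun_diff polyfun_qform pt assms)
  have pQ: "polyfun I0 (\<lambda>g. qform n (matW g) (matF g) m m' w ^ 2)"
    by (intro polyfun_power polyfun_qform assms)
  have i: "integrable M (\<lambda>\<omega>. T (XX \<omega>) ^ 2)" "integrable M (\<lambda>\<omega>. t (XX \<omega>) ^ 2)"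
    by (rule polyfun_integrable[OF polyfun_power[OF pT]] polyfun_integrable[OF polyfun_power[OF pt]])+
  have iq: "integrable M (\<lambda>\<omega>. qform n (AW \<omega>) (BF \<omega>) k k' w')" if "k < d" "k' < d" for k k' w'
    by (rule polyfun_integrable[OF polyfun_qform[OF that]])
  have ET: "expectation (\<lambda>\<omega>. T (XX \<omega>) ^ 2) = \<eta>\<^sup>2 / real n * (trace_moment [flip w @ w]
        + (if m = m' then trace_moment [flip w @ flip w] else 0))"
    using qform_deviation_moment[OF assms, of w 1] iq assms
    by (auto simp: T_def t_def mean power2_eq_square algebra_simps add_divide_distrib)
  have Et: "expectation (\<lambda>\<omega>. t (XX \<omega>) ^ 2) \<le> \<eta>\<^sup>2 * trace_moment [w, w]"
  proof -
    have "trace_moment [w, w] = expectation (\<lambda>\<omega>. ntr n (AW \<omega>) w ^ 2)"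
      by (simp add: trace_moment_def power2_eq_square)
    moreover have "0 \<le> expectation (\<lambda>\<omega>. ntr n (AW \<omega>) w ^ 2)"
      by (intro integral_nonneg_AE) auto
    ultimately show ?thesis
      by (cases "m = m'") (simp_all add: t_def power_mult_distrib)
  qed
  have "expectation (\<lambda>\<omega>. qform n (AW \<omega>) (BF \<omega>) m m' w ^ 2) \<le> expectation (\<lambda>\<omega>. 2 * T (XX \<omega>) ^ 2 + 2 * t (XX \<omega>) ^ 2)"
  proof (rule integral_mono)
    show "integrable M (\<lambda>\<omega>. qform n (AW \<omega>) (BF \<omega>) m m' w ^ 2)"
      by (rule polyfun_integrable[OF pQ])
    show "integrable M (\<lambda>\<omega>. 2 * T (XX \<omega>) ^ 2 + 2 * t (XX \<omega>) ^ 2)" using i by simp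
    fix \<omega>
    have "(a + b)\<^sup>2 \<le> 2 * a\<^sup>2 + 2 * b\<^sup>2" for a b :: real
      using sum_squares_bound[of a b] by (simp add: power2_sum)
    from this[of "T (XX \<omega>)" "t (XX \<omega>)"]
    show "qform n (AW \<omega>) (BF \<omega>) m m' w ^ 2 \<le> 2 * T (XX \<omega>) ^ 2 + 2 * t (XX \<omega>) ^ 2"
      by (simp add: T_def)
  qed
  also have "\<dots> = 2 * expectation (\<lambda>\<omega>. T (XX \<omega>) ^ 2) + 2 * expectation (\<lambda>\<omega>. t (XX \<omega>) ^ 2)"
    using i by simp
  also have "\<dots> \<le> 2 * (\<eta>\<^sup>2 / real n * (trace_moment [flip w @ w]
        + (if m = m' then trace_moment [flip w @ flip w] else 0))) + 2 * (\<eta>\<^sup>2 * trace_moment [w, w])"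
    using ET Et by simp
  finally show ?thesis by (simp add: mult.assoc)
qed

text \<open>The deviation identity with p = 3 gives the factor a = 3 \<eta> / n in front of the
  expectation of T^2 Q'. The inequality between geometric and arithmetic mean bounds a T^2 Q' by T^4
  / 2 plus a multiple of a^2, and the half fourth moment is absorbed on the left. This leaves 2 a^2,
  hence the constant 18.\<close>

lemma qform_fourth_moment:
  fixes w :: "bool list"
  assumes m: "m < d" "m' < d"
  defines "T \<equiv> \<lambda>g. qform n (matW g) (matF g) m m' w - (if m = m' then \<eta> * ntr n (matW g) w else 0)"
  shows "expectation (\<lambda>\<omega>. T (XX \<omega>) ^ 4) \<le> 18 * \<eta>\<^sup>2 / real n ^ 2 *
    (expectation (\<lambda>\<omega>. qform n (AW \<omega>) (BF \<omega>) m' m' (flip w @ w) ^ 2)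
     + expectation (\<lambda>\<omega>. qform n (AW \<omega>) (BF \<omega>) m m (flip w @ flip w) ^ 2))"
proof -
  define Q1 where "Q1 g = qform n (matW g) (matF g) m' m' (flip w @ w)" for g
  define Q2 where "Q2 g = qform n (matW g) (matF g) m m (flip w @ flip w)" for g
  define Q' where "Q' g = Q1 g + (if m = m' then Q2 g else 0)" for g
  have pT: "polyfun I0 T"
    unfolding T_def by (intro polyfun_intros polyfun_qform polyfun_ntr m)
  have p12: "polyfun I0 Q1" "polyfun I0 Q2"
    unfolding Q1_def Q2_def by (intro polyfun_qform m)+
  have pQ': "polyfun I0 Q'"
    unfolding Q'_def by (intro polyfun_intros p12)
  have i4: "integrable M (\<lambda>\<omega>. T (XX \<omega>) ^ 4)"
    by (rule polyfun_integrable[OF polyfun_power[OF pT]])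
  have i1: "integrable M (\<lambda>\<omega>. Q1 (XX \<omega>) ^ 2)" "integrable M (\<lambda>\<omega>. Q2 (XX \<omega>) ^ 2)"
    by (rule polyfun_integrable[OF polyfun_power] p12)+
  define a where "a = 3 * \<eta> / real n"
  have i22: "integrable M (\<lambda>\<omega>. T (XX \<omega>) ^ 2 * Q' (XX \<omega>))"
    by (rule polyfun_integrable[OF polyfun_mult[OF polyfun_power[OF pT] pQ']])
  have "expectation (\<lambda>\<omega>. T (XX \<omega>) ^ 4) = a * expectation (\<lambda>\<omega>. T (XX \<omega>) ^ 2 * Q' (XX \<omega>))"
    using qform_deviation_moment[OF m, of w 3]
    by (cases "m = m'") (simp_all add: T_def Q'_def Q1_def Q2_def a_def)
  also have "\<dots> = expectation (\<lambda>\<omega>. a * (T (XX \<omega>) ^ 2 * Q' (XX \<omega>)))" by simp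
  also have "\<dots> \<le> expectation (\<lambda>\<omega>. T (XX \<omega>) ^ 4 / 2 + a\<^sup>2 * (Q1 (XX \<omega>) ^ 2 + Q2 (XX \<omega>) ^ 2))"
  proof (rule integral_mono)
    show "integrable M (\<lambda>\<omega>. T (XX \<omega>) ^ 4 / 2 + a\<^sup>2 * (Q1 (XX \<omega>) ^ 2 + Q2 (XX \<omega>) ^ 2))"
      using i4 i1 by simp
    show "integrable M (\<lambda>\<omega>. a * (T (XX \<omega>) ^ 2 * Q' (XX \<omega>)))" using i22 by simp
    fix \<omega>
    let ?t = "T (XX \<omega>)" and ?q = "Q' (XX \<omega>)" and ?x = "Q1 (XX \<omega>)" and ?y = "Q2 (XX \<omega>)"
    have 1: "?q\<^sup>2 \<le> 2 * (?x\<^sup>2 + ?y\<^sup>2)"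
      using sum_squares_bound[of ?x ?y] zero_le_power2[of ?x] zero_le_power2[of ?y]
      by (auto simp: Q'_def power2_sum)
    have "2 * ?t\<^sup>2 * (a * ?q) \<le> (?t\<^sup>2)\<^sup>2 + (a * ?q)\<^sup>2" by (rule sum_squares_bound)
    also have "(a * ?q)\<^sup>2 \<le> a\<^sup>2 * (2 * (?x\<^sup>2 + ?y\<^sup>2))"
      unfolding power_mult_distrib by (intro mult_left_mono 1) simp
    finally have "2 * (a * (?t ^ 2 * ?q)) \<le> ?t ^ 4 + 2 * (a\<^sup>2 * (?x ^ 2 + ?y ^ 2))"
      by (simp add: power_mult[symmetric] algebra_simps)
    then show "a * (?t ^ 2 * ?q) \<le> ?t ^ 4 / 2 + a\<^sup>2 * (?x ^ 2 + ?y ^ 2)"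
      by linarith
  qed
  also have "\<dots> = expectation (\<lambda>\<omega>. T (XX \<omega>) ^ 4) / 2
      + a\<^sup>2 * (expectation (\<lambda>\<omega>. Q1 (XX \<omega>) ^ 2) + expectation (\<lambda>\<omega>. Q2 (XX \<omega>) ^ 2))"
    using i4 i1 by simp
  finally have "expectation (\<lambda>\<omega>. T (XX \<omega>) ^ 4)
     \<le> 2 * a\<^sup>2 * (expectation (\<lambda>\<omega>. Q1 (XX \<omega>) ^ 2) + expectation (\<lambda>\<omega>. Q2 (XX \<omega>) ^ 2))"
    by simp
  then show ?thesis
    unfolding Q1_def Q2_def a_def by (simp add: power_divide power_mult_distrib)
qed

end

section \<open>Almost sure limits along the dimensions\<close>

locale gaussian_matrices = prob_space M
  for M :: "'a measure" +
  fixes X :: "nat \<Rightarrow> (nat \<times> nat) + (nat \<times> nat) \<Rightarrow> 'a \<Rightarrow> real" and d :: nat and \<nu> \<eta> :: real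
  assumes gaussian: "\<And>n. n \<ge> 1 \<Longrightarrow> gaussian_matrix M n d (X n) \<nu> \<eta>"
begin

abbreviation "W n \<omega> \<equiv> matW (\<lambda>y. X n y \<omega>)"
abbreviation "B n \<omega> \<equiv> matF (\<lambda>y. X n y \<omega>)"

definition mom :: "nat \<Rightarrow> bool list list \<Rightarrow> real" where
  "mom n ws = expectation (\<lambda>\<omega>. \<Prod>w\<leftarrow>ws. ntr n (W n \<omega>) w)"

lemma mom_eq: "n \<ge> 1 \<Longrightarrow> mom n ws = gaussian_matrix.trace_moment M n (X n) ws"
  using gaussian_matrix.trace_moment_def[OF gaussian] by (simp add: mom_def)

sublocale loop_equations mom \<nu>
proof
  fix n :: nat and ws c w
  assume n: "n \<ge> 1"
  then interpret G: gaussian_matrix M n d "X n" \<nu> \<eta> by (rule gaussian)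
  show "mom n [] = 1" by (simp add: mom_def prob_space)
  show "mom n ([] # ws) = mom n ws" using n by (simp add: mom_def)
  show "mom n ((c # w) # ws) =
      \<nu> * ((\<Sum>(u, c', v)\<leftarrow>splits w. if c' = c then mom n ((flip u @ v) # ws) / real n else mom n (u # v # ws))
          + (\<Sum>zs\<leftarrow>cross c w ws. mom n zs) / real n ^ 2)"
    unfolding mom_eq[OF n] by (rule G.trace_moment_step)
qed

text \<open>The variance of the trace is the covariance of the word with itself, which
  \<open>Mo_covariance\<close> bounds at a summable rate; second moments suffice here.\<close>

lemma ntr_AE:
  "AE \<omega> in M. (\<lambda>n. ntr n (W n \<omega>) w - mom n [w]) \<longlonglongrightarrow> 0"
proof (rule AE_tendsto_0_if_moments_summable[where k = 1])
  show "integrable M (\<lambda>\<omega>. (ntr n (W n \<omega>) w - mom n [w]) ^ (2 * 1))" if "n \<ge> 1" for n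
  proof -
    interpret G: gaussian_matrix M n d "X n" \<nu> \<eta> using that by (rule gaussian)
    show ?thesis
      by (rule G.polyfun_integrable[of "\<lambda>g. (ntr n (matW g) w - mom n [w]) ^ (2 * 1)"])
         (intro polyfun_intros G.polyfun_ntr)
  qed
  show "(\<lambda>n. expectation (\<lambda>\<omega>. (ntr n (W n \<omega>) w - mom n [w]) ^ (2 * 1))) \<in> O(\<lambda>n. 1 / real n ^ 2)"
  proof (rule bigo_cong_ge1[OF Mo_covariance[of "[w]" "[w]"]])
    fix n :: nat assume n: "n \<ge> 1"
    then interpret G: gaussian_matrix M n d "X n" \<nu> \<eta> by (rule gaussian)
    let ?Z = "\<lambda>\<omega>. ntr n (G.AW \<omega>) w"
    have i: "integrable M ?Z" by (rule G.polyfun_integrable[OF G.polyfun_ntr])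
    have i2: "integrable M (\<lambda>\<omega>. ?Z \<omega> ^ 2)" by (rule G.polyfun_integrable[OF polyfun_power[OF G.polyfun_ntr]])
    have "expectation (\<lambda>\<omega>. (?Z \<omega> - expectation ?Z) ^ 2) = expectation (\<lambda>\<omega>. ?Z \<omega> ^ 2) - (expectation ?Z) ^ 2"
      using i i2 by (rule variance_eq)
    then show "expectation (\<lambda>\<omega>. (ntr n (W n \<omega>) w - mom n [w]) ^ (2 * 1)) = mom n ([w] @ [w]) - mom n [w] * mom n [w]"
      by (simp add: mom_def power2_eq_square)
  qed
qed simp

lemma qform_second_moment_bigo:
  assumes "m < d" "m' < d"
  shows "(\<lambda>n. expectation (\<lambda>\<omega>. qform n (W n \<omega>) (B n \<omega>) m m' w ^ 2)) \<in> O(\<lambda>_. 1)"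
proof -
  let ?b = "\<lambda>n. 2 * \<eta>\<^sup>2 * mom n [w, w] + 2 * \<eta>\<^sup>2 * ((mom n [flip w @ w]
        + (if m = m' then mom n [flip w @ flip w] else 0)) * (1 / real n ^ 1))"
  have 1: "(\<lambda>n. if m = m' then mom n [flip w @ flip w] else 0) \<in> O(\<lambda>_. 1)"
    using Mo_bounded by (cases "m = m'") auto
  have b: "?b \<in> O(\<lambda>_. 1)"
    using landau_o.big.mult[OF sum_in_bigo(1)[OF Mo_bounded[of "[flip w @ w]"] 1] inverse_in_bigo_1[of 1]]
    by (intro sum_in_bigo(1) bigo_cmult Mo_bounded) (simp_all only: mult_1_left)
  show ?thesis
  proof (rule landau_o.big_trans[OF _ b], rule bigoI[of _ 1], rule eventually_mono[OF ev_ge1])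
    fix n :: nat assume n: "n \<ge> 1"
    then interpret G: gaussian_matrix M n d "X n" \<nu> \<eta> by (rule gaussian)
    let ?E = "expectation (\<lambda>\<omega>. qform n (W n \<omega>) (B n \<omega>) m m' w ^ 2)"
    have "0 \<le> ?E" by (intro integral_nonneg_AE) auto
    moreover have "?E \<le> ?b n"
      using G.qform_second_moment[OF assms, of w] unfolding mom_eq[OF n] by (simp add: mult_ac)
    ultimately show "norm ?E \<le> 1 * norm (?b n)" by simp
  qed
qed

text \<open>The deviation from \<eta> times the trace is treated by fourth moments, since the bound
  of order 1/n on its second moment is not summable; the trace itself is treated by
  \<open>ntr_AE\<close> and \<open>Mo_mixed_tendsto\<close>. Both values of \<open>c\<close> are
  used: powers act on the columns of F and, transposed, on the rows of C.\<close>

theorem qform_AE: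
  assumes m: "m < d" "m' < d"
  shows "AE \<omega> in M. (\<lambda>n. qform n (W n \<omega>) (B n \<omega>) m m' (replicate b c @ replicate a (\<not> c)))
     \<longlonglongrightarrow> (if m = m' \<and> a = b then \<eta> * \<nu> ^ a else 0)"
proof -
  let ?w = "replicate b c @ replicate a (\<not> c)"
  let ?t = "\<lambda>n \<omega>. if m = m' then \<eta> * ntr n (W n \<omega>) ?w else 0"
  let ?T = "\<lambda>n \<omega>. qform n (W n \<omega>) (B n \<omega>) m m' ?w - ?t n \<omega>"
  have "AE \<omega> in M. (\<lambda>n. ?T n \<omega>) \<longlonglongrightarrow> 0"
  proof (rule AE_tendsto_0_if_moments_summable[where k = 2])
    show "integrable M (\<lambda>\<omega>. ?T n \<omega> ^ (2 * 2))" if "n \<ge> 1" for n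
    proof -
      interpret G: gaussian_matrix M n d "X n" \<nu> \<eta> using that by (rule gaussian)
      show ?thesis
        by (rule G.polyfun_integrable[of "\<lambda>g. (qform n (matW g) (matF g) m m' ?w - (if m = m' then \<eta> * ntr n (matW g) ?w else 0)) ^ (2 * 2)"])
           (intro polyfun_intros G.polyfun_ntr G.polyfun_qform m)
    qed
    let ?b = "\<lambda>n. 18 * \<eta>\<^sup>2 * ((expectation (\<lambda>\<omega>. qform n (W n \<omega>) (B n \<omega>) m' m' (flip ?w @ ?w) ^ 2)
       + expectation (\<lambda>\<omega>. qform n (W n \<omega>) (B n \<omega>) m m (flip ?w @ flip ?w) ^ 2)) * (1 / real n ^ 2))"
    have b: "?b \<in> O(\<lambda>n. 1 / real n ^ 2)"
    proof (rule bigo_cmult)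
      show "(\<lambda>n. (expectation (\<lambda>\<omega>. qform n (W n \<omega>) (B n \<omega>) m' m' (flip ?w @ ?w) ^ 2)
       + expectation (\<lambda>\<omega>. qform n (W n \<omega>) (B n \<omega>) m m (flip ?w @ flip ?w) ^ 2)) * (1 / real n ^ 2)) \<in> O(\<lambda>n. 1 / real n ^ 2)"
        using landau_o.big.mult[OF sum_in_bigo(1)[OF qform_second_moment_bigo[OF m(2) m(2), of "flip ?w @ ?w"]
            qform_second_moment_bigo[OF m(1) m(1), of "flip ?w @ flip ?w"]], of "\<lambda>n. 1 / real n ^ 2" "\<lambda>n. 1 / real n ^ 2"]
        by (simp only: mult_1_left landau_o.big_refl)
    qed
    show "(\<lambda>n. expectation (\<lambda>\<omega>. ?T n \<omega> ^ (2 * 2))) \<in> O(\<lambda>n. 1 / real n ^ 2)"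
    proof (rule landau_o.big_trans[OF _ b], rule bigoI[of _ 1], rule eventually_mono[OF ev_ge1])
      fix n :: nat assume n: "n \<ge> 1"
      then interpret G: gaussian_matrix M n d "X n" \<nu> \<eta> by (rule gaussian)
      have "0 \<le> expectation (\<lambda>\<omega>. ?T n \<omega> ^ (2 * 2))"
        by (intro integral_nonneg_AE) (auto simp: power_mult)
      moreover have "expectation (\<lambda>\<omega>. ?T n \<omega> ^ (2 * 2)) \<le> ?b n"
        using G.qform_fourth_moment[OF m, of ?w] by (simp only: times_divide_eq_right times_divide_eq_left mult_1_right) simp
      ultimately show "norm (expectation (\<lambda>\<omega>. ?T n \<omega> ^ (2 * 2))) \<le> 1 * norm (?b n)"
        by (simp only: real_norm_def mult_1_left abs_of_nonneg)
    qed
  qed simp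
  moreover have "AE \<omega> in M. (\<lambda>n. ntr n (W n \<omega>) ?w - mom n [?w]) \<longlonglongrightarrow> 0"
    by (rule ntr_AE)
  ultimately show ?thesis
  proof eventually_elim
    case (elim \<omega>)
    have "(\<lambda>n. ntr n (W n \<omega>) ?w) \<longlonglongrightarrow> (if a = b then \<nu> ^ a else 0)"
      using tendsto_add[OF elim(2) Mo_mixed_tendsto[of b c a]] by simp
    then have 1: "(\<lambda>n. \<eta> * ntr n (W n \<omega>) ?w) \<longlonglongrightarrow> \<eta> * (if a = b then \<nu> ^ a else 0)"
      by (rule tendsto_mult_left)
    have "(\<lambda>n. ?t n \<omega>) \<longlonglongrightarrow> (if m = m' then \<eta> * (if a = b then \<nu> ^ a else 0) else 0)"
      using 1 by (cases "m = m'") simp_all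
    from tendsto_add[OF elim(1) this] show ?case by (simp split: if_splits)
  qed
qed

end

section \<open>The tangent kernel as a sum of quadratic forms\<close>

definition hvec :: "nat \<Rightarrow> (nat \<Rightarrow> nat \<Rightarrow> real) \<Rightarrow> (nat \<Rightarrow> nat \<Rightarrow> real) \<Rightarrow> nat \<Rightarrow> nat \<Rightarrow> nat \<Rightarrow> real" where
  "hvec n A B a m i = (\<Sum>q<n. wmat n A (replicate a True) i q * B q m)"

definition cvec :: "nat \<Rightarrow> (nat \<Rightarrow> nat \<Rightarrow> real) \<Rightarrow> (nat \<Rightarrow> nat \<Rightarrow> real) \<Rightarrow> nat \<Rightarrow> nat \<Rightarrow> nat \<Rightarrow> real" where
  "cvec n A C a k i = (\<Sum>p<n. C k p * wmat n A (replicate a True) p i)"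

lemma qform_hvec:
  "qform n A B m m' (replicate a False @ replicate b True) = (\<Sum>i<n. hvec n A B a m i * hvec n A B b m' i) / real n"
  using qform_flip[of n A B m m' "replicate a True" "replicate b True"] by (simp add: hvec_def wvec_def)

text \<open>The columns of the transposed \<open>C\<close> take the role of the columns of
  \<open>F\<close>. Powers then act from the other side, which exchanges \<open>True\<close> and
  \<open>False\<close> in the word.\<close>

lemma qform_cvec:
  "qform n A (\<lambda>i k. C k i) k l (replicate a True @ replicate b False) = (\<Sum>i<n. cvec n A C a k i * cvec n A C b l i) / real n"
proof -
  have "wvec n A (\<lambda>i k. C k i) (replicate a False) k i = cvec n A C a k i" if "i < n" for a k i
    using that wmat_flip[of i n _ A "replicate a True"] by (simp add: wvec_def cvec_def mult.commute)
  then show ?thesis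
    using qform_flip[of n A "\<lambda>i k. C k i" k l "replicate a False" "replicate b False"] by simp
qed

lemma hvec_0: "i < n \<Longrightarrow> hvec n A B 0 m i = B i m"
  by (simp add: hvec_def if_distrib[of "\<lambda>x. x * _"] cong: if_cong)

lemma hvec_Suc: "hvec n A B (Suc a) m i = (\<Sum>j<n. A i j * hvec n A B a m j)"
proof -
  have "hvec n A B (Suc a) m i = (\<Sum>q<n. \<Sum>j<n. A i j * (wmat n A (replicate a True) j q * B q m))"
    by (simp add: hvec_def letter_def sum_distrib_right mult.assoc)
  also have "\<dots> = (\<Sum>j<n. \<Sum>q<n. A i j * (wmat n A (replicate a True) j q * B q m))"
    by (rule sum.swap)
  finally show ?thesis by (simp add: hvec_def sum_distrib_left)
qed

lemma wpowF_eq_hvec: "i < n \<Longrightarrow> wpowF n W B a i m = hvec n W B a m i"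
  by (induction a arbitrary: i) (simp_all add: hvec_0 hvec_Suc)

lemma hvec_scale: "hvec n (\<lambda>i j. s * A i j) B a m i = s ^ a * hvec n A B a m i"
  by (simp add: hvec_def wmat_scale sum_distrib_left mult.assoc)

text \<open>Unrolling the recursion gives h_t as the sum of A^a F x_(t-a) over the lags a. Since
  \<open>toeplitz_in\<close> vanishes for a > t, the sum may run over all a < T, a range that does
  not depend on t.\<close>

lemma rnn_hidden_eq:
  assumes "i < n" "t < T"
  shows "rnn_hidden n nx W F x t i
    = (\<Sum>a<T. \<Sum>m<nx. hvec n (\<lambda>i j. 1 / sqrt (real n) * W i j) F a m i * toeplitz_in x a m t)"
  using assms
proof (induction t arbitrary: i)
  case 0
  let ?A = "\<lambda>i j. 1 / sqrt (real n) * W i j"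
  let ?G = "\<lambda>a. \<Sum>m<nx. hvec n ?A F a m i * toeplitz_in x a m 0"
  have "(\<Sum>a<T. ?G a) = (\<Sum>a<T. if a = 0 then ?G 0 else 0)"
    by (intro sum.cong refl) (auto simp: toeplitz_in_def)
  also have "\<dots> = ?G 0" using 0 by (subst sum.delta) auto
  finally show ?case using 0 by (simp add: toeplitz_in_def hvec_0)
next
  case (Suc t)
  let ?A = "\<lambda>i j. 1 / sqrt (real n) * W i j"
  let ?G = "\<lambda>a. \<Sum>m<nx. hvec n ?A F a m i * toeplitz_in x a m (Suc t)"
  have toep: "toeplitz_in x (Suc a) m (Suc t) = toeplitz_in x a m t" for a m
    by (cases "a \<le> t") (simp_all add: toeplitz_in_def)
  have "rnn_hidden n nx W F x (Suc t) i = (\<Sum>j<n. ?A i j * rnn_hidden n nx W F x t j) + (\<Sum>m<nx. F i m * x (Suc t) m)"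
    by (simp add: sum_distrib_left mult.assoc)
  also have "(\<Sum>j<n. ?A i j * rnn_hidden n nx W F x t j)
     = (\<Sum>j<n. \<Sum>a<T. \<Sum>m<nx. ?A i j * (hvec n ?A F a m j * toeplitz_in x a m t))"
    using Suc by (simp add: sum_distrib_left)
  also have "\<dots> = (\<Sum>a<T. \<Sum>j<n. \<Sum>m<nx. ?A i j * (hvec n ?A F a m j * toeplitz_in x a m t))"
    by (rule sum.swap)
  also have "\<dots> = (\<Sum>a<T. \<Sum>m<nx. \<Sum>j<n. ?A i j * (hvec n ?A F a m j * toeplitz_in x a m t))"
    by (intro sum.cong refl sum.swap)
  also have "\<dots> = (\<Sum>a<T. ?G (Suc a))"
    unfolding hvec_Suc sum_distrib_right toep by (simp add: mult.assoc)
  also have "(\<Sum>m<nx. F i m * x (Suc t) m) = ?G 0"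
    using Suc by (simp add: toeplitz_in_def hvec_0)
  also have "(\<Sum>a<T. ?G (Suc a)) + ?G 0 = (\<Sum>a<Suc T. ?G a)"
    by (subst sum.lessThan_Suc_shift) simp
  also have "\<dots> = (\<Sum>a<T. ?G a) + ?G T" by (rule sum.lessThan_Suc)
  \<comment> \<open>The shift of lags creates a term with lag T, which exceeds the current time
    \<open>Suc t\<close>.\<close>
  also have "?G T = 0" using Suc by (simp add: toeplitz_in_def)
  finally show ?case by simp
qed

lemma rnn_out_eq:
  assumes "t < T"
  shows "rnn_out n nx W F C x t k
    = 1 / sqrt (real n) * (\<Sum>p<n. \<Sum>a<T. \<Sum>m<nx. C k p * (hvec n (\<lambda>i j. 1 / sqrt (real n) * W i j) F a m p * toeplitz_in x a m t))"
  unfolding rnn_out_def using assms by (simp add: rnn_hidden_eq sum_distrib_left)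

lemma sum_cvec_hvec:
  "(\<Sum>p<n. C k p * (\<Sum>q<n. wmat n A (replicate a True) p q * B q m)) = (\<Sum>q<n. cvec n A C a k q * B q m)"
proof -
  have "(\<Sum>p<n. C k p * (\<Sum>q<n. wmat n A (replicate a True) p q * B q m))
     = (\<Sum>p<n. \<Sum>q<n. C k p * wmat n A (replicate a True) p q * B q m)"
    by (simp add: sum_distrib_left mult.assoc)
  also have "\<dots> = (\<Sum>q<n. \<Sum>p<n. C k p * wmat n A (replicate a True) p q * B q m)"
    by (rule sum.swap)
  finally show ?thesis by (simp add: cvec_def sum_distrib_right)
qed

text \<open>Collecting the powers on the side of C makes the output visibly linear in the entries of
  F, so that the derivative in F can be read off.\<close>

lemma rnn_out_eq_cvec:
  assumes "t < T"
  shows "rnn_out n nx W F C x t k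
    = 1 / sqrt (real n) * (\<Sum>a<T. \<Sum>m<nx. \<Sum>q<n. cvec n (\<lambda>i j. 1 / sqrt (real n) * W i j) C a k q * F q m * toeplitz_in x a m t)"
proof -
  let ?A = "\<lambda>i j. 1 / sqrt (real n) * W i j"
  have "(\<Sum>p<n. \<Sum>a<T. \<Sum>m<nx. C k p * (hvec n ?A F a m p * toeplitz_in x a m t))
     = (\<Sum>a<T. \<Sum>p<n. \<Sum>m<nx. C k p * (hvec n ?A F a m p * toeplitz_in x a m t))"
    by (rule sum.swap)
  also have "\<dots> = (\<Sum>a<T. \<Sum>m<nx. \<Sum>p<n. C k p * (hvec n ?A F a m p * toeplitz_in x a m t))"
    by (intro sum.cong refl sum.swap)
  also have "\<dots> = (\<Sum>a<T. \<Sum>m<nx. (\<Sum>p<n. C k p * hvec n ?A F a m p) * toeplitz_in x a m t)"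
    by (simp add: sum_distrib_right mult.assoc)
  also have "\<dots> = (\<Sum>a<T. \<Sum>m<nx. \<Sum>q<n. cvec n ?A C a k q * F q m * toeplitz_in x a m t)"
    unfolding hvec_def sum_cvec_hvec sum_distrib_right ..
  finally show ?thesis unfolding rnn_out_eq[OF assms] by simp
qed

section \<open>Partial derivatives of the output\<close>

lemma upd2_derivative:
  "((\<lambda>a. upd2 A i j a p q) has_real_derivative (if p = i then (if q = j then 1 else 0) else 0)) (at z)"
  by (cases "p = i"; cases "q = j") (simp_all add: upd2_def)

lemma sum_mult_if_eq:
  fixes f :: "nat \<Rightarrow> real"
  assumes "i < n" shows "(\<Sum>k<n. f k * (if k = i then b else 0)) = f i * b"
proof -
  have "(\<Sum>k<n. f k * (if k = i then b else 0)) = (\<Sum>k<n. if k = i then f k * b else 0)"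
    by (intro sum.cong refl) auto
  then show ?thesis using assms by simp
qed

lemma deriv_rnn_out_C:
  assumes "i < n" "t < T"
  shows "deriv (\<lambda>a. rnn_out n nx W F (upd2 C q i a) x t k) (C q i)
    = (if k = q then 1 / sqrt (real n) * (\<Sum>a<T. \<Sum>m<nx. hvec n (\<lambda>i j. 1 / sqrt (real n) * W i j) F a m i * toeplitz_in x a m t) else 0)"
proof (rule DERIV_imp_deriv)
  let ?h = "\<lambda>p. rnn_hidden n nx W F x t p"
  have "((\<lambda>a. rnn_out n nx W F (upd2 C q i a) x t k) has_real_derivative
     1 / sqrt (real n) * (\<Sum>p<n. (if k = q then (if p = i then 1 else 0) else 0) * ?h p)) (at (C q i))"
    unfolding rnn_out_def by (intro DERIV_cmult DERIV_sum DERIV_cmult_right upd2_derivative)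
  also have "(\<Sum>p<n. (if k = q then (if p = i then 1 else 0) else 0) * ?h p) = (if k = q then ?h i else 0)"
    using sum_mult_if_eq[OF assms(1), of ?h 1] by (cases "k = q") (simp_all add: mult.commute)
  finally show "((\<lambda>a. rnn_out n nx W F (upd2 C q i a) x t k) has_real_derivative
     (if k = q then 1 / sqrt (real n) * (\<Sum>a<T. \<Sum>m<nx. hvec n (\<lambda>i j. 1 / sqrt (real n) * W i j) F a m i * toeplitz_in x a m t) else 0)) (at (C q i))"
    using rnn_hidden_eq[OF assms, of nx W F x] by (cases "k = q") simp_all
qed

lemma deriv_rnn_out_F:
  assumes "i < n" "m < nx" "t < T"
  shows "deriv (\<lambda>a. rnn_out n nx W (upd2 F i m a) C x t k) (F i m)
    = 1 / sqrt (real n) * (\<Sum>a<T. cvec n (\<lambda>i j. 1 / sqrt (real n) * W i j) C a k i * toeplitz_in x a m t)"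
proof (rule DERIV_imp_deriv)
  let ?c = "cvec n (\<lambda>i j. 1 / sqrt (real n) * W i j) C"
  have "((\<lambda>a. rnn_out n nx W (upd2 F i m a) C x t k) has_real_derivative
     1 / sqrt (real n) * (\<Sum>a<T. \<Sum>m'<nx. \<Sum>q<n. ?c a k q * (if q = i then (if m' = m then 1 else 0) else 0) * toeplitz_in x a m' t)) (at (F i m))"
    unfolding rnn_out_eq_cvec[OF assms(3)] by (intro DERIV_cmult DERIV_sum DERIV_cmult_right upd2_derivative)
  also have "(\<Sum>a<T. \<Sum>m'<nx. \<Sum>q<n. ?c a k q * (if q = i then (if m' = m then 1 else 0) else 0) * toeplitz_in x a m' t)
    = (\<Sum>a<T. \<Sum>m'<nx. ?c a k i * toeplitz_in x a m' t * (if m' = m then 1 else 0))"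
    unfolding sum_distrib_right[symmetric] sum_mult_if_eq[OF assms(1)] by (simp only: mult_ac)
  also have "\<dots> = (\<Sum>a<T. ?c a k i * toeplitz_in x a m t)"
    unfolding sum_mult_if_eq[OF assms(2)] by simp
  finally show "((\<lambda>a. rnn_out n nx W (upd2 F i m a) C x t k) has_real_derivative
     1 / sqrt (real n) * (\<Sum>a<T. ?c a k i * toeplitz_in x a m t)) (at (F i m))" .
qed

text \<open>The power A^a with A = s W has the derivative s times the sum of A^d E_ij A^(a-1-d) over
  d < a, where E_ij is the elementary matrix. It follows from \<open>wmat_derivative\<close> by the
  chain rule.\<close>

lemma hvec_derivative:
  fixes s :: real and W :: "nat \<Rightarrow> nat \<Rightarrow> real"
  assumes "i < n" "j < n"
  defines "A \<equiv> \<lambda>W i j. s * W i j"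
  shows "((\<lambda>\<alpha>. hvec n (A (upd2 W i j \<alpha>)) B a m p) has_real_derivative
     s * (\<Sum>d<a. wmat n (A W) (replicate d True) p i * hvec n (A W) B (a - 1 - d) m j)) (at (W i j))"
proof -
  let ?A = "A W"
  \<comment> \<open>Writing \<alpha> into an entry of \<open>W\<close> amounts to writing s \<alpha>
    into the entry of the scaled matrix, which introduces the linear inner function.\<close>
  have upd: "A (upd2 W i j \<alpha>) = upd_letter True ?A i j (s * \<alpha>)" for \<alpha>
    by (auto simp: A_def upd_letter_def upd2_def fun_eq_iff)
  have lin: "((\<lambda>\<alpha>. s * \<alpha>) has_real_derivative s) (at (W i j))"
    by (auto intro!: derivative_eq_intros)
  have "((\<lambda>\<alpha>. wmat n (A (upd2 W i j \<alpha>)) (replicate a True) p q) has_real_derivative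
     (\<Sum>z\<leftarrow>splits (replicate a True). split_term n ?A True i j p q z) * s) (at (W i j))" for q
    unfolding upd using wmat_derivative[OF assms(1,2), of True ?A "replicate a True" p q]
    by (intro DERIV_chain2[OF _ lin]) (simp add: letter_def A_def)
  moreover have "(\<Sum>z\<leftarrow>splits (replicate a True). split_term n ?A True i j p q z)
     = (\<Sum>d<a. wmat n ?A (replicate d True) p i * wmat n ?A (replicate (a - 1 - d) True) j q)" for q
    unfolding splits_replicate map_map
    by (subst sum_list_distinct_conv_sum_set) (simp_all add: split_term_def atLeast0LessThan)
  ultimately have d: "((\<lambda>\<alpha>. wmat n (A (upd2 W i j \<alpha>)) (replicate a True) p q) has_real_derivative
     (\<Sum>d<a. wmat n ?A (replicate d True) p i * wmat n ?A (replicate (a - 1 - d) True) j q) * s) (at (W i j))" for q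
    by simp
  have "((\<lambda>\<alpha>. hvec n (A (upd2 W i j \<alpha>)) B a m p) has_real_derivative
     (\<Sum>q<n. (\<Sum>d<a. wmat n ?A (replicate d True) p i * wmat n ?A (replicate (a - 1 - d) True) j q) * s * B q m)) (at (W i j))"
    unfolding hvec_def by (intro DERIV_sum DERIV_cmult_right d)
  also have "(\<Sum>q<n. (\<Sum>d<a. wmat n ?A (replicate d True) p i * wmat n ?A (replicate (a - 1 - d) True) j q) * s * B q m)
     = (\<Sum>q<n. \<Sum>d<a. s * (wmat n ?A (replicate d True) p i * (wmat n ?A (replicate (a - 1 - d) True) j q * B q m)))"
    unfolding sum_distrib_right by (simp only: mult_ac)
  also have "\<dots> = (\<Sum>d<a. \<Sum>q<n. s * (wmat n ?A (replicate d True) p i * (wmat n ?A (replicate (a - 1 - d) True) j q * B q m)))"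
    by (rule sum.swap)
  also have "\<dots> = s * (\<Sum>d<a. wmat n ?A (replicate d True) p i * hvec n ?A B (a - 1 - d) m j)"
    by (simp add: hvec_def sum_distrib_left)
  finally show ?thesis .
qed

text \<open>In a pair (a, d), a is the lag between input and output, and d counts the
  multiplications by W that come after the perturbed one.\<close>

definition lags :: "nat \<Rightarrow> (nat \<times> nat) set" where
  "lags T = Sigma {..<T} (\<lambda>a. {..<a})"

lemma finite_lags [simp]: "finite (lags T)"
  by (simp add: lags_def)

text \<open>Of the two factors 1 / sqrt n one belongs to the output layer and one to the scaling of
  W. Each summand is a function of i times a function of j; this product structure makes the kernel
  computable.\<close>

lemma deriv_rnn_out_W:
  assumes "i < n" "j < n" "t < T"
  shows "deriv (\<lambda>\<alpha>. rnn_out n nx (upd2 W i j \<alpha>) F C x t k) (W i j)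
    = 1 / real n * (\<Sum>(a, d)\<in>lags T. \<Sum>m<nx. cvec n (\<lambda>i j. 1 / sqrt (real n) * W i j) C d k i
        * (hvec n (\<lambda>i j. 1 / sqrt (real n) * W i j) F (a - 1 - d) m j * toeplitz_in x a m t))"
proof (rule DERIV_imp_deriv)
  let ?A = "\<lambda>i j. 1 / sqrt (real n) * W i j"
  let ?s = "1 / sqrt (real n)"
  let ?w = "\<lambda>d. wmat n ?A (replicate d True)" and ?h = "\<lambda>a m. hvec n ?A F a m j"
  have "((\<lambda>\<alpha>. rnn_out n nx (upd2 W i j \<alpha>) F C x t k) has_real_derivative
     ?s * (\<Sum>p<n. \<Sum>a<T. \<Sum>m<nx. C k p * (?s * (\<Sum>d<a. ?w d p i * ?h (a - 1 - d) m) * toeplitz_in x a m t))) (at (W i j))"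
    unfolding rnn_out_eq[OF assms(3)]
    by (intro DERIV_cmult DERIV_sum DERIV_cmult_right hvec_derivative assms)
  also have "?s * (\<Sum>p<n. \<Sum>a<T. \<Sum>m<nx. C k p * (?s * (\<Sum>d<a. ?w d p i * ?h (a - 1 - d) m) * toeplitz_in x a m t))
     = (?s * ?s) * (\<Sum>p<n. \<Sum>a<T. \<Sum>m<nx. \<Sum>d<a. C k p * ?w d p i * (?h (a - 1 - d) m * toeplitz_in x a m t))"
    unfolding mult.assoc sum_distrib_left sum_distrib_right by (simp only: mult_ac)
  also have "?s * ?s = 1 / real n" by simp
  also have "(\<Sum>p<n. \<Sum>a<T. \<Sum>m<nx. \<Sum>d<a. C k p * ?w d p i * (?h (a - 1 - d) m * toeplitz_in x a m t))
     = (\<Sum>a<T. \<Sum>p<n. \<Sum>m<nx. \<Sum>d<a. C k p * ?w d p i * (?h (a - 1 - d) m * toeplitz_in x a m t))"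
    by (rule sum.swap)
  also have "\<dots> = (\<Sum>a<T. \<Sum>p<n. \<Sum>d<a. \<Sum>m<nx. C k p * ?w d p i * (?h (a - 1 - d) m * toeplitz_in x a m t))"
    by (intro sum.cong refl sum.swap)
  also have "\<dots> = (\<Sum>a<T. \<Sum>d<a. \<Sum>p<n. \<Sum>m<nx. C k p * ?w d p i * (?h (a - 1 - d) m * toeplitz_in x a m t))"
    by (intro sum.cong refl sum.swap)
  also have "\<dots> = (\<Sum>a<T. \<Sum>d<a. \<Sum>m<nx. \<Sum>p<n. C k p * ?w d p i * (?h (a - 1 - d) m * toeplitz_in x a m t))"
    by (intro sum.cong refl sum.swap)
  also have "\<dots> = (\<Sum>a<T. \<Sum>d<a. \<Sum>m<nx. cvec n ?A C d k i * (?h (a - 1 - d) m * toeplitz_in x a m t))"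
    unfolding cvec_def sum_distrib_right ..
  also have "\<dots> = (\<Sum>(a, d)\<in>lags T. \<Sum>m<nx. cvec n ?A C d k i * (?h (a - 1 - d) m * toeplitz_in x a m t))"
    unfolding lags_def by (rule sum.Sigma) auto
  finally show "((\<lambda>\<alpha>. rnn_out n nx (upd2 W i j \<alpha>) F C x t k) has_real_derivative
      1 / real n * (\<Sum>(a, d)\<in>lags T. \<Sum>m<nx. cvec n ?A C d k i * (?h (a - 1 - d) m * toeplitz_in x a m t))) (at (W i j))" .
qed

section \<open>The kernel assembled from its derivatives\<close>

lemma sum_sum_product:
  fixes f g :: "'b \<Rightarrow> 'c \<Rightarrow> real"
  shows "(\<Sum>i\<in>I. (\<Sum>\<alpha>\<in>S. f \<alpha> i) * (\<Sum>\<beta>\<in>S'. g \<beta> i)) = (\<Sum>\<alpha>\<in>S. \<Sum>\<beta>\<in>S'. \<Sum>i\<in>I. f \<alpha> i * g \<beta> i)"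
proof -
  have "(\<Sum>i\<in>I. (\<Sum>\<alpha>\<in>S. f \<alpha> i) * (\<Sum>\<beta>\<in>S'. g \<beta> i)) = (\<Sum>i\<in>I. \<Sum>\<alpha>\<in>S. \<Sum>\<beta>\<in>S'. f \<alpha> i * g \<beta> i)"
    by (simp add: sum_product)
  also have "\<dots> = (\<Sum>\<alpha>\<in>S. \<Sum>i\<in>I. \<Sum>\<beta>\<in>S'. f \<alpha> i * g \<beta> i)" by (rule sum.swap)
  also have "\<dots> = (\<Sum>\<alpha>\<in>S. \<Sum>\<beta>\<in>S'. \<Sum>i\<in>I. f \<alpha> i * g \<beta> i)" by (intro sum.cong refl sum.swap)
  finally show ?thesis .
qed

text \<open>The three summands come from W, F and C. The forms \<open>qC\<close> and
  \<open>qF\<close> are parameters so that the same expression describes the kernel at finite n and,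
  with the limits of the forms inserted, its limit.\<close>

definition ntk_sum :: "nat \<Rightarrow> nat \<Rightarrow> (nat \<Rightarrow> nat \<Rightarrow> nat \<Rightarrow> nat \<Rightarrow> real) \<Rightarrow> (nat \<Rightarrow> nat \<Rightarrow> nat \<Rightarrow> nat \<Rightarrow> real)
    \<Rightarrow> (nat \<Rightarrow> nat \<Rightarrow> real) \<Rightarrow> (nat \<Rightarrow> nat \<Rightarrow> real) \<Rightarrow> nat \<Rightarrow> nat \<Rightarrow> nat \<Rightarrow> nat \<Rightarrow> real" where
  "ntk_sum T nx qC qF x x' t k s l = (\<Sum>((a, d), m)\<in>lags T \<times> {..<nx}. \<Sum>((a', d'), m')\<in>lags T \<times> {..<nx}.
        qC d d' k l * qF (a - 1 - d) (a' - 1 - d') m m' * (toeplitz_in x a m t * toeplitz_in x' a' m' s))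
   + (\<Sum>m<nx. \<Sum>a<T. \<Sum>a'<T. qC a a' k l * (toeplitz_in x a m t * toeplitz_in x' a' m s))
   + (if k = l then \<Sum>(a, m)\<in>{..<T} \<times> {..<nx}. \<Sum>(a', m')\<in>{..<T} \<times> {..<nx}.
        qF a a' m m' * (toeplitz_in x a m t * toeplitz_in x' a' m' s) else 0)"

text \<open>Every derivative is a finite sum of products of propagated vectors, so the sums over
  hidden units turn into quadratic forms. The powers of n cancel exactly, in the W part as 1/n^2
  against two factors n.\<close>

theorem rnn_ntk_eq:
  fixes W F C x x' :: "nat \<Rightarrow> nat \<Rightarrow> real"
  assumes n: "n \<ge> 1" and t: "t < T" "s < T" and k: "k < ny"
  defines "A \<equiv> \<lambda>i j. 1 / sqrt (real n) * W i j"
  defines "qF \<equiv> \<lambda>a b m m'. qform n A F m m' (replicate a False @ replicate b True)"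
  defines "qC \<equiv> \<lambda>a b k l. qform n A (\<lambda>i k. C k i) k l (replicate a True @ replicate b False)"
  shows "rnn_ntk n nx ny W F C x x' t k s l = ntk_sum T nx qC qF x x' t k s l"
proof -
  let ?X = "\<lambda>a m a' m'. toeplitz_in x a m t * toeplitz_in x' a' m' s"
  let ?dW = "\<lambda>x t k i j. deriv (\<lambda>a. rnn_out n nx (upd2 W i j a) F C x t k) (W i j)"
  let ?dF = "\<lambda>x t k i m. deriv (\<lambda>a. rnn_out n nx W (upd2 F i m a) C x t k) (F i m)"
  let ?dC = "\<lambda>x t k q i. deriv (\<lambda>a. rnn_out n nx W F (upd2 C q i a) x t k) (C q i)"
  let ?s = "1 / sqrt (real n)"
  have ss: "?s * ?s = 1 / real n" by simp
  have qF: "(\<Sum>i<n. hvec n A F a m i * hvec n A F b m' i) = real n * qF a b m m'" for a b m m'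
    using n by (simp add: qF_def qform_hvec)
  have qC: "(\<Sum>i<n. cvec n A C a k i * cvec n A C b l i) = real n * qC a b k l" for a b k l
    using n by (simp add: qC_def qform_cvec)
  define f where "f = (\<lambda>x t k ((a, d), m) i j. cvec n A C d k i * (hvec n A F (a - 1 - d) m j * toeplitz_in x a m t))"
  have dW: "?dW x t k i j
     = 1 / real n * (\<Sum>\<alpha>\<in>lags T \<times> {..<nx}. f x t k \<alpha> i j)" if "i < n" "j < n" "t < T" for i j t k x
  proof -
    have "(\<Sum>\<alpha>\<in>lags T \<times> {..<nx}. f x t k \<alpha> i j) = (\<Sum>\<beta>\<in>lags T. \<Sum>m<nx. f x t k (\<beta>, m) i j)"
      by (simp add: sum.cartesian_product)
    then show ?thesis
      unfolding deriv_rnn_out_W[OF that] f_def A_def by (simp add: case_prod_unfold)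
  qed
  \<comment> \<open>The factors depending on i and on j separate, so the double sum is a product of
    a form in C and a form in F.\<close>
  have ff: "(\<Sum>i<n. \<Sum>j<n. f x t k ((a, d), m) i j * f x' s l ((a', d'), m') i j)
     = real n ^ 2 * (qC d d' k l * qF (a - 1 - d) (a' - 1 - d') m m' * ?X a m a' m')" for a d m a' d' m'
  proof -
    have "(\<Sum>i<n. \<Sum>j<n. f x t k ((a, d), m) i j * f x' s l ((a', d'), m') i j)
       = (\<Sum>i<n. cvec n A C d k i * cvec n A C d' l i) *
          (\<Sum>j<n. hvec n A F (a - 1 - d) m j * hvec n A F (a' - 1 - d') m' j) * ?X a m a' m'"
      unfolding sum_product sum_distrib_right by (simp add: f_def mult_ac sum_distrib_left)
    then show ?thesis unfolding qC qF by (simp add: power2_eq_square mult_ac)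
  qed
  have W: "(\<Sum>i<n. \<Sum>j<n. ?dW x t k i j * ?dW x' s l i j)
    = (\<Sum>((a, d), m)\<in>lags T \<times> {..<nx}. \<Sum>((a', d'), m')\<in>lags T \<times> {..<nx}.
        qC d d' k l * qF (a - 1 - d) (a' - 1 - d') m m' * ?X a m a' m')"
  proof -
    have "(\<Sum>i<n. \<Sum>j<n. ?dW x t k i j * ?dW x' s l i j)
      = (\<Sum>(i, j)\<in>{..<n} \<times> {..<n}. (1 / real n * (\<Sum>\<alpha>\<in>lags T \<times> {..<nx}. f x t k \<alpha> i j)) * (1 / real n * (\<Sum>\<alpha>\<in>lags T \<times> {..<nx}. f x' s l \<alpha> i j)))"
      unfolding sum.cartesian_product[symmetric] by (intro sum.cong refl) (simp add: dW t)
    also have "\<dots> = 1 / real n ^ 2 * (\<Sum>\<gamma>\<in>{..<n} \<times> {..<n}. (\<Sum>\<alpha>\<in>lags T \<times> {..<nx}. f x t k \<alpha> (fst \<gamma>) (snd \<gamma>)) * (\<Sum>\<alpha>\<in>lags T \<times> {..<nx}. f x' s l \<alpha> (fst \<gamma>) (snd \<gamma>)))"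
      unfolding sum_distrib_left[of "1 / real n ^ 2"] by (intro sum.cong refl) (auto simp: power2_eq_square)
    also have "\<dots> = 1 / real n ^ 2 * (\<Sum>\<alpha>\<in>lags T \<times> {..<nx}. \<Sum>\<beta>\<in>lags T \<times> {..<nx}. \<Sum>\<gamma>\<in>{..<n} \<times> {..<n}. f x t k \<alpha> (fst \<gamma>) (snd \<gamma>) * f x' s l \<beta> (fst \<gamma>) (snd \<gamma>))"
      unfolding sum_sum_product ..
    also have "\<dots> = 1 / real n ^ 2 * (\<Sum>\<alpha>\<in>lags T \<times> {..<nx}. \<Sum>\<beta>\<in>lags T \<times> {..<nx}. \<Sum>i<n. \<Sum>j<n. f x t k \<alpha> i j * f x' s l \<beta> i j)"
      by (simp add: sum.cartesian_product case_prod_unfold)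
    also have "\<dots> = (\<Sum>((a, d), m)\<in>lags T \<times> {..<nx}. \<Sum>((a', d'), m')\<in>lags T \<times> {..<nx}.
        qC d d' k l * qF (a - 1 - d) (a' - 1 - d') m m' * ?X a m a' m')"
    proof -
      define G where "G = (\<lambda>((a, d), m) ((a', d'), m').
        qC d d' k l * qF (a - 1 - d) (a' - 1 - d') m m' * ?X a m a' m')"
      have "(\<Sum>i<n. \<Sum>j<n. f x t k \<alpha> i j * f x' s l \<beta> i j) = real n ^ 2 * G \<alpha> \<beta>" for \<alpha> \<beta>
        using ff[of "fst (fst \<alpha>)" "snd (fst \<alpha>)" "snd \<alpha>" "fst (fst \<beta>)" "snd (fst \<beta>)" "snd \<beta>"]
        by (simp add: G_def case_prod_unfold)
      then have "1 / real n ^ 2 * (\<Sum>\<alpha>\<in>lags T \<times> {..<nx}. \<Sum>\<beta>\<in>lags T \<times> {..<nx}. \<Sum>i<n. \<Sum>j<n. f x t k \<alpha> i j * f x' s l \<beta> i j)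
        = (\<Sum>\<alpha>\<in>lags T \<times> {..<nx}. \<Sum>\<beta>\<in>lags T \<times> {..<nx}. G \<alpha> \<beta>)"
        using n by (simp add: sum_distrib_left[symmetric])
      then show ?thesis by (simp add: G_def case_prod_unfold)
    qed
    finally show ?thesis .
  qed
  have F: "(\<Sum>i<n. \<Sum>m<nx. ?dF x t k i m * ?dF x' s l i m)
    = (\<Sum>m<nx. \<Sum>a<T. \<Sum>a'<T. qC a a' k l * ?X a m a' m)"
  proof -
    let ?f = "\<lambda>x t k m a i. cvec n A C a k i * toeplitz_in x a m t"
    have "(\<Sum>i<n. \<Sum>m<nx. ?dF x t k i m * ?dF x' s l i m)
      = (\<Sum>m<nx. \<Sum>i<n. ?dF x t k i m * ?dF x' s l i m)"
      by (rule sum.swap)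
    also have "\<dots> = (\<Sum>m<nx. 1 / real n * (\<Sum>i<n. (\<Sum>a<T. ?f x t k m a i) * (\<Sum>a<T. ?f x' s l m a i)))"
    proof (rule sum.cong[OF refl])
      fix m assume "m \<in> {..<nx}"
      then have m: "m < nx" by simp
      have "(\<Sum>i<n. ?dF x t k i m * ?dF x' s l i m)
        = (\<Sum>i<n. (?s * ?s) * ((\<Sum>a<T. ?f x t k m a i) * (\<Sum>a<T. ?f x' s l m a i)))"
      proof (rule sum.cong[OF refl])
        fix i assume "i \<in> {..<n}"
        then have i: "i < n" by simp
        show "?dF x t k i m * ?dF x' s l i m
          = (?s * ?s) * ((\<Sum>a<T. ?f x t k m a i) * (\<Sum>a<T. ?f x' s l m a i))"
          unfolding deriv_rnn_out_F[OF i m t(1)] deriv_rnn_out_F[OF i m t(2)] A_def by (simp only: mult_ac)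
      qed
      then show "(\<Sum>i<n. ?dF x t k i m * ?dF x' s l i m)
        = 1 / real n * (\<Sum>i<n. (\<Sum>a<T. ?f x t k m a i) * (\<Sum>a<T. ?f x' s l m a i))"
        unfolding ss sum_distrib_left[symmetric] .
    qed
    also have "\<dots> = (\<Sum>m<nx. 1 / real n * (\<Sum>a<T. \<Sum>a'<T. (\<Sum>i<n. cvec n A C a k i * cvec n A C a' l i) * ?X a m a' m))"
      unfolding sum_sum_product unfolding sum_distrib_right by (simp only: mult_ac)
    also have "\<dots> = (\<Sum>m<nx. \<Sum>a<T. \<Sum>a'<T. qC a a' k l * ?X a m a' m)"
      unfolding qC sum_distrib_left using n by simp
    finally show ?thesis .
  qed
  have C: "(\<Sum>q<ny. \<Sum>i<n. ?dC x t k q i * ?dC x' s l q i)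
    = (if k = l then \<Sum>(a, m)\<in>{..<T} \<times> {..<nx}. \<Sum>(a', m')\<in>{..<T} \<times> {..<nx}.
        qF a a' m m' * ?X a m a' m' else 0)"
  proof -
    let ?h = "\<lambda>x t i. \<Sum>\<alpha>\<in>{..<T} \<times> {..<nx}. hvec n A F (fst \<alpha>) (snd \<alpha>) i * toeplitz_in x (fst \<alpha>) (snd \<alpha>) t"
    have h: "(\<Sum>a<T. \<Sum>m<nx. hvec n A F a m i * toeplitz_in x a m t) = ?h x t i" for x t i
      by (simp add: sum.cartesian_product case_prod_unfold)
    have dC: "?dC x t k q i = (if k = q then ?s * ?h x t i else 0)"
      if "i < n" "t < T" for q i k t x
      using deriv_rnn_out_C[OF that, of nx W F C q x k] unfolding A_def[symmetric] h .
    have "(\<Sum>q<ny. \<Sum>i<n. ?dC x t k q i * ?dC x' s l q i)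
      = (\<Sum>q<ny. \<Sum>i<n. (if k = q then ?s * ?h x t i else 0) * (if l = q then ?s * ?h x' s i else 0))"
      by (intro sum.cong refl) (simp only: dC t lessThan_iff)
    \<comment> \<open>A row of C influences only its own output component, so a nonzero product
      requires q = k = l. This is the origin of the identity matrix in the limit.\<close>
    also have "\<dots> = (\<Sum>q<ny. if q = k then (if k = l then 1 / real n * (\<Sum>i<n. ?h x t i * ?h x' s i) else 0) else 0)"
    proof (intro sum.cong refl)
      fix q
      show "(\<Sum>i<n. (if k = q then ?s * ?h x t i else 0) * (if l = q then ?s * ?h x' s i else 0))
        = (if q = k then (if k = l then 1 / real n * (\<Sum>i<n. ?h x t i * ?h x' s i) else 0) else 0)"
      proof (cases "q = k \<and> k = l")
        case True
        have "(\<Sum>i<n. (?s * ?h x t i) * (?s * ?h x' s i)) = (?s * ?s) * (\<Sum>i<n. ?h x t i * ?h x' s i)"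
          unfolding sum_distrib_left[of "?s * ?s"] by (intro sum.cong refl) (simp only: mult_ac)
        then show ?thesis using True unfolding ss by (simp only: refl if_True simp_thms)
      next
        case False
        then show ?thesis by (intro trans[OF sum.neutral]) (auto simp del: mult_eq_0_iff)
      qed
    qed
    also have "\<dots> = (if k = l then 1 / real n * (\<Sum>i<n. ?h x t i * ?h x' s i) else 0)"
      using k by (subst sum.delta) auto
    also have "1 / real n * (\<Sum>i<n. ?h x t i * ?h x' s i)
       = 1 / real n * (\<Sum>\<alpha>\<in>{..<T} \<times> {..<nx}. \<Sum>\<beta>\<in>{..<T} \<times> {..<nx}. (\<Sum>i<n. hvec n A F (fst \<alpha>) (snd \<alpha>) i * hvec n A F (fst \<beta>) (snd \<beta>) i)
           * (toeplitz_in x (fst \<alpha>) (snd \<alpha>) t * toeplitz_in x' (fst \<beta>) (snd \<beta>) s))"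
      unfolding sum_sum_product unfolding sum_distrib_right by (simp only: mult_ac)
    also have "\<dots> = (\<Sum>(a, m)\<in>{..<T} \<times> {..<nx}. \<Sum>(a', m')\<in>{..<T} \<times> {..<nx}.
        qF a a' m m' * ?X a m a' m')"
      unfolding qF sum_distrib_left using n by (simp add: case_prod_unfold)
    finally show ?thesis .
  qed
  show ?thesis unfolding rnn_ntk_def W F C ntk_sum_def ..
qed

section \<open>A multivariate continuity theorem\<close>

text \<open>A weight bounded away from 0 can be normalized to a probability density. Under the
  tilted measure the hypothesis says that the characteristic functions of \<open>X n\<close>
  converge to that of \<open>N\<close>, so the one-dimensional theorem applies; the normalization is
  then undone.\<close>

lemma weighted_levy_pos:
  fixes D X :: "nat \<Rightarrow> 'a \<Rightarrow> real" and g :: "real \<Rightarrow> complex"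
  assumes "prob_space M" "real_distribution N"
    and meas [measurable]: "\<And>n. D n \<in> borel_measurable M" "\<And>n. X n \<in> borel_measurable M"
    and b: "b > 0" "\<And>n \<omega>. b \<le> D n \<omega>" "\<And>n \<omega>. D n \<omega> \<le> B"
    and conv: "\<And>s. (\<lambda>n. \<integral>\<omega>. of_real (D n \<omega>) * iexp (s * X n \<omega>) \<partial>M) \<longlonglongrightarrow> of_real z * char N s"
    and g: "continuous_on UNIV g" "bounded (range g)"
  shows "(\<lambda>n. \<integral>\<omega>. of_real (D n \<omega>) * g (X n \<omega>) \<partial>M) \<longlonglongrightarrow> of_real z * (\<integral>x. g x \<partial>N)"
proof -
  interpret prob_space M by fact
  interpret N: real_distribution N by fact
  have [measurable]: "g \<in> borel_measurable borel" by (rule borel_measurable_continuous_onI) fact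
  have intD: "integrable M (D n)" for n
  proof (rule integrable_const_bound[of _ B])
    have "norm (D n \<omega>) \<le> B" for \<omega> using b(1) b(2)[of n \<omega>] b(3)[of n \<omega>] by simp
    then show "AE \<omega> in M. norm (D n \<omega>) \<le> B" by simp
  qed measurable
  define Z where "Z n = expectation (D n)" for n
  have Zb: "Z n \<ge> b" for n
    using integral_mono[of M "\<lambda>_. b" "D n"] intD b(2) by (simp add: Z_def prob_space)
  \<comment> \<open>At s = 0 the hypothesis is the convergence of the normalizing constants; the
    lower bound b keeps their limit positive.\<close>
  have "(\<lambda>n. of_real (Z n) :: complex) \<longlonglongrightarrow> of_real z"
    using conv[of 0] by (simp add: Z_def N.char_zero)
  then have Zlim: "Z \<longlonglongrightarrow> z" by (simp add: tendsto_of_real_iff)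
  then have "z \<ge> b" using Zb by (intro LIMSEQ_le_const) auto
  then have z: "z > 0" using b by simp
  define Mn where "Mn n = distr (density M (\<lambda>\<omega>. ennreal (D n \<omega> / Z n))) borel (X n)" for n
  have pos: "0 \<le> D n \<omega> / Z n" for n \<omega> using b(1) b(2)[of n \<omega>] Zb[of n] by simp
  have Mn_int: "(\<integral>x. h x \<partial>Mn n) = (\<integral>\<omega>. of_real (D n \<omega>) * h (X n \<omega>) \<partial>M) / of_real (Z n)"
    if [measurable]: "h \<in> borel_measurable borel" for h :: "real \<Rightarrow> complex" and n
  proof -
    have "(\<integral>x. h x \<partial>Mn n) = (\<integral>\<omega>. h (X n \<omega>) \<partial>density M (\<lambda>\<omega>. ennreal (D n \<omega> / Z n)))"
      unfolding Mn_def by (rule integral_distr) measurable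
    also have "\<dots> = (\<integral>\<omega>. (D n \<omega> / Z n) *\<^sub>R h (X n \<omega>) \<partial>M)"
      by (rule integral_density) (use pos in auto)
    also have "\<dots> = (\<integral>\<omega>. of_real (D n \<omega>) * h (X n \<omega>) / of_real (Z n) \<partial>M)"
      by (intro Bochner_Integration.integral_cong refl) (simp add: scaleR_conv_of_real)
    finally show ?thesis by simp
  qed
  have Mn: "real_distribution (Mn n)" for n
  proof -
    have "(\<integral>\<^sup>+\<omega>. ennreal (D n \<omega> / Z n) \<partial>M) = ennreal (\<integral>\<omega>. D n \<omega> / Z n \<partial>M)"
      using intD pos by (intro nn_integral_eq_integral) auto
    also have "\<dots> = 1" using Zb[of n] b(1) by (simp add: Z_def[symmetric])
    finally have "prob_space (density M (\<lambda>\<omega>. ennreal (D n \<omega> / Z n)))"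
      by (intro prob_spaceI) (simp add: emeasure_density cong: nn_integral_cong)
    then interpret P: prob_space "density M (\<lambda>\<omega>. ennreal (D n \<omega> / Z n))" .
    show ?thesis unfolding Mn_def by (rule P.real_distribution_distr) simp
  qed
  have "weak_conv_m Mn N"
  proof (rule levy_continuity[OF Mn \<open>real_distribution N\<close>])
    fix s
    have "(\<lambda>n. (\<integral>\<omega>. of_real (D n \<omega>) * iexp (s * X n \<omega>) \<partial>M) / of_real (Z n)) \<longlonglongrightarrow> of_real z * char N s / of_real z"
      using z by (intro tendsto_divide conv tendsto_of_real Zlim) auto
    moreover have "char (Mn n) s = (\<integral>\<omega>. of_real (D n \<omega>) * iexp (s * X n \<omega>) \<partial>M) / of_real (Z n)" for n
      unfolding char_def by (rule Mn_int) measurable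
    ultimately show "(\<lambda>n. char (Mn n) s) \<longlonglongrightarrow> char N s" using z by simp
  qed
  moreover obtain C where "\<And>x. norm (g x) \<le> C" using g(2) by (auto simp: bounded_iff)
  ultimately have "(\<lambda>n. \<integral>x. g x \<partial>Mn n) \<longlonglongrightarrow> (\<integral>x. g x \<partial>N)"
    using g(1) by (intro weak_conv_imp_integral_bdd_continuous_conv[OF Mn \<open>real_distribution N\<close>])
      (auto simp: continuous_on_eq_continuous_at)
  then have "(\<lambda>n. of_real (Z n) * (\<integral>x. g x \<partial>Mn n)) \<longlonglongrightarrow> of_real z * (\<integral>x. g x \<partial>N)"
    by (intro tendsto_mult tendsto_of_real Zlim)
  moreover have "of_real (Z n) * (\<integral>x. g x \<partial>Mn n) = (\<integral>\<omega>. of_real (D n \<omega>) * g (X n \<omega>) \<partial>M)" for n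
    using Zb[of n] b(1) by (subst Mn_int) auto
  ultimately show ?thesis by simp
qed

text \<open>Adding B + 1 moves the weight into the interval from 1 to 2 B + 1. The added constant is
  removed again by the unweighted case, for which \<open>convX\<close> is required.\<close>

lemma weighted_levy_real:
  fixes R X :: "nat \<Rightarrow> 'a \<Rightarrow> real" and g :: "real \<Rightarrow> complex"
  assumes M: "prob_space M" and N: "real_distribution N"
    and meas [measurable]: "\<And>n. R n \<in> borel_measurable M" "\<And>n. X n \<in> borel_measurable M"
    and bound: "\<And>n \<omega>. \<bar>R n \<omega>\<bar> \<le> B"
    and conv: "\<And>s. (\<lambda>n. \<integral>\<omega>. of_real (R n \<omega>) * iexp (s * X n \<omega>) \<partial>M) \<longlonglongrightarrow> of_real r * char N s"
    and convX: "\<And>s. (\<lambda>n. \<integral>\<omega>. iexp (s * X n \<omega>) \<partial>M) \<longlonglongrightarrow> char N s"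
    and g: "continuous_on UNIV g" "bounded (range g)"
  shows "(\<lambda>n. \<integral>\<omega>. of_real (R n \<omega>) * g (X n \<omega>) \<partial>M) \<longlonglongrightarrow> of_real r * (\<integral>x. g x \<partial>N)"
proof -
  interpret prob_space M by fact
  have [measurable]: "g \<in> borel_measurable borel" by (rule borel_measurable_continuous_onI) fact
  obtain C where C: "\<And>x. norm (g x) \<le> C" using g(2) by (auto simp: bounded_iff)
  have B: "B \<ge> 0" using bound[of 0 undefined] by linarith
  have int: "integrable M (\<lambda>\<omega>. of_real (R n \<omega>) * h (X n \<omega>))" "integrable M (\<lambda>\<omega>. h (X n \<omega>))"
    if [measurable]: "h \<in> borel_measurable borel" and h: "\<And>x. norm (h x) \<le> C" for h :: "real \<Rightarrow> complex" and C n
  proof -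
    have "norm (of_real (R n \<omega>) * h (X n \<omega>)) \<le> B * C" for \<omega>
      unfolding norm_mult using bound[of n \<omega>] h[of "X n \<omega>"] B by (intro mult_mono) auto
    then show "integrable M (\<lambda>\<omega>. of_real (R n \<omega>) * h (X n \<omega>))"
      by (intro integrable_const_bound[of _ "B * C"]) auto
    show "integrable M (\<lambda>\<omega>. h (X n \<omega>))"
      using h by (intro integrable_const_bound[of _ C]) auto
  qed
  have split: "(\<integral>\<omega>. of_real (R n \<omega> + (B + 1)) * h (X n \<omega>) \<partial>M)
      = (\<integral>\<omega>. of_real (R n \<omega>) * h (X n \<omega>) \<partial>M) + of_real (B + 1) * (\<integral>\<omega>. h (X n \<omega>) \<partial>M)"
    if "h \<in> borel_measurable borel" "\<And>x. norm (h x) \<le> C" for h :: "real \<Rightarrow> complex" and C n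
    using int[OF that, of n] by (simp add: distrib_right)
  have "(\<lambda>n. \<integral>\<omega>. of_real (R n \<omega> + (B + 1)) * g (X n \<omega>) \<partial>M) \<longlonglongrightarrow> of_real (r + (B + 1)) * (\<integral>x. g x \<partial>N)"
  proof (rule weighted_levy_pos[OF M N _ _ zero_less_one _ _ _ g])
    fix s
    have "(\<lambda>n. (\<integral>\<omega>. of_real (R n \<omega>) * iexp (s * X n \<omega>) \<partial>M) + of_real (B + 1) * (\<integral>\<omega>. iexp (s * X n \<omega>) \<partial>M))
      \<longlonglongrightarrow> of_real r * char N s + of_real (B + 1) * char N s"
      by (intro tendsto_intros conv convX)
    then show "(\<lambda>n. \<integral>\<omega>. of_real (R n \<omega> + (B + 1)) * iexp (s * X n \<omega>) \<partial>M) \<longlonglongrightarrow> of_real (r + (B + 1)) * char N s"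
      by (subst split[of "\<lambda>x. iexp (s * x)" 1]) (simp_all add: distrib_right)
  next
    show "1 \<le> R n \<omega> + (B + 1)" for n \<omega> using bound[of n \<omega>] by linarith
    show "R n \<omega> + (B + 1) \<le> 2 * B + 1" for n \<omega> using bound[of n \<omega>] by linarith
  qed measurable
  moreover have "(\<lambda>n. \<integral>\<omega>. of_real 1 * g (X n \<omega>) \<partial>M) \<longlonglongrightarrow> of_real 1 * (\<integral>x. g x \<partial>N)"
    by (rule weighted_levy_pos[OF M N _ _ zero_less_one _ _ _ g, where B = 1]) (use convX in auto)
  ultimately have "(\<lambda>n. (\<integral>\<omega>. of_real (R n \<omega> + (B + 1)) * g (X n \<omega>) \<partial>M) - of_real (B + 1) * (\<integral>\<omega>. g (X n \<omega>) \<partial>M))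
     \<longlonglongrightarrow> of_real (r + (B + 1)) * (\<integral>x. g x \<partial>N) - of_real (B + 1) * (\<integral>x. g x \<partial>N)"
    by (intro tendsto_intros) auto
  then show ?thesis
    by (subst (asm) split[OF _ C]) (simp_all add: distrib_right)
qed

text \<open>The real and the imaginary part of the weight are Re (c Y) for c = 1 and c = -i. Taking
  real parts is not complex linear, so the convergence of the conjugate weights is a separate
  hypothesis.\<close>

lemma weighted_levy:
  fixes Y :: "nat \<Rightarrow> 'a \<Rightarrow> complex" and X :: "nat \<Rightarrow> 'a \<Rightarrow> real" and g :: "real \<Rightarrow> complex"
  assumes M: "prob_space M" and N: "real_distribution N"
    and meas [measurable]: "\<And>n. Y n \<in> borel_measurable M" "\<And>n. X n \<in> borel_measurable M"
    and bound: "\<And>n \<omega>. norm (Y n \<omega>) \<le> B"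
    and conv: "\<And>s. (\<lambda>n. \<integral>\<omega>. Y n \<omega> * iexp (s * X n \<omega>) \<partial>M) \<longlonglongrightarrow> y * char N s"
    and conv': "\<And>s. (\<lambda>n. \<integral>\<omega>. cnj (Y n \<omega>) * iexp (s * X n \<omega>) \<partial>M) \<longlonglongrightarrow> cnj y * char N s"
    and convX: "\<And>s. (\<lambda>n. \<integral>\<omega>. iexp (s * X n \<omega>) \<partial>M) \<longlonglongrightarrow> char N s"
    and g: "continuous_on UNIV g" "bounded (range g)"
  shows "(\<lambda>n. \<integral>\<omega>. Y n \<omega> * g (X n \<omega>) \<partial>M) \<longlonglongrightarrow> y * (\<integral>x. g x \<partial>N)"
proof -
  interpret prob_space M by fact
  have [measurable]: "g \<in> borel_measurable borel" by (rule borel_measurable_continuous_onI) fact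
  obtain C where C: "\<And>x. norm (g x) \<le> C" using g(2) by (auto simp: bounded_iff)
  have cnj [measurable]: "cnj \<in> borel_measurable borel" 
    by (intro borel_measurable_continuous_onI continuous_intros)
  have B: "B \<ge> 0" using norm_ge_zero[of "Y 0 undefined"] bound[of 0 undefined] by linarith
  have int: "integrable M (\<lambda>\<omega>. V \<omega> * h (X n \<omega>))"
    if [measurable]: "V \<in> borel_measurable M" "h \<in> borel_measurable borel" and V: "\<And>\<omega>. norm (V \<omega>) \<le> B" and h: "\<And>x. norm (h x) \<le> K"
    for V and h :: "real \<Rightarrow> complex" and K n
  proof -
    have "norm (V \<omega> * h (X n \<omega>)) \<le> B * K" for \<omega>
      unfolding norm_mult using V[of \<omega>] h[of "X n \<omega>"] B by (intro mult_mono) auto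
    then show ?thesis by (intro integrable_const_bound[of _ "B * K"]) auto
  qed
  have re: "of_real (Re (c * w)) = (c * w + cnj c * cnj w) / 2" for c w
    by (simp add: complex_eq_iff)
  have iexp_int: "integrable M (\<lambda>\<omega>. Y n \<omega> * iexp (s * X n \<omega>))" "integrable M (\<lambda>\<omega>. cnj (Y n \<omega>) * iexp (s * X n \<omega>))" for n s
    using bound by (auto intro!: int[of _ _ 1])
  have part: "(\<lambda>n. \<integral>\<omega>. of_real (Re (c * Y n \<omega>)) * g (X n \<omega>) \<partial>M) \<longlonglongrightarrow> of_real (Re (c * y)) * (\<integral>x. g x \<partial>N)"
    if c: "norm c = 1" for c
  proof (rule weighted_levy_real[OF M N _ _ _ _ convX g])
    show "\<bar>Re (c * Y n \<omega>)\<bar> \<le> B" for n \<omega>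
      using abs_Re_le_cmod[of "c * Y n \<omega>"] bound[of n \<omega>] c by (simp add: norm_mult)
    fix s
    have "(\<lambda>n. (c * (\<integral>\<omega>. Y n \<omega> * iexp (s * X n \<omega>) \<partial>M) + cnj c * (\<integral>\<omega>. cnj (Y n \<omega>) * iexp (s * X n \<omega>) \<partial>M)) / 2)
      \<longlonglongrightarrow> (c * (y * char N s) + cnj c * (cnj y * char N s)) / 2"
      by (intro tendsto_intros conv conv') auto
    moreover have "(\<integral>\<omega>. of_real (Re (c * Y n \<omega>)) * iexp (s * X n \<omega>) \<partial>M)
       = (c * (\<integral>\<omega>. Y n \<omega> * iexp (s * X n \<omega>) \<partial>M) + cnj c * (\<integral>\<omega>. cnj (Y n \<omega>) * iexp (s * X n \<omega>) \<partial>M)) / 2" for n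
    proof -
      have "(\<integral>\<omega>. of_real (Re (c * Y n \<omega>)) * iexp (s * X n \<omega>) \<partial>M)
         = (\<integral>\<omega>. (c * (Y n \<omega> * iexp (s * X n \<omega>)) + cnj c * (cnj (Y n \<omega>) * iexp (s * X n \<omega>))) / 2 \<partial>M)"
        unfolding re by (intro Bochner_Integration.integral_cong refl) (simp add: distrib_right mult.assoc)
      then show ?thesis using iexp_int by simp
    qed
    moreover have "of_real (Re (c * y)) * char N s = (c * (y * char N s) + cnj c * (cnj y * char N s)) / 2"
      unfolding re by (simp add: distrib_right mult.assoc)
    ultimately show "(\<lambda>n. \<integral>\<omega>. of_real (Re (c * Y n \<omega>)) * iexp (s * X n \<omega>) \<partial>M) \<longlonglongrightarrow> of_real (Re (c * y)) * char N s"
      by (simp only:)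
  qed measurable
  have "(\<lambda>n. (\<integral>\<omega>. of_real (Re (Y n \<omega>)) * g (X n \<omega>) \<partial>M) + \<i> * (\<integral>\<omega>. of_real (Im (Y n \<omega>)) * g (X n \<omega>) \<partial>M))
     \<longlonglongrightarrow> of_real (Re y) * (\<integral>x. g x \<partial>N) + \<i> * (of_real (Im y) * (\<integral>x. g x \<partial>N))"
    using part[of 1] part[of "- \<i>"] by (intro tendsto_intros) simp_all
  also have "of_real (Re y) * (\<integral>x. g x \<partial>N) + \<i> * (of_real (Im y) * (\<integral>x. g x \<partial>N)) = y * (\<integral>x. g x \<partial>N)"
    by (subst (3) complex_eq[of y]) (simp add: distrib_right)
  also have "(\<lambda>n. (\<integral>\<omega>. of_real (Re (Y n \<omega>)) * g (X n \<omega>) \<partial>M) + \<i> * (\<integral>\<omega>. of_real (Im (Y n \<omega>)) * g (X n \<omega>) \<partial>M))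
     = (\<lambda>n. \<integral>\<omega>. Y n \<omega> * g (X n \<omega>) \<partial>M)"
  proof
    fix n
    have "integrable M (\<lambda>\<omega>. of_real (Re (Y n \<omega>)) * g (X n \<omega>))" 
      using abs_Re_le_cmod[of "Y n _"] bound[of n] C by (intro int[of _ _ C]) (auto intro: order_trans)
    moreover have "integrable M (\<lambda>\<omega>. of_real (Im (Y n \<omega>)) * g (X n \<omega>))"
      using abs_Im_le_cmod[of "Y n _"] bound[of n] C by (intro int[of _ _ C]) (auto intro: order_trans)
    ultimately have "(\<integral>\<omega>. of_real (Re (Y n \<omega>)) * g (X n \<omega>) \<partial>M) + \<i> * (\<integral>\<omega>. of_real (Im (Y n \<omega>)) * g (X n \<omega>) \<partial>M)
       = (\<integral>\<omega>. of_real (Re (Y n \<omega>)) * g (X n \<omega>) + \<i> * (of_real (Im (Y n \<omega>)) * g (X n \<omega>)) \<partial>M)" by simp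
    also have "\<dots> = (\<integral>\<omega>. Y n \<omega> * g (X n \<omega>) \<partial>M)"
      by (intro Bochner_Integration.integral_cong refl, subst (3) complex_eq) (simp add: distrib_right)
    finally show "(\<integral>\<omega>. of_real (Re (Y n \<omega>)) * g (X n \<omega>) \<partial>M) + \<i> * (\<integral>\<omega>. of_real (Im (Y n \<omega>)) * g (X n \<omega>) \<partial>M)
       = (\<integral>\<omega>. Y n \<omega> * g (X n \<omega>) \<partial>M)" .
  qed
  finally show ?thesis .
qed

section \<open>From characteristic functions to products of test functions\<close>

locale char_convergence = prob_space M for M :: "'a measure" +
  fixes I :: "'i::countable set" and N :: "'i \<Rightarrow> real measure" and X :: "nat \<Rightarrow> 'a \<Rightarrow> 'i \<Rightarrow> real"
  assumes finI: "finite I"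
    and N: "\<And>p. real_distribution (N p)"
    and X_meas [measurable]: "\<And>n p. (\<lambda>\<omega>. X n \<omega> p) \<in> borel_measurable M"
    and char_conv: "\<And>s. (\<lambda>n. expectation (\<lambda>\<omega>. \<Prod>p\<in>I. iexp (s p * X n \<omega> p))) \<longlonglongrightarrow> (\<Prod>p\<in>I. char (N p) (s p))"
begin

definition test_fun :: "(real \<Rightarrow> complex) \<Rightarrow> bool" where
  "test_fun g \<longleftrightarrow> continuous_on UNIV g \<and> bounded (range g)"

lemma test_fun_meas: "test_fun g \<Longrightarrow> g \<in> borel_measurable borel"
  by (auto simp: test_fun_def intro: borel_measurable_continuous_onI)

lemma test_fun_iexp: "test_fun (\<lambda>x. iexp (s * x))"
  unfolding test_fun_def by (auto intro!: continuous_intros simp: bounded_iff intro: exI[of _ 1])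

lemma test_fun_cnj: "test_fun g \<Longrightarrow> test_fun (\<lambda>x. cnj (g x))"
  unfolding test_fun_def by (auto intro!: continuous_intros simp: bounded_iff)

text \<open>Exponentials are traded for arbitrary test functions one coordinate at a time,
  the remaining factors acting as a weight in the one-dimensional continuity theorem.\<close>

lemma prod_test_convergence_aux:
  assumes "A \<subseteq> I" "\<And>p. p \<in> A \<Longrightarrow> test_fun (g p)" "\<And>p. p \<in> I - A \<Longrightarrow> \<exists>s. g p = (\<lambda>x. iexp (s * x))"
  shows "(\<lambda>n. expectation (\<lambda>\<omega>. \<Prod>p\<in>I. g p (X n \<omega> p))) \<longlonglongrightarrow> (\<Prod>p\<in>I. \<integral>x. g p x \<partial>N p)"
  using finite_subset[OF assms(1) finI] assms
proof (induction A arbitrary: g rule: finite_induct)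
  case empty
  then obtain s where s: "\<And>p. p \<in> I \<Longrightarrow> g p = (\<lambda>x. iexp (s p * x))" by (metis Diff_empty)
  then show ?case using char_conv[of s] by (simp add: char_def)
next
  case (insert p0 A)
  have p0: "p0 \<in> I" using insert by auto
  let ?Y = "\<lambda>g n \<omega>. \<Prod>p\<in>I - {p0}. g p (X n \<omega> p)"
  let ?y = "\<lambda>g. \<Prod>p\<in>I - {p0}. \<integral>x. g p x \<partial>N p"
  have test: "test_fun (g p)" if "p \<in> I" for p
    using insert.prems that test_fun_iexp by (cases "p \<in> insert p0 A") force+
  have conv: "(\<lambda>n. expectation (\<lambda>\<omega>. ?Y h n \<omega> * iexp (s * X n \<omega> p0))) \<longlonglongrightarrow> ?y h * char (N p0) s"
    if "\<And>p. p \<in> A \<Longrightarrow> test_fun (h p)" "\<And>p. p \<in> I - insert p0 A \<Longrightarrow> \<exists>s. h p = (\<lambda>x. iexp (s * x))" for h s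
  proof -
    let ?h = "h(p0 := (\<lambda>x. iexp (s * x)))"
    have "(\<lambda>n. expectation (\<lambda>\<omega>. \<Prod>p\<in>I. ?h p (X n \<omega> p))) \<longlonglongrightarrow> (\<Prod>p\<in>I. \<integral>x. ?h p x \<partial>N p)"
      using insert that by (intro insert.IH) auto
    moreover have "(\<Prod>p\<in>I. ?h p (X n \<omega> p)) = ?Y h n \<omega> * iexp (s * X n \<omega> p0)" for n \<omega>
      by (subst prod.remove[OF finI p0]) (auto intro!: prod.cong simp: mult.commute)
    moreover have "(\<Prod>p\<in>I. \<integral>x. ?h p x \<partial>N p) = ?y h * char (N p0) s"
      by (subst prod.remove[OF finI p0]) (auto intro!: prod.cong simp: mult.commute char_def)
    ultimately show ?thesis by simp
  qed
  have "\<forall>p\<in>I. \<exists>K. \<forall>x. norm (g p x) \<le> K" using test by (auto simp: test_fun_def bounded_iff)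
  then obtain K where K: "\<And>p x. p \<in> I \<Longrightarrow> norm (g p x) \<le> K p" by metis
  have "(\<lambda>n. expectation (\<lambda>\<omega>. ?Y g n \<omega> * g p0 (X n \<omega> p0))) \<longlonglongrightarrow> ?y g * (\<integral>x. g p0 x \<partial>N p0)"
  proof (rule weighted_levy[OF prob_space_axioms N])
    show "?Y g n \<in> borel_measurable M" for n
      using test test_fun_meas by (intro borel_measurable_prod measurable_compose[OF X_meas]) auto
    show "norm (?Y g n \<omega>) \<le> (\<Prod>p\<in>I - {p0}. K p)" for n \<omega>
      unfolding prod_norm[symmetric] using K by (intro prod_mono) auto
    show "(\<lambda>n. expectation (\<lambda>\<omega>. ?Y g n \<omega> * iexp (s * X n \<omega> p0))) \<longlonglongrightarrow> ?y g * char (N p0) s" for s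
      using insert.prems by (intro conv) auto
    show "(\<lambda>n. expectation (\<lambda>\<omega>. cnj (?Y g n \<omega>) * iexp (s * X n \<omega> p0))) \<longlonglongrightarrow> cnj (?y g) * char (N p0) s" for s
    proof -
      have "(\<lambda>n. expectation (\<lambda>\<omega>. ?Y (\<lambda>p x. cnj (g p x)) n \<omega> * iexp (s * X n \<omega> p0))) \<longlonglongrightarrow> ?y (\<lambda>p x. cnj (g p x)) * char (N p0) s"
      proof (intro conv)
        show "test_fun (\<lambda>x. cnj (g p x))" if "p \<in> A" for p
          using insert.prems that by (intro test_fun_cnj) auto
        fix p assume "p \<in> I - insert p0 A"
        then obtain s where "g p = (\<lambda>x. iexp (s * x))" using insert.prems by blast
        \<comment> \<open>Conjugation keeps the class of exponentials, with the frequency negated,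
          so the induction hypothesis also covers the conjugate weight.\<close>
        then have "(\<lambda>x. cnj (g p x)) = (\<lambda>x. iexp ((- s) * x))" by (auto simp: exp_cnj fun_eq_iff)
        then show "\<exists>s. (\<lambda>x. cnj (g p x)) = (\<lambda>x. iexp (s * x))" by blast
      qed
      then show ?thesis by (simp add: cnj_prod integral_cnj)
    qed
    show "(\<lambda>n. expectation (\<lambda>\<omega>. iexp (s * X n \<omega> p0))) \<longlonglongrightarrow> char (N p0) s" for s
    proof -
      \<comment> \<open>The constant 1 is the exponential of frequency 0, so convergence of a single
        marginal is a special case.\<close>
      have "(\<lambda>n. expectation (\<lambda>\<omega>. ?Y (\<lambda>p x. 1) n \<omega> * iexp (s * X n \<omega> p0))) \<longlonglongrightarrow> ?y (\<lambda>p x. 1) * char (N p0) s"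
      proof (intro conv)
        show "test_fun (\<lambda>x. 1)" by (auto simp: test_fun_def bounded_iff intro: exI[of _ 1])
        show "\<exists>s. (\<lambda>x. 1 :: complex) = (\<lambda>x. iexp (s * x))" by (rule exI[of _ 0]) simp
      qed
      then show ?thesis using N by (simp add: real_distribution_def prob_space.prob_space)
    qed
    show "continuous_on UNIV (g p0)" "bounded (range (g p0))"
      using test[OF p0] by (auto simp: test_fun_def)
  qed measurable
  moreover have "(\<Prod>p\<in>I. g p (X n \<omega> p)) = ?Y g n \<omega> * g p0 (X n \<omega> p0)" for n \<omega>
    by (subst prod.remove[OF finI p0]) (simp add: mult.commute)
  moreover have "(\<Prod>p\<in>I. \<integral>x. g p x \<partial>N p) = ?y g * (\<integral>x. g p0 x \<partial>N p0)"
    by (subst prod.remove[OF finI p0]) (simp add: mult.commute)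
  ultimately show ?case by simp
qed

lemma prod_test_convergence:
  fixes g :: "'i \<Rightarrow> real \<Rightarrow> real"
  assumes g: "\<And>p. p \<in> I \<Longrightarrow> continuous_on UNIV (g p)" "\<And>p. p \<in> I \<Longrightarrow> bounded (range (g p))"
  shows "(\<lambda>n. expectation (\<lambda>\<omega>. \<Prod>p\<in>I. g p (X n \<omega> p))) \<longlonglongrightarrow> (\<Prod>p\<in>I. \<integral>x. g p x \<partial>N p)"
proof -
  have "(\<lambda>n. expectation (\<lambda>\<omega>. \<Prod>p\<in>I. complex_of_real (g p (X n \<omega> p)))) \<longlonglongrightarrow> (\<Prod>p\<in>I. \<integral>x. complex_of_real (g p x) \<partial>N p)"
    by (rule prod_test_convergence_aux[of I]) (use g in \<open>auto simp: test_fun_def bounded_iff intro!: continuous_intros\<close>)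
  then have "(\<lambda>n. complex_of_real (expectation (\<lambda>\<omega>. \<Prod>p\<in>I. g p (X n \<omega> p)))) \<longlonglongrightarrow> complex_of_real (\<Prod>p\<in>I. \<integral>x. g p x \<partial>N p)"
    by (simp add: of_real_prod[symmetric] del: of_real_prod)
  then show ?thesis by (simp only: tendsto_of_real_iff)
qed

end

section \<open>Clipping and polynomial approximation\<close>

definition clip :: "real \<Rightarrow> real \<Rightarrow> real" where
  "clip B x = max (-B) (min B x)"

text \<open>Coordinates outside I are set to 0, so that the image lies in a compact set even if the
  index type is infinite.\<close>

definition clip_on :: "'i set \<Rightarrow> real \<Rightarrow> ('i \<Rightarrow> real) \<Rightarrow> 'i \<Rightarrow> real" where
  "clip_on I B v p = (if p \<in> I then clip B (v p) else 0)"

text \<open>A continuous majorant of the indicator of |x| \<ge> B, vanishing for |x| \<le> B - 1.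
  Continuity makes tails accessible to the convergence of test functions.\<close>

definition tail_fun :: "real \<Rightarrow> real \<Rightarrow> real" where
  "tail_fun B x = min 1 (max 0 (\<bar>x\<bar> - B + 1))"

lemma tail_fun_bounds: "0 \<le> tail_fun B x" "tail_fun B x \<le> 1"
  by (auto simp: tail_fun_def)

lemma continuous_tail_fun: "continuous_on UNIV (tail_fun B)"
  unfolding tail_fun_def[abs_def] by (intro continuous_intros)

lemma continuous_clip: "continuous_on UNIV (clip B)"
  unfolding clip_def[abs_def] by (intro continuous_intros)

lemma continuous_clip_on: "continuous_on UNIV (clip_on I B :: ('i \<Rightarrow> real) \<Rightarrow> 'i \<Rightarrow> real)"
proof (rule continuous_on_coordinatewise_then_product)
  fix p
  have "continuous_on UNIV (\<lambda>v :: 'i \<Rightarrow> real. clip B (v p))"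
    by (rule continuous_on_compose2[OF continuous_clip]) auto
  then show "continuous_on UNIV (\<lambda>v :: 'i \<Rightarrow> real. clip_on I B v p)"
    unfolding clip_on_def by (cases "p \<in> I") auto
qed

lemma tail_expectation_tendsto:
  assumes "real_distribution N"
  shows "(\<lambda>B. \<integral>x. tail_fun (real B) x \<partial>N) \<longlonglongrightarrow> 0"
proof -
  interpret real_distribution N by fact
  have "(\<lambda>B. \<integral>x. tail_fun (real B) x \<partial>N) \<longlonglongrightarrow> (\<integral>x. 0 \<partial>N)"
  proof (rule integral_dominated_convergence[where w = "\<lambda>_. 1"])
    show "AE x in N. (\<lambda>B. tail_fun (real B) x) \<longlonglongrightarrow> 0"
    proof (intro AE_I2 tendsto_eventually)
      fix x :: real
      show "eventually (\<lambda>B. tail_fun (real B) x = 0) sequentially"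
        using eventually_ge_at_top[of "nat \<lceil>\<bar>x\<bar>\<rceil> + 1"]
        by eventually_elim (auto simp: tail_fun_def, linarith)
    qed
    show "AE x in N. norm (tail_fun (real B) x) \<le> 1" for B
      using tail_fun_bounds by auto
    show "tail_fun (real B) \<in> borel_measurable N" for B
      using borel_measurable_continuous_onI[OF continuous_tail_fun] by simp
  qed auto
  then show ?thesis by simp
qed

text \<open>Almost surely, clipping changes the argument only if some coordinate in I exceeds B. In
  that case the two values of f differ by at most 2 C, while the sum of the tail functions is at
  least 1.\<close>

lemma (in prob_space) clip_error:
  fixes f :: "('i::countable \<Rightarrow> real) \<Rightarrow> real" and V :: "'a \<Rightarrow> 'i \<Rightarrow> real"
  assumes finI: "finite I" and f: "continuous_on UNIV f" "\<And>v. \<bar>f v\<bar> \<le> C"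
    and V [measurable]: "\<And>p. (\<lambda>\<omega>. V \<omega> p) \<in> borel_measurable M"
    and zero: "AE \<omega> in M. \<forall>p. p \<notin> I \<longrightarrow> V \<omega> p = 0"
  shows "\<bar>expectation (\<lambda>\<omega>. f (V \<omega>)) - expectation (\<lambda>\<omega>. f (clip_on I B (V \<omega>)))\<bar>
    \<le> 2 * C * (\<Sum>p\<in>I. expectation (\<lambda>\<omega>. tail_fun B (V \<omega> p)))"
proof -
  have [measurable]: "f \<in> borel_measurable borel" "clip_on I B \<in> borel_measurable borel" "tail_fun B \<in> borel_measurable borel"
    using f(1) continuous_clip_on continuous_tail_fun by (auto intro: borel_measurable_continuous_onI)
  have [measurable]: "V \<in> borel_measurable M" by (rule measurable_coordinatewise_then_product) (rule V)
  have C: "C \<ge> 0" using f(2)[of undefined] by linarith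
  have i1: "integrable M (\<lambda>\<omega>. f (V \<omega>))" "integrable M (\<lambda>\<omega>. f (clip_on I B (V \<omega>)))"
    using f(2) by (auto intro!: integrable_const_bound[of _ C])
  have i2: "integrable M (\<lambda>\<omega>. tail_fun B (V \<omega> p))" for p
    using tail_fun_bounds by (auto intro!: integrable_const_bound[of _ 1])
  have "\<bar>expectation (\<lambda>\<omega>. f (V \<omega>)) - expectation (\<lambda>\<omega>. f (clip_on I B (V \<omega>)))\<bar>
     = \<bar>expectation (\<lambda>\<omega>. f (V \<omega>) - f (clip_on I B (V \<omega>)))\<bar>"
    using i1 by simp
  also have "\<dots> \<le> expectation (\<lambda>\<omega>. \<bar>f (V \<omega>) - f (clip_on I B (V \<omega>))\<bar>)"
    by (rule integral_abs_bound)
  also have "\<dots> \<le> expectation (\<lambda>\<omega>. 2 * C * (\<Sum>p\<in>I. tail_fun B (V \<omega> p)))"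
  proof (rule integral_mono_AE)
    show "integrable M (\<lambda>\<omega>. \<bar>f (V \<omega>) - f (clip_on I B (V \<omega>))\<bar>)" using i1 by simp
    show "integrable M (\<lambda>\<omega>. 2 * C * (\<Sum>p\<in>I. tail_fun B (V \<omega> p)))" using i2 by simp
    show "AE \<omega> in M. \<bar>f (V \<omega>) - f (clip_on I B (V \<omega>))\<bar> \<le> 2 * C * (\<Sum>p\<in>I. tail_fun B (V \<omega> p))"
      using zero
    proof eventually_elim
      case (elim \<omega>)
      show ?case
      proof (cases "\<forall>p\<in>I. \<bar>V \<omega> p\<bar> \<le> B")
        case True
        then have "clip_on I B (V \<omega>) = V \<omega>"
          using elim by (fastforce simp: clip_on_def clip_def fun_eq_iff)
        then show ?thesis using C by (auto intro!: mult_nonneg_nonneg sum_nonneg tail_fun_bounds)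
      next
        case False
        then obtain p where p: "p \<in> I" "\<bar>V \<omega> p\<bar> > B" by force
        have "1 = tail_fun B (V \<omega> p)" using p by (simp add: tail_fun_def)
        also have "\<dots> \<le> (\<Sum>p\<in>I. tail_fun B (V \<omega> p))"
          using p finI by (intro member_le_sum) (auto simp: tail_fun_bounds)
        finally have 1: "2 * C * 1 \<le> 2 * C * (\<Sum>p\<in>I. tail_fun B (V \<omega> p))"
          using C by (intro mult_left_mono) auto
        have "\<bar>f (V \<omega>) - f (clip_on I B (V \<omega>))\<bar> \<le> 2 * C"
          using f(2)[of "V \<omega>"] f(2)[of "clip_on I B (V \<omega>)"] by linarith
        then show ?thesis using 1 by linarith
      qed
    qed
  qed
  also have "\<dots> = 2 * C * (\<Sum>p\<in>I. expectation (\<lambda>\<omega>. tail_fun B (V \<omega> p)))"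
    using i2 by (simp add: Bochner_Integration.integral_sum)
  finally show ?thesis .
qed

text \<open>Stone-Weierstrass on the product of the intervals for p in I and of the singleton 0
  elsewhere, compact by Tychonoff's theorem. Two different points of this set differ at a coordinate
  in I, so polynomials in these coordinates separate points.\<close>

lemma polyfun_approximation:
  fixes f :: "('i::countable \<Rightarrow> real) \<Rightarrow> real"
  assumes f: "continuous_on UNIV f" and B: "B \<ge> 0" and e: "e > 0"
  shows "\<exists>\<Phi>. polyfun I \<Phi> \<and> (\<forall>v. \<bar>f (clip_on I B v) - \<Phi> (clip_on I B v)\<bar> < e)"
proof -
  define K where "K = (PiE UNIV (\<lambda>p. if p \<in> I then {-B..B} else {0}) :: ('i \<Rightarrow> real) set)"
  have "compactin (product_topology (\<lambda>_. euclidean) UNIV) K"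
    unfolding K_def compactin_PiE by auto
  then have K: "compact K" by (simp add: euclidean_product_topology)
  have clipK: "clip_on I B v \<in> K" for v
    using B by (auto simp: K_def PiE_iff clip_on_def clip_def)
  have "function_ring_on {\<Phi>. polyfun I \<Phi>} K"
  proof
    show "compact K" by (rule K)
    show "continuous_on K \<Phi>" if "\<Phi> \<in> {\<Phi>. polyfun I \<Phi>}" for \<Phi>
    proof -
      from that have "polyfun I \<Phi>" by simp
      then show ?thesis
        by (induction rule: polyfun.induct)
           (auto intro!: continuous_intros continuous_on_subset[OF continuous_on_product_coordinates])
    qed
    fix v w assume vw: "v \<in> K" "w \<in> K" "v \<noteq> w"
    then obtain p where "v p \<noteq> w p" by auto
    moreover from this have "p \<in> I"
    proof (rule contrapos_np)
      assume "p \<notin> I"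
      moreover have "v p \<in> (if p \<in> I then {-B..B} else {0})" "w p \<in> (if p \<in> I then {-B..B} else {0})"
        using vw(1,2) unfolding K_def PiE_iff by blast+
      ultimately show "v p = w p" by simp
    qed
    ultimately show "\<exists>\<Phi>\<in>{\<Phi>. polyfun I \<Phi>}. \<Phi> v \<noteq> \<Phi> w"
      by (auto intro!: polyfun_var)
  qed (auto intro: polyfun_add polyfun_mult polyfun_const)
  from function_ring_on.Stone_Weierstrass_basic[OF this continuous_on_subset[OF f] e]
  show ?thesis using clipK by auto
qed

section \<open>Expectations under the product limit law\<close>

context char_convergence
begin

abbreviation "\<mu> \<equiv> PiM UNIV N"

lemma N_prob: "prob_space (N p)" and N_sets [measurable_cong]: "sets (N p) = sets borel"
  using N[of p] by (simp_all add: real_distribution_def real_distribution_axioms_def)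

lemma prob_space_\<mu>: "prob_space \<mu>"
  by (intro prob_space_PiM N_prob)

text \<open>The countability of the index type enters here: it makes the product sigma-algebra the
  Borel sigma-algebra of the product topology, so that continuous functions are measurable for
  \<mu>.\<close>

lemma sets_\<mu> [measurable_cong]: "sets \<mu> = sets borel"
proof -
  have "sets \<mu> = sets (PiM UNIV (\<lambda>_ :: 'i. borel :: real measure))"
    by (rule sets_PiM_cong) (simp_all add: N_sets)
  then show ?thesis using sets_PiM_equal_borel by simp
qed

lemma coord_meas [measurable]: "(\<lambda>v. v p) \<in> borel_measurable \<mu>"
  using measurable_component_singleton[of p UNIV N] measurable_cong_sets[OF refl N_sets] by blast

lemma distr_coord: "distr \<mu> borel (\<lambda>v. v p) = N p"
proof -
  have "distr \<mu> borel (\<lambda>v. v p) = distr \<mu> (N p) (\<lambda>v. v p)"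
    by (rule distr_cong) (simp_all add: N_sets)
  then show ?thesis using distr_PiM_component[of UNIV N p, OF N_prob] by simp
qed

text \<open>Independence is read off the joint law of the coordinates in J, a projection of the
  product measure. The criterion asks for a nonempty family, which explains the case
  distinction.\<close>

lemma indep_coord: "prob_space.indep_vars \<mu> (\<lambda>_. borel) (\<lambda>p v. v p) J"
proof (cases "J = {}")
  case True
  interpret P: prob_space \<mu> by (rule prob_space_\<mu>)
  show ?thesis unfolding True P.indep_vars_def P.indep_sets_def by auto
next
  case False
  interpret P: prob_space \<mu> by (rule prob_space_\<mu>)
  have "distr \<mu> (PiM J N) (\<lambda>v. \<lambda>p\<in>J. v p) = PiM J N"
    using distr_PiM_reindex[of UNIV N "\<lambda>p. p" J] N_prob by auto
  moreover have "distr \<mu> (PiM J (\<lambda>_. borel)) (\<lambda>v. \<lambda>p\<in>J. v p) = distr \<mu> (PiM J N) (\<lambda>v. \<lambda>p\<in>J. v p)"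
    by (rule distr_cong) (auto intro!: sets_PiM_cong simp: N_sets)
  ultimately show ?thesis
    by (subst P.indep_vars_iff_distr_eq_PiM[OF False]) (auto simp: distr_coord)
qed

lemma coord_integral:
  fixes h :: "real \<Rightarrow> real"
  assumes "h \<in> borel_measurable borel"
  shows "(\<integral>v. h (v p) \<partial>\<mu>) = (\<integral>x. h x \<partial>N p)"
  using integral_distr[OF coord_meas assms, of p] by (simp add: distr_coord)

lemma prod_integral_\<mu>:
  fixes g :: "'i \<Rightarrow> real \<Rightarrow> real"
  assumes g: "\<And>p. p \<in> I \<Longrightarrow> continuous_on UNIV (g p)" "\<And>p. p \<in> I \<Longrightarrow> bounded (range (g p))"
  shows "(\<integral>v. (\<Prod>p\<in>I. g p (v p)) \<partial>\<mu>) = (\<Prod>p\<in>I. \<integral>x. g p x \<partial>N p)"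
proof -
  interpret P: prob_space \<mu> by (rule prob_space_\<mu>)
  have meas: "g p \<in> borel_measurable borel" if "p \<in> I" for p
    using g(1)[OF that] by (rule borel_measurable_continuous_onI)
  have "P.indep_vars (\<lambda>_. borel) (\<lambda>p v. g p (v p)) I"
    by (rule P.indep_vars_compose2[OF indep_coord]) (use meas in auto)
  then have "(\<integral>v. (\<Prod>p\<in>I. g p (v p)) \<partial>\<mu>) = (\<Prod>p\<in>I. \<integral>v. g p (v p) \<partial>\<mu>)"
  proof (rule P.indep_vars_lebesgue_integral[OF finI])
    fix p assume p: "p \<in> I"
    obtain K where "\<And>x. norm (g p x) \<le> K" using g(2)[OF p] by (auto simp: bounded_iff)
    then show "integrable \<mu> (\<lambda>v. g p (v p))"
      using measurable_compose[OF coord_meas meas[OF p]] by (intro P.integrable_const_bound[of _ K]) auto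
  qed
  then show ?thesis using meas by (simp add: coord_integral)
qed

lemma clipped_monomial:
  fixes c :: "'i \<Rightarrow> nat"
  defines "g \<equiv> \<lambda>B p x. clip B x ^ c p"
  shows "continuous_on UNIV (g B p)" "bounded (range (g B p))"
proof -
  show "continuous_on UNIV (g B p)"
    unfolding g_def using continuous_clip by (intro continuous_intros)
  have "\<bar>clip B x\<bar> \<le> \<bar>B\<bar>" for x by (auto simp: clip_def)
  then have "norm (g B p x) \<le> \<bar>B\<bar> ^ c p" for x
    unfolding g_def by (simp add: power_abs power_mono)
  then show "bounded (range (g B p))" by (auto simp: bounded_iff)
qed

text \<open>The same induction as for integration by parts, with the clipped monomial in front
  absorbing variables. Integrability is carried along because the case of a sum needs it.\<close>

lemma polyfun_clip_convergence:
  assumes "polyfun I \<Phi>"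
  shows "(\<lambda>n. expectation (\<lambda>\<omega>. (\<Prod>p\<in>I. clip B (X n \<omega> p) ^ c p) * \<Phi> (clip_on I B (X n \<omega>))))
     \<longlonglongrightarrow> (\<integral>v. (\<Prod>p\<in>I. clip B (v p) ^ c p) * \<Phi> (clip_on I B v) \<partial>\<mu>)
   \<and> (\<forall>n. integrable M (\<lambda>\<omega>. (\<Prod>p\<in>I. clip B (X n \<omega> p) ^ c p) * \<Phi> (clip_on I B (X n \<omega>))))
   \<and> integrable \<mu> (\<lambda>v. (\<Prod>p\<in>I. clip B (v p) ^ c p) * \<Phi> (clip_on I B v))"
  using assms
proof (induction arbitrary: c rule: polyfun.induct)
  case (polyfun_const a)
  interpret P: prob_space \<mu> by (rule prob_space_\<mu>)
  have [measurable]: "clip B \<in> borel_measurable borel"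
    using continuous_clip by (rule borel_measurable_continuous_onI)
  have bnd: "norm (\<Prod>p\<in>I. clip B (v p) ^ c p) \<le> (\<Prod>p\<in>I. \<bar>B\<bar> ^ c p)" for v :: "'i \<Rightarrow> real"
  proof -
    have "\<bar>clip B x\<bar> \<le> \<bar>B\<bar>" for x by (auto simp: clip_def)
    then show ?thesis
      unfolding prod_norm[symmetric] by (intro prod_mono) (auto simp: power_abs intro: power_mono)
  qed
  have "integrable M (\<lambda>\<omega>. \<Prod>p\<in>I. clip B (X n \<omega> p) ^ c p)" for n
    by (rule integrable_const_bound[OF AE_I2[OF bnd]]) measurable
  moreover have "integrable \<mu> (\<lambda>v. \<Prod>p\<in>I. clip B (v p) ^ c p)"
    by (rule P.integrable_const_bound[OF AE_I2[OF bnd]]) measurable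
  moreover have "(\<lambda>n. expectation (\<lambda>\<omega>. \<Prod>p\<in>I. clip B (X n \<omega> p) ^ c p)) \<longlonglongrightarrow> (\<integral>v. (\<Prod>p\<in>I. clip B (v p) ^ c p) \<partial>\<mu>)"
    using prod_test_convergence[of "\<lambda>p x. clip B x ^ c p"] prod_integral_\<mu>[of "\<lambda>p x. clip B x ^ c p"] clipped_monomial
    by simp
  ultimately show ?case by (auto intro: tendsto_mult_right)
next
  case (polyfun_add \<Phi> \<Psi>)
  show ?case using polyfun_add.IH(1)[of c] polyfun_add.IH(2)[of c]
    by (auto simp: distrib_left intro!: tendsto_add)
next
  case (polyfun_var_mult y \<Phi>)
  have "(\<Prod>p\<in>I. clip B (v p) ^ c p) * (clip_on I B v y * \<Phi> (clip_on I B v))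
     = (\<Prod>p\<in>I. clip B (v p) ^ (c(y := Suc (c y))) p) * \<Phi> (clip_on I B v)" for v
  proof -
    have "(\<Prod>z\<in>I. clip B (v z) ^ (c(y := Suc (c y))) z) = (\<Prod>z\<in>I. clip B (v z) ^ c z * (if z = y then clip B (v z) else 1))"
      by (intro prod.cong) auto
    also have "\<dots> = (\<Prod>z\<in>I. clip B (v z) ^ c z) * clip B (v y)"
      using polyfun_var_mult(1) finI by (simp add: prod.distrib prod.delta)
    finally show ?thesis using polyfun_var_mult(1) by (simp add: clip_on_def)
  qed
  then show ?case using polyfun_var_mult.IH[of "c(y := Suc (c y))"] by (simp only: simp_thms)
qed

text \<open>Both sides are compared with a polynomial of the clipped coordinates, whose expectations
  converge. The tails of \<open>X n\<close> are controlled for large n by those of the limit law,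
  since \<open>tail_fun\<close> is itself a test function.\<close>

theorem expectation_convergence:
  fixes f :: "('i \<Rightarrow> real) \<Rightarrow> real"
  assumes f: "continuous_on UNIV f" "bounded (range f)"
    and X_zero: "\<And>n \<omega> p. p \<notin> I \<Longrightarrow> X n \<omega> p = 0"
    and \<mu>_zero: "AE v in \<mu>. \<forall>p. p \<notin> I \<longrightarrow> v p = 0"
  shows "(\<lambda>n. expectation (\<lambda>\<omega>. f (X n \<omega>))) \<longlonglongrightarrow> (\<integral>v. f v \<partial>\<mu>)"
proof -
  interpret P: prob_space \<mu> by (rule prob_space_\<mu>)
  obtain C0 where C0: "\<And>v. \<bar>f v\<bar> \<le> C0" using f(2) by (auto simp: bounded_iff)
  define C where "C = max C0 1"
  have C: "\<And>v. \<bar>f v\<bar> \<le> C" "C > 0" using C0 by (auto simp: C_def max.coboundedI1)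
  show ?thesis
  proof (rule LIMSEQ_I)
    fix r :: real assume r: "r > 0"
    \<comment> \<open>Five differences of at most e are added at the end: two from clipping, two
      from the approximation and one from the convergence for \<Phi>.\<close>
    define e where "e = r / 8"
    have e: "e > 0" using r by (simp add: e_def)
    have "(\<lambda>B. \<Sum>p\<in>I. \<integral>x. tail_fun (real B) x \<partial>N p) \<longlonglongrightarrow> (\<Sum>p\<in>I. 0)"
      by (intro tendsto_sum tail_expectation_tendsto N)
    then have "(\<lambda>B. \<Sum>p\<in>I. \<integral>x. tail_fun (real B) x \<partial>N p) \<longlonglongrightarrow> 0" by simp
    from order_tendstoD(2)[OF this, of "e / (2 * C)"] e C(2)
    \<comment> \<open>The level is chosen for the limit law alone; the convergence \<open>t\<close>
      transfers the bound to \<open>X n\<close> afterwards.\<close>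
    obtain B :: nat where B: "(\<Sum>p\<in>I. \<integral>x. tail_fun (real B) x \<partial>N p) < e / (2 * C)"
      by (auto simp: eventually_sequentially)
    let ?t = "\<lambda>n. \<Sum>p\<in>I. expectation (\<lambda>\<omega>. tail_fun B (X n \<omega> p))"
    have t: "?t \<longlonglongrightarrow> (\<Sum>p\<in>I. \<integral>x. tail_fun B x \<partial>N p)"
    proof (rule tendsto_sum)
      fix p assume p: "p \<in> I"
      let ?g = "\<lambda>q. if q = p then tail_fun B else (\<lambda>_. 1)"
      have bt: "bounded (range (tail_fun B))"
        using tail_fun_bounds by (auto simp: bounded_iff intro!: exI[of _ 1])
      have "(\<lambda>n. expectation (\<lambda>\<omega>. \<Prod>q\<in>I. ?g q (X n \<omega> q))) \<longlonglongrightarrow> (\<Prod>q\<in>I. \<integral>x. ?g q x \<partial>N q)"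
        by (rule prod_test_convergence) (use bt continuous_tail_fun in auto)
      moreover have "(\<Prod>q\<in>I. ?g q (X n \<omega> q)) = tail_fun B (X n \<omega> p)" for n \<omega>
        by (subst prod.remove[OF finI p]) (simp add: prod.neutral)
      moreover have "(\<Prod>q\<in>I. \<integral>x. ?g q x \<partial>N q) = (\<integral>x. tail_fun B x \<partial>N p)"
        using N_prob by (subst prod.remove[OF finI p]) (simp add: prod.neutral prob_space.prob_space)
      ultimately show "(\<lambda>n. expectation (\<lambda>\<omega>. tail_fun B (X n \<omega> p))) \<longlonglongrightarrow> (\<integral>x. tail_fun B x \<partial>N p)" by simp
    qed
    obtain \<Phi> where \<Phi>: "polyfun I \<Phi>" "\<And>v. \<bar>f (clip_on I B v) - \<Phi> (clip_on I B v)\<bar> < e"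
      using polyfun_approximation[OF f(1) _ e, of "real B" I] by auto
    have \<Phi>conv: "(\<lambda>n. expectation (\<lambda>\<omega>. \<Phi> (clip_on I B (X n \<omega>)))) \<longlonglongrightarrow> (\<integral>v. \<Phi> (clip_on I B v) \<partial>\<mu>)"
      and \<Phi>int: "\<And>n. integrable M (\<lambda>\<omega>. \<Phi> (clip_on I B (X n \<omega>)))" "integrable \<mu> (\<lambda>v. \<Phi> (clip_on I B v))"
      using polyfun_clip_convergence[OF \<Phi>(1), of "real B" "\<lambda>_. 0"] by auto
    have [measurable]: "f \<in> borel_measurable borel" "clip_on I B \<in> borel_measurable borel"
      using f(1) continuous_clip_on by (auto intro: borel_measurable_continuous_onI)
    have [measurable]: "X n \<in> borel_measurable M" for n
      by (rule measurable_coordinatewise_then_product) (rule X_meas)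
    have fint: "integrable M (\<lambda>\<omega>. f (clip_on I B (X n \<omega>)))" for n
      using C(1) by (auto intro!: integrable_const_bound[of _ C])
    have fint': "integrable \<mu> (\<lambda>v. f (clip_on I B v))"
      using C(1) by (auto intro!: P.integrable_const_bound[of _ C])
    have close: "\<bar>expectation (\<lambda>\<omega>. f (clip_on I B (X n \<omega>))) - expectation (\<lambda>\<omega>. \<Phi> (clip_on I B (X n \<omega>)))\<bar> \<le> e" for n
    proof -
      have "\<bar>expectation (\<lambda>\<omega>. f (clip_on I B (X n \<omega>)) - \<Phi> (clip_on I B (X n \<omega>)))\<bar>
         \<le> expectation (\<lambda>\<omega>. \<bar>f (clip_on I B (X n \<omega>)) - \<Phi> (clip_on I B (X n \<omega>))\<bar>)"
        by (rule integral_abs_bound)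
      also have "\<dots> \<le> expectation (\<lambda>_. e)"
        using fint \<Phi>int \<Phi>(2) by (intro integral_mono) (auto intro: less_imp_le)
      finally show ?thesis using fint \<Phi>int by (simp add: prob_space)
    qed
    have close': "\<bar>(\<integral>v. f (clip_on I B v) \<partial>\<mu>) - (\<integral>v. \<Phi> (clip_on I B v) \<partial>\<mu>)\<bar> \<le> e"
    proof -
      have "\<bar>\<integral>v. f (clip_on I B v) - \<Phi> (clip_on I B v) \<partial>\<mu>\<bar> \<le> (\<integral>v. \<bar>f (clip_on I B v) - \<Phi> (clip_on I B v)\<bar> \<partial>\<mu>)"
        by (rule integral_abs_bound)
      also have "\<dots> \<le> (\<integral>v. e \<partial>\<mu>)"
        using fint' \<Phi>int \<Phi>(2) by (intro integral_mono) (auto intro: less_imp_le)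
      finally show ?thesis using fint' \<Phi>int by (simp add: P.prob_space)
    qed
    have clipM: "\<bar>expectation (\<lambda>\<omega>. f (X n \<omega>)) - expectation (\<lambda>\<omega>. f (clip_on I B (X n \<omega>)))\<bar> \<le> 2 * C * ?t n" for n
      by (rule clip_error[OF finI f(1) C(1)]) (use X_zero in auto)
    have clip\<mu>: "\<bar>(\<integral>v. f v \<partial>\<mu>) - (\<integral>v. f (clip_on I B v) \<partial>\<mu>)\<bar> \<le> 2 * C * (\<Sum>p\<in>I. \<integral>x. tail_fun B x \<partial>N p)"
    proof -
      have "\<bar>(\<integral>v. f v \<partial>\<mu>) - (\<integral>v. f (clip_on I B v) \<partial>\<mu>)\<bar> \<le> 2 * C * (\<Sum>p\<in>I. \<integral>v. tail_fun B (v p) \<partial>\<mu>)"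
        by (rule P.clip_error[OF finI f(1) C(1) _ \<mu>_zero]) measurable
      then show ?thesis
        using borel_measurable_continuous_onI[OF continuous_tail_fun] by (simp add: coord_integral)
    qed
    have tail: "2 * C * (\<Sum>p\<in>I. \<integral>x. tail_fun B x \<partial>N p) < e" using B C(2) by (simp add: field_simps)
    have "eventually (\<lambda>n. ?t n < e / (2 * C)) sequentially"
      by (rule order_tendstoD(2)[OF t B])
    moreover have "eventually (\<lambda>n. dist (expectation (\<lambda>\<omega>. \<Phi> (clip_on I B (X n \<omega>)))) (\<integral>v. \<Phi> (clip_on I B v) \<partial>\<mu>) < e) sequentially"
      using \<Phi>conv e by (rule tendstoD)
    ultimately have "eventually (\<lambda>n. norm (expectation (\<lambda>\<omega>. f (X n \<omega>)) - (\<integral>v. f v \<partial>\<mu>)) < r) sequentially"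
    proof eventually_elim
      case (elim n)
      have "2 * C * ?t n < e" using elim(1) C(2) by (simp add: field_simps)
      then show ?case
        using tail elim(2) clipM[of n] clip\<mu> close[of n] close' r unfolding dist_real_def real_norm_def e_def
        by linarith
    qed
    then show "\<exists>no. \<forall>n\<ge>no. norm (expectation (\<lambda>\<omega>. f (X n \<omega>)) - (\<integral>v. f v \<partial>\<mu>)) < r"
      by (simp add: eventually_sequentially)
  qed
qed

end

section \<open>Blocks of independent Gaussian variables\<close>

text \<open>Serves to extract from the whole family of parameters the pair of W and F and the pair
  of W and the transposed C.\<close>

lemma (in prob_space) indep_vars_reindex:
  assumes ind: "indep_vars M' X I" and inj: "inj_on f J" and sub: "f ` J \<subseteq> I"
  shows "indep_vars (\<lambda>j. M' (f j)) (\<lambda>j. X (f j)) J"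
  unfolding indep_vars_def2 indep_sets_def
proof (intro conjI ballI allI impI)
  have I: "\<And>i. i \<in> I \<Longrightarrow> X i \<in> measurable M (M' i)"
    and sets: "\<And>i. i \<in> I \<Longrightarrow> {X i -` A \<inter> space M |A. A \<in> sets (M' i)} \<subseteq> events"
    and prod: "\<And>K A. K \<subseteq> I \<Longrightarrow> K \<noteq> {} \<Longrightarrow> finite K \<Longrightarrow> A \<in> Pi K (\<lambda>i. {X i -` A \<inter> space M |A. A \<in> sets (M' i)})
        \<Longrightarrow> prob (\<Inter>j\<in>K. A j) = (\<Prod>j\<in>K. prob (A j))"
    using ind unfolding indep_vars_def2 indep_sets_def by blast+
  show "random_variable (M' (f j)) (X (f j))" if "j \<in> J" for j using that sub I by auto
  show "{X (f j) -` A \<inter> space M |A. A \<in> sets (M' (f j))} \<subseteq> events" if "j \<in> J" for j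
    using that sub sets by blast
  fix K A assume K: "K \<subseteq> J" "K \<noteq> {}" "finite K" and A: "A \<in> Pi K (\<lambda>i. {X (f i) -` A \<inter> space M |A. A \<in> sets (M' (f i))})"
  have injK: "inj_on f K" using inj K(1) by (rule inj_on_subset)
  define A' where "A' i = A (the_inv_into K f i)" for i
  have A': "A' (f j) = A j" if "j \<in> K" for j
    using that injK by (simp add: A'_def the_inv_into_f_f)
  have "prob (\<Inter>i\<in>f ` K. A' i) = (\<Prod>i\<in>f ` K. prob (A' i))"
  proof (rule prod)
    show "f ` K \<subseteq> I" using K sub by auto
    show "A' \<in> Pi (f ` K) (\<lambda>i. {X i -` A \<inter> space M |A. A \<in> sets (M' i)})"
    proof (rule Pi_I)
      fix i assume "i \<in> f ` K"
      then obtain j where j: "j \<in> K" "i = f j" by blast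
      show "A' i \<in> {X i -` A \<inter> space M |A. A \<in> sets (M' i)}"
        using Pi_mem[OF A j(1)] A'[OF j(1)] j(2) by simp
    qed
  qed (use K in auto)
  then show "prob (\<Inter> (A ` K)) = (\<Prod>j\<in>K. prob (A j))"
    using A' by (simp add: prod.reindex[OF injK])
qed

lemma (in prob_space) normal_char:
  assumes X: "distributed M lborel X (normal_density 0 \<sigma>)" and s: "\<sigma> > 0"
  shows "expectation (\<lambda>\<omega>. iexp (t * X \<omega>)) = of_real (exp (- (\<sigma> * t)\<^sup>2 / 2))"
proof -
  define Y where "Y \<omega> = (X \<omega> - 0) / \<sigma>" for \<omega>
  have std: "distributed M lborel Y std_normal_density"
    using X normal_standard_normal_convert[OF s, of X 0] unfolding Y_def[abs_def] by simp
  have [measurable]: "Y \<in> borel_measurable M" using distributed_measurable[OF std] by simp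
  have "std_normal_distribution = distr M lborel Y"
    using distributed_distr_eq_density[OF std] by simp
  then have "char std_normal_distribution (\<sigma> * t) = expectation (\<lambda>\<omega>. iexp (\<sigma> * t * Y \<omega>))"
    unfolding char_def by (simp add: integral_distr)
  also have "\<dots> = expectation (\<lambda>\<omega>. iexp (t * X \<omega>))"
  proof (intro Bochner_Integration.integral_cong refl)
    fix \<omega>
    have "\<sigma> * t * Y \<omega> = t * X \<omega>" using s by (simp add: Y_def)
    then show "iexp (\<sigma> * t * Y \<omega>) = iexp (t * X \<omega>)" by (rule arg_cong)
  qed
  finally show ?thesis by (simp add: char_std_normal_distribution)
qed

lemma char_normal:
  assumes s: "\<sigma> > 0"
  shows "char (density lborel (normal_density 0 \<sigma>)) t = of_real (exp (- (\<sigma> * t)\<^sup>2 / 2))"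
proof -
  interpret prob_space "density lborel (normal_density 0 \<sigma>)" by (rule prob_space_normal_density[OF s])
  have "distributed (density lborel (normal_density 0 \<sigma>)) lborel (\<lambda>x. x) (normal_density 0 \<sigma>)"
    unfolding distributed_def by (auto intro!: distr_id2)
  from normal_char[OF this s, of t] show ?thesis by (simp add: char_def)
qed

text \<open>Conditioning on the block A, done by Fubini for the product of the two block laws: with
  the coefficients frozen, the exponent is linear in independent Gaussian variables, and the inner
  integral is a product of characteristic functions.\<close>

lemma (in prob_space) gaussian_block_char:
  fixes Y :: "'i \<Rightarrow> 'a \<Rightarrow> real" and b :: "'i \<Rightarrow> ('i \<Rightarrow> real) \<Rightarrow> real"
  assumes ind: "indep_vars (\<lambda>_. borel) Y (A \<union> B)" and disj: "A \<inter> B = {}" and finB: "finite B"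
    and dist: "\<And>y. y \<in> B \<Longrightarrow> distributed M lborel (Y y) (normal_density 0 (sqrt v))" and v: "v > 0"
    and b: "\<And>y. y \<in> B \<Longrightarrow> b y \<in> borel_measurable (PiM A (\<lambda>_. borel))"
  defines "U \<equiv> \<lambda>\<omega>. restrict (\<lambda>y. Y y \<omega>) A"
  shows "expectation (\<lambda>\<omega>. \<Prod>y\<in>B. iexp (b y (U \<omega>) * Y y \<omega>))
      = expectation (\<lambda>\<omega>. of_real (exp (- (v / 2) * (\<Sum>y\<in>B. (b y (U \<omega>))\<^sup>2))))"
proof -
  let ?S = "PiM A (\<lambda>_. borel :: real measure)" and ?T = "PiM B (\<lambda>_. borel :: real measure)"
  define V where "V \<omega> = restrict (\<lambda>y. Y y \<omega>) B" for \<omega>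
  have "indep_var ?S U ?T V"
    unfolding U_def V_def by (rule indep_var_restrict[OF ind disj]) auto
  then have U [measurable]: "U \<in> measurable M ?S" and V [measurable]: "V \<in> measurable M ?T"
    and joint: "distr M ?S U \<Otimes>\<^sub>M distr M ?T V = distr M (?S \<Otimes>\<^sub>M ?T) (\<lambda>\<omega>. (U \<omega>, V \<omega>))"
    unfolding indep_var_distribution_eq by auto
  interpret PU: prob_space "distr M ?S U" by (rule prob_space_distr) measurable
  interpret PV: prob_space "distr M ?T V" by (rule prob_space_distr) measurable
  interpret P: pair_prob_space "distr M ?S U" "distr M ?T V" ..
  define h where "h = (\<lambda>z :: ('i \<Rightarrow> real) \<times> ('i \<Rightarrow> real). \<Prod>y\<in>B. iexp (b y (fst z) * snd z y))"
  have h_meas [measurable]: "h \<in> borel_measurable (?S \<Otimes>\<^sub>M ?T)"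
    unfolding h_def
  proof (rule borel_measurable_prod)
    fix y assume y: "y \<in> B"
    have [measurable]: "b y \<in> borel_measurable ?S" by (rule b[OF y])
    have [measurable]: "(\<lambda>w. w y) \<in> borel_measurable ?T" using y by measurable
    show "(\<lambda>z. iexp (b y (fst z) * snd z y)) \<in> borel_measurable (?S \<Otimes>\<^sub>M ?T)" by measurable
  qed
  have h_meas' [measurable]: "h \<in> borel_measurable (distr M ?S U \<Otimes>\<^sub>M distr M ?T V)"
    using h_meas by (simp cong: measurable_cong_sets sets_pair_measure_cong)
  have h_int: "integrable (distr M ?S U \<Otimes>\<^sub>M distr M ?T V) h"
    by (rule P.integrable_const_bound[OF _ h_meas', of 1]) (simp add: h_def prod_norm[symmetric])
  have inner: "(\<integral>w. h (u, w) \<partial>distr M ?T V) = of_real (exp (- (v / 2) * (\<Sum>y\<in>B. (b y u)\<^sup>2)))"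
    if u: "u \<in> space ?S" for u
  proof -
    have "(\<lambda>w. h (u, w)) \<in> borel_measurable ?T"
      using u by (rule measurable_Pair1'[THEN measurable_compose, OF _ h_meas])
    then have "(\<integral>w. h (u, w) \<partial>distr M ?T V) = expectation (\<lambda>\<omega>. h (u, V \<omega>))"
      by (rule integral_distr[OF V])
    also have "\<dots> = expectation (\<lambda>\<omega>. \<Prod>y\<in>B. iexp (b y u * Y y \<omega>))"
      unfolding h_def V_def by (intro Bochner_Integration.integral_cong prod.cong refl) simp_all
    also have "\<dots> = (\<Prod>y\<in>B. expectation (\<lambda>\<omega>. iexp (b y u * Y y \<omega>)))"
    proof (rule indep_vars_lebesgue_integral[OF finB])
      show "indep_vars (\<lambda>_. borel) (\<lambda>y \<omega>. iexp (b y u * Y y \<omega>)) B"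
        by (rule indep_vars_compose2[OF indep_vars_subset[OF ind], of B "\<lambda>y x. iexp (b y u * x)"]) auto
      fix y assume "y \<in> B"
      then have [measurable]: "Y y \<in> borel_measurable M" using distributed_measurable[OF dist] by simp
      show "integrable M (\<lambda>\<omega>. iexp (b y u * Y y \<omega>))"
        by (rule integrable_const_bound[of _ 1]) auto
    qed
    also have "\<dots> = (\<Prod>y\<in>B. of_real (exp (- (sqrt v * b y u)\<^sup>2 / 2)))"
      using v dist by (intro prod.cong refl normal_char) auto
    also have "\<dots> = of_real (\<Prod>y\<in>B. exp (- (sqrt v * b y u)\<^sup>2 / 2))" by simp
    also have "(\<Prod>y\<in>B. exp (- (sqrt v * b y u)\<^sup>2 / 2)) = exp (\<Sum>y\<in>B. - (sqrt v * b y u)\<^sup>2 / 2)"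
      using finB by (simp add: exp_sum)
    also have "(\<Sum>y\<in>B. - (sqrt v * b y u)\<^sup>2 / 2) = - (v / 2) * (\<Sum>y\<in>B. (b y u)\<^sup>2)"
      using v by (simp add: power_mult_distrib sum_distrib_left)
    finally show ?thesis .
  qed
  have "expectation (\<lambda>\<omega>. \<Prod>y\<in>B. iexp (b y (U \<omega>) * Y y \<omega>)) = expectation (\<lambda>\<omega>. h (U \<omega>, V \<omega>))"
    unfolding h_def V_def by (intro Bochner_Integration.integral_cong prod.cong refl) simp_all
  also have "\<dots> = (\<integral>z. h z \<partial>distr M (?S \<Otimes>\<^sub>M ?T) (\<lambda>\<omega>. (U \<omega>, V \<omega>)))"
    by (rule integral_distr[symmetric]) measurable
  also have "\<dots> = (\<integral>u. \<integral>w. h (u, w) \<partial>distr M ?T V \<partial>distr M ?S U)"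
    unfolding joint[symmetric] by (rule P.integral_fst'[symmetric, OF h_int])
  also have "\<dots> = (\<integral>u. of_real (exp (- (v / 2) * (\<Sum>y\<in>B. (b y u)\<^sup>2))) \<partial>distr M ?S U)"
    by (intro Bochner_Integration.integral_cong refl inner) simp
  also have "\<dots> = expectation (\<lambda>\<omega>. of_real (exp (- (v / 2) * (\<Sum>y\<in>B. (b y (U \<omega>))\<^sup>2))))"
  proof (rule integral_distr[OF U])
    have "(\<lambda>u. \<Sum>y\<in>B. (b y u)\<^sup>2) \<in> borel_measurable ?S"
      using b by (intro borel_measurable_sum borel_measurable_power)
    then show "(\<lambda>u. complex_of_real (exp (- (v / 2) * (\<Sum>y\<in>B. (b y u)\<^sup>2)))) \<in> borel_measurable ?S"
      by measurable
  qed
  finally show ?thesis .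
qed

section \<open>Dependence on the relevant entries and the limit of the kernel sum\<close>

lemma wmat_cong:
  assumes "\<And>i j. i < n \<Longrightarrow> j < n \<Longrightarrow> A i j = A' i j" "i < n"
  shows "wmat n A w i j = wmat n A' w i j"
  using assms(2)
proof (induction w arbitrary: i)
  case (Cons c w)
  then show ?case using assms(1) by (auto simp: letter_def intro!: sum.cong)
qed simp

lemma hvec_cong:
  assumes "\<And>i j. i < n \<Longrightarrow> j < n \<Longrightarrow> A i j = A' i j" "\<And>i. i < n \<Longrightarrow> B i m = B' i m" "i < n"
  shows "hvec n A B a m i = hvec n A' B' a m i"
  unfolding hvec_def using assms wmat_cong[of n A A'] by (intro sum.cong) auto

lemma measurable_hvec:
  assumes "\<And>i j. i < n \<Longrightarrow> j < n \<Longrightarrow> (\<lambda>\<omega>. A \<omega> i j) \<in> borel_measurable M"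
    and "\<And>i. i < n \<Longrightarrow> (\<lambda>\<omega>. B \<omega> i m) \<in> borel_measurable M" and "i < n"
  shows "(\<lambda>\<omega>. hvec n (A \<omega>) (B \<omega>) a m i) \<in> borel_measurable M"
  using assms(3)
proof (induction a arbitrary: i)
  case 0
  then show ?case using assms(2) by (simp add: hvec_0)
next
  case (Suc a)
  show ?case unfolding hvec_Suc
    using assms(1) Suc by (intro borel_measurable_sum borel_measurable_times) auto
qed

lemma impulse_coeff_eq:
  "impulse_coeff n W F C j k m
     = 1 / sqrt (real n) * (\<Sum>i<n. C k i * hvec n (\<lambda>i j. 1 / sqrt (real n) * W i j) F j m i)"
  unfolding impulse_coeff_def hvec_scale
  by (simp add: wpowF_eq_hvec sum_distrib_left mult_ac)

lemma sum_delta_pair: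
  fixes f :: "'b \<Rightarrow> real"
  assumes "finite S" "\<alpha> \<in> S"
  shows "(\<Sum>\<beta>\<in>S. if \<beta> = \<alpha> then f \<beta> else 0) = f \<alpha>"
  using assms by simp

lemma ntk_sum_tendsto:
  assumes C: "\<And>a b. (\<lambda>n. qC n a b k l) \<longlonglongrightarrow> LC a b k l"
    and F: "\<And>a b m m'. m < nx \<Longrightarrow> m' < nx \<Longrightarrow> (\<lambda>n. qF n a b m m') \<longlonglongrightarrow> LF a b m m'"
  shows "(\<lambda>n. ntk_sum T nx (qC n) (qF n) x x' t k s l) \<longlonglongrightarrow> ntk_sum T nx LC LF x x' t k s l"
proof (cases "k = l")
  case True
  show ?thesis
    unfolding ntk_sum_def case_prod_unfold if_P[OF True]
    by (intro tendsto_add tendsto_sum tendsto_mult tendsto_const C F) auto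
next
  case False
  show ?thesis
    unfolding ntk_sum_def case_prod_unfold if_not_P[OF False]
    by (intro tendsto_add tendsto_sum tendsto_mult tendsto_const C F) auto
qed

text \<open>In the W part a pair (a, d) survives only against itself, with weight \<nu>C \<nu>F
  \<nu>W^(a-1) independent of d. The a choices of d < a give the factor j in \<open>ntk_rho\<close>;
  for a = 0 there is no such d, so the truncated exponent is irrelevant.\<close>

lemma ntk_limit_eq:
  fixes \<nu>W \<nu>F \<nu>C :: real
  assumes t: "t < T" "s < T"
  defines "LF \<equiv> \<lambda>a b m m'. if m = m' \<and> b = a then \<nu>F * \<nu>W ^ b else 0"
  defines "LC \<equiv> \<lambda>a b k l. if k = l \<and> b = a then \<nu>C * \<nu>W ^ b else 0"
  shows "ntk_sum T nx LC LF x x' t k s l = ntk_limit T nx \<nu>W \<nu>F \<nu>C x x' t k s l"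
proof (cases "k = l")
  case False
  then show ?thesis by (simp add: ntk_sum_def LC_def ntk_limit_def case_prod_unfold)
next
  case True
  let ?X = "\<lambda>a m a' m'. toeplitz_in x a m t * toeplitz_in x' a' m' s"
  let ?Y = "\<lambda>a m. ?X a m a m"
  have 1: "(\<Sum>((a, d), m)\<in>lags T \<times> {..<nx}. \<Sum>((a', d'), m')\<in>lags T \<times> {..<nx}.
        LC d d' k l * LF (a - 1 - d) (a' - 1 - d') m m' * ?X a m a' m')
     = (\<Sum>a<T. \<Sum>m<nx. real a * \<nu>C * \<nu>F * \<nu>W ^ (a - 1) * ?Y a m)"
  proof -
    have "(\<Sum>((a, d), m)\<in>lags T \<times> {..<nx}. \<Sum>((a', d'), m')\<in>lags T \<times> {..<nx}.
        LC d d' k l * LF (a - 1 - d) (a' - 1 - d') m m' * ?X a m a' m')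
      = (\<Sum>((a, d), m)\<in>lags T \<times> {..<nx}. \<nu>C * \<nu>F * \<nu>W ^ (a - 1) * ?Y a m)"
    proof (intro sum.cong refl, clarify)
      fix a d m assume ad: "(a, d) \<in> lags T" and m: "m < nx"
      have "(\<Sum>((a', d'), m')\<in>lags T \<times> {..<nx}.
        LC d d' k l * LF (a - 1 - d) (a' - 1 - d') m m' * ?X a m a' m')
        = (\<Sum>\<beta>\<in>lags T \<times> {..<nx}. LC d (snd (fst \<beta>)) k l * LF (a - 1 - d) (fst (fst \<beta>) - 1 - snd (fst \<beta>)) m (snd \<beta>)
            * (toeplitz_in x a m t * toeplitz_in x' (fst (fst \<beta>)) (snd \<beta>) s))"
        by (simp add: case_prod_unfold)
      also have "\<dots> = (\<Sum>\<beta>\<in>lags T \<times> {..<nx}. if \<beta> = ((a, d), m) then \<nu>C * \<nu>F * \<nu>W ^ (a - 1) * ?Y a m else 0)"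
      proof (intro sum.cong refl)
        fix \<beta> assume \<beta>: "\<beta> \<in> lags T \<times> {..<nx}"
        obtain a' d' m' where b: "\<beta> = ((a', d'), m')" by (metis prod.exhaust)
        have d: "d < a" "d' < a'" using ad \<beta> b by (auto simp: lags_def)
        have pw: "\<nu>W ^ d * \<nu>W ^ (a - 1 - d) = \<nu>W ^ (a - 1)" using d(1) by (simp add: power_add[symmetric])
        \<comment> \<open>Both subtractions are exact because d < a and d' < a', so that equal d and
          equal a - 1 - d force equal a.\<close>
        have "d' = d \<and> m = m' \<and> a' - 1 - d' = a - 1 - d \<longleftrightarrow> \<beta> = ((a, d), m)"
          using d b by auto
        then show "LC d (snd (fst \<beta>)) k l * LF (a - 1 - d) (fst (fst \<beta>) - 1 - snd (fst \<beta>)) m (snd \<beta>)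
            * (toeplitz_in x a m t * toeplitz_in x' (fst (fst \<beta>)) (snd \<beta>) s)
          = (if \<beta> = ((a, d), m) then \<nu>C * \<nu>F * \<nu>W ^ (a - 1) * ?Y a m else 0)"
          using True b pw[symmetric] by (auto simp: LC_def LF_def)
      qed
      also have "\<dots> = \<nu>C * \<nu>F * \<nu>W ^ (a - 1) * ?Y a m"
        using ad m by (intro sum_delta_pair) auto
      finally show "(\<Sum>((a', d'), m')\<in>lags T \<times> {..<nx}.
        LC d d' k l * LF (a - 1 - d) (a' - 1 - d') m m' * ?X a m a' m')
        = \<nu>C * \<nu>F * \<nu>W ^ (a - 1) * ?Y a m" .
    qed
    also have "\<dots> = (\<Sum>(a, d)\<in>lags T. \<Sum>m<nx. \<nu>C * \<nu>F * \<nu>W ^ (a - 1) * ?Y a m)"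
      by (simp add: sum.cartesian_product case_prod_unfold)
    also have "\<dots> = (\<Sum>a<T. \<Sum>d<a. \<Sum>m<nx. \<nu>C * \<nu>F * \<nu>W ^ (a - 1) * ?Y a m)"
      unfolding lags_def by (rule sum.Sigma[symmetric]) auto
    finally show ?thesis by (simp add: sum_distrib_left mult_ac)
  qed
  have 2: "(\<Sum>m<nx. \<Sum>a<T. \<Sum>a'<T. LC a a' k l * ?X a m a' m)
     = (\<Sum>a<T. \<Sum>m<nx. \<nu>C * \<nu>W ^ a * ?Y a m)"
  proof -
    have "(\<Sum>a'<T. LC a a' k l * ?X a m a' m) = \<nu>C * \<nu>W ^ a * ?Y a m" if "a < T" for a m
    proof -
      have "(\<Sum>a'<T. LC a a' k l * ?X a m a' m)
        = (\<Sum>a'<T. if a' = a then \<nu>C * \<nu>W ^ a * ?Y a m else 0)"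
        using True by (intro sum.cong refl) (auto simp: LC_def)
      then show ?thesis using that by simp
    qed
    then have "(\<Sum>m<nx. \<Sum>a<T. \<Sum>a'<T. LC a a' k l * ?X a m a' m)
      = (\<Sum>m<nx. \<Sum>a<T. \<nu>C * \<nu>W ^ a * ?Y a m)" by simp
    also have "\<dots> = (\<Sum>a<T. \<Sum>m<nx. \<nu>C * \<nu>W ^ a * ?Y a m)" by (rule sum.swap)
    finally show ?thesis .
  qed
  have 3: "(\<Sum>(a, m)\<in>{..<T} \<times> {..<nx}. \<Sum>(a', m')\<in>{..<T} \<times> {..<nx}.
        LF a a' m m' * ?X a m a' m') = (\<Sum>a<T. \<Sum>m<nx. \<nu>F * \<nu>W ^ a * ?Y a m)"
  proof -
    have "(\<Sum>(a, m)\<in>{..<T} \<times> {..<nx}. \<Sum>(a', m')\<in>{..<T} \<times> {..<nx}.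
        LF a a' m m' * ?X a m a' m')
      = (\<Sum>(a, m)\<in>{..<T} \<times> {..<nx}. \<nu>F * \<nu>W ^ a * ?Y a m)"
    proof (intro sum.cong refl, clarify)
      fix a m assume am: "a < T" "m < nx"
      have "(\<Sum>(a', m')\<in>{..<T} \<times> {..<nx}. LF a a' m m' * ?X a m a' m')
        = (\<Sum>\<beta>\<in>{..<T} \<times> {..<nx}. if \<beta> = (a, m) then \<nu>F * \<nu>W ^ a * ?Y a m else 0)"
        by (intro sum.cong refl) (auto simp: LF_def split: if_splits)
      also have "\<dots> = \<nu>F * \<nu>W ^ a * ?Y a m"
        using am by (intro sum_delta_pair) auto
      finally show "(\<Sum>(a', m')\<in>{..<T} \<times> {..<nx}. LF a a' m m' * ?X a m a' m')
        = \<nu>F * \<nu>W ^ a * ?Y a m" .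
    qed
    then show ?thesis by (simp add: sum.cartesian_product)
  qed
  have "(\<Sum>a<T. \<Sum>m<nx. real a * \<nu>C * \<nu>F * \<nu>W ^ (a - 1) * ?Y a m) + (\<Sum>a<T. \<Sum>m<nx. \<nu>C * \<nu>W ^ a * ?Y a m)
     + (\<Sum>a<T. \<Sum>m<nx. \<nu>F * \<nu>W ^ a * ?Y a m) = (\<Sum>a<T. \<Sum>m<nx. toeplitz_in x a m t * ntk_rho \<nu>W \<nu>F \<nu>C a * toeplitz_in x' a m s)"
    unfolding sum.distrib[symmetric] by (intro sum.cong refl) (simp add: ntk_rho_def algebra_simps)
  then show ?thesis unfolding ntk_sum_def 1 2 3 using True by (simp add: ntk_limit_def)
qed

section \<open>The recurrent network at initialization\<close>

lemma (in prob_space) gaussian_matrixI: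
  assumes n: "n \<ge> 1" and pos: "\<nu> > 0" "\<eta> > 0"
    and ind: "indep_vars (\<lambda>_. borel) (case_sum (\<lambda>(i, j). W i j) (\<lambda>(i, m). B i m)) (({..<n} \<times> {..<n}) <+> ({..<n} \<times> {..<d}))"
    and dW: "\<And>i j. i < n \<Longrightarrow> j < n \<Longrightarrow> distributed M lborel (W i j) (normal_density 0 (sqrt \<nu>))"
    and dB: "\<And>i m. i < n \<Longrightarrow> m < d \<Longrightarrow> distributed M lborel (B i m) (normal_density 0 (sqrt \<eta>))"
  shows "gaussian_matrix M n d (case_sum (\<lambda>(i, j) \<omega>. 1 / sqrt (real n) * W i j \<omega>) (\<lambda>(i, m). B i m)) \<nu> \<eta>"
proof
  show "finite (({..<n} \<times> {..<n}) <+> ({..<n} \<times> {..<d}))" by simp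
  show "1 \<le> n" by fact
  let ?X = "case_sum (\<lambda>(i, j) \<omega>. 1 / sqrt (real n) * W i j \<omega>) (\<lambda>(i, m). B i m)"
  have "indep_vars (\<lambda>_. borel) (\<lambda>y \<omega>. (case y of Inl _ \<Rightarrow> (\<lambda>x. 1 / sqrt (real n) * x) | Inr _ \<Rightarrow> (\<lambda>x. x))
     (case_sum (\<lambda>(i, j). W i j) (\<lambda>(i, m). B i m) y \<omega>)) (({..<n} \<times> {..<n}) <+> ({..<n} \<times> {..<d}))"
    by (rule indep_vars_compose2[OF ind]) (auto split: sum.split)
  also have "(\<lambda>y \<omega>. (case y of Inl _ \<Rightarrow> (\<lambda>x. 1 / sqrt (real n) * x) | Inr _ \<Rightarrow> (\<lambda>x. x))
     (case_sum (\<lambda>(i, j). W i j) (\<lambda>(i, m). B i m) y \<omega>)) = ?X"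
    by (auto simp: fun_eq_iff split: sum.split)
  finally show "indep_vars (\<lambda>_. borel) ?X (({..<n} \<times> {..<n}) <+> ({..<n} \<times> {..<d}))" .
  fix y assume y: "y \<in> ({..<n} \<times> {..<n}) <+> ({..<n} \<times> {..<d})"
  show "0 < case_sum (\<lambda>_. \<nu> / real n) (\<lambda>_. \<eta>) y" using pos n by (auto split: sum.split)
  have "distributed M lborel (\<lambda>\<omega>. 0 + 1 / sqrt (real n) * W i j \<omega>) (normal_density (0 + 1 / sqrt (real n) * 0) (\<bar>1 / sqrt (real n)\<bar> * sqrt \<nu>))"
    if "i < n" "j < n" for i j
    using n pos by (intro normal_density_affine dW that) auto
  moreover have "\<bar>1 / sqrt (real n)\<bar> * sqrt \<nu> = sqrt (\<nu> / real n)"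
    by (simp add: real_sqrt_divide)
  ultimately have "distributed M lborel (\<lambda>\<omega>. 1 / sqrt (real n) * W i j \<omega>) (normal_density 0 (sqrt (\<nu> / real n)))"
    if "i < n" "j < n" for i j using that by simp
  then show "distributed M lborel (?X y) (normal_density 0 (sqrt (case_sum (\<lambda>_. \<nu> / real n) (\<lambda>_. \<eta>) y)))"
    using y dB by auto
qed

lemma prod_iexp:
  assumes "finite S" shows "(\<Prod>y\<in>S. iexp (f y)) = iexp (\<Sum>y\<in>S. f y)"
  using assms by (simp add: exp_sum sum_distrib_left)

section \<open>Initialized parameters and the limit of the kernel\<close>

locale rnn_init = prob_space M for M :: "'a measure" +
  fixes T nx ny :: nat
    and \<nu>W \<nu>F \<nu>C :: real
    and W F C :: "nat \<Rightarrow> nat \<Rightarrow> nat \<Rightarrow> 'a \<Rightarrow> real"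
  assumes \<nu>W: "\<nu>W > 0" and \<nu>F: "\<nu>F > 0" and \<nu>C: "\<nu>C > 0"
    and indep: "\<And>n. n \<ge> 1 \<Longrightarrow> indep_vars (\<lambda>_. borel)
        (\<lambda>p. case p of Inl (i, j) \<Rightarrow> W n i j
                    | Inr (Inl (i, m)) \<Rightarrow> F n i m
                    | Inr (Inr (k, i)) \<Rightarrow> C n k i)
        (({..<n} \<times> {..<n}) <+> (({..<n} \<times> {..<nx}) <+> ({..<ny} \<times> {..<n})))"
    and distW: "\<And>n i j. n \<ge> 1 \<Longrightarrow> i < n \<Longrightarrow> j < n \<Longrightarrow>
        distributed M lborel (W n i j) (normal_density 0 (sqrt \<nu>W))"
    and distF: "\<And>n i m. n \<ge> 1 \<Longrightarrow> i < n \<Longrightarrow> m < nx \<Longrightarrow>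
        distributed M lborel (F n i m) (normal_density 0 (sqrt \<nu>F))"
    and distC: "\<And>n k i. n \<ge> 1 \<Longrightarrow> k < ny \<Longrightarrow> i < n \<Longrightarrow>
        distributed M lborel (C n k i) (normal_density 0 (sqrt \<nu>C))"
begin

definition params :: "nat \<Rightarrow> (nat \<times> nat) + ((nat \<times> nat) + (nat \<times> nat)) \<Rightarrow> 'a \<Rightarrow> real" where
  "params n = (\<lambda>p. case p of Inl (i, j) \<Rightarrow> W n i j | Inr (Inl (i, m)) \<Rightarrow> F n i m | Inr (Inr (k, i)) \<Rightarrow> C n k i)"

abbreviation "J n \<equiv> ({..<n} \<times> {..<n}) <+> (({..<n} \<times> {..<nx}) <+> ({..<ny} \<times> {..<n}))"

lemma params_indep: "n \<ge> 1 \<Longrightarrow> indep_vars (\<lambda>_. borel) (params n) (J n)"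
  unfolding params_def by (rule indep)

definition XF :: "nat \<Rightarrow> (nat \<times> nat) + (nat \<times> nat) \<Rightarrow> 'a \<Rightarrow> real" where
  "XF n = case_sum (\<lambda>(i, j) \<omega>. 1 / sqrt (real n) * W n i j \<omega>) (\<lambda>(i, m). F n i m)"

text \<open>The index pair of \<open>C\<close> is exchanged, so that the rows of C become the
  columns of the second matrix.\<close>

definition XC :: "nat \<Rightarrow> (nat \<times> nat) + (nat \<times> nat) \<Rightarrow> 'a \<Rightarrow> real" where
  "XC n = case_sum (\<lambda>(i, j) \<omega>. 1 / sqrt (real n) * W n i j \<omega>) (\<lambda>(i, k). C n k i)"

sublocale GF: gaussian_matrices M XF nx \<nu>W \<nu>F
proof (rule gaussian_matrices.intro[OF prob_space_axioms gaussian_matrices_axioms.intro])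
  fix n :: nat assume n: "n \<ge> 1"
  let ?f = "case_sum Inl (\<lambda>q. Inr (Inl q)) :: (nat \<times> nat) + (nat \<times> nat) \<Rightarrow> (nat \<times> nat) + ((nat \<times> nat) + (nat \<times> nat))"
  have "indep_vars (\<lambda>_. borel) (\<lambda>y. params n (?f y)) (({..<n} \<times> {..<n}) <+> ({..<n} \<times> {..<nx}))"
    by (rule indep_vars_reindex[OF params_indep[OF n]]) (auto simp: inj_on_def split: sum.splits)
  also have "(\<lambda>y. params n (?f y)) = case_sum (\<lambda>(i, j). W n i j) (\<lambda>(i, m). F n i m)"
    by (auto simp: params_def fun_eq_iff split: sum.split)
  finally show "gaussian_matrix M n nx (XF n) \<nu>W \<nu>F"
    unfolding XF_def using n \<nu>W \<nu>F distW distF by (intro gaussian_matrixI) auto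
qed

sublocale GC: gaussian_matrices M XC ny \<nu>W \<nu>C
proof (rule gaussian_matrices.intro[OF prob_space_axioms gaussian_matrices_axioms.intro])
  fix n :: nat assume n: "n \<ge> 1"
  let ?f = "case_sum Inl (\<lambda>(i, k). Inr (Inr (k, i))) :: (nat \<times> nat) + (nat \<times> nat) \<Rightarrow> (nat \<times> nat) + ((nat \<times> nat) + (nat \<times> nat))"
  have "indep_vars (\<lambda>_. borel) (\<lambda>y. params n (?f y)) (({..<n} \<times> {..<n}) <+> ({..<n} \<times> {..<ny}))"
    by (rule indep_vars_reindex[OF params_indep[OF n]]) (auto simp: inj_on_def split: sum.splits)
  also have "(\<lambda>y. params n (?f y)) = case_sum (\<lambda>(i, j). W n i j) (\<lambda>(i, k). C n k i)"
    by (auto simp: params_def fun_eq_iff split: sum.split)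
  finally show "gaussian_matrix M n ny (XC n) \<nu>W \<nu>C"
    unfolding XC_def using n \<nu>W \<nu>C distW distC by (intro gaussian_matrixI) auto
qed

abbreviation "Wn n \<omega> \<equiv> \<lambda>i j. W n i j \<omega>"
abbreviation "Fn n \<omega> \<equiv> \<lambda>i m. F n i m \<omega>"
abbreviation "Cn n \<omega> \<equiv> \<lambda>k i. C n k i \<omega>"
abbreviation "An n \<omega> \<equiv> \<lambda>i j. 1 / sqrt (real n) * W n i j \<omega>"

definition qF where
  "qF n \<omega> a b m m' = qform n (An n \<omega>) (Fn n \<omega>) m m' (replicate a False @ replicate b True)"

definition qC where
  "qC n \<omega> a b k l = qform n (An n \<omega>) (\<lambda>i k. C n k i \<omega>) k l (replicate a True @ replicate b False)"

lemma qF_AE: "AE \<omega> in M. \<forall>a b m m'. m < nx \<longrightarrow> m' < nx \<longrightarrow>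
    (\<lambda>n. qF n \<omega> a b m m') \<longlonglongrightarrow> (if m = m' \<and> b = a then \<nu>F * \<nu>W ^ b else 0)"
proof -
  have mat: "matW (\<lambda>y. XF n y \<omega>) = An n \<omega>" "matF (\<lambda>y. XF n y \<omega>) = Fn n \<omega>" for n \<omega>
    by (auto simp: matW_def matF_def XF_def fun_eq_iff)
  have "AE \<omega> in M. m < nx \<longrightarrow> m' < nx \<longrightarrow>
    (\<lambda>n. qF n \<omega> a b m m') \<longlonglongrightarrow> (if m = m' \<and> b = a then \<nu>F * \<nu>W ^ b else 0)" for a b m m'
    using GF.qform_AE[of m m' a False b, unfolded mat] by (cases "m < nx \<and> m' < nx") (auto simp: qF_def)
  then show ?thesis unfolding AE_all_countable by blast
qed

lemma qC_AE: "AE \<omega> in M. \<forall>a b k l. k < ny \<longrightarrow> l < ny \<longrightarrow>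
    (\<lambda>n. qC n \<omega> a b k l) \<longlonglongrightarrow> (if k = l \<and> b = a then \<nu>C * \<nu>W ^ b else 0)"
proof -
  have mat: "matW (\<lambda>y. XC n y \<omega>) = An n \<omega>" "matF (\<lambda>y. XC n y \<omega>) = (\<lambda>i k. C n k i \<omega>)" for n \<omega>
    by (auto simp: matW_def matF_def XC_def fun_eq_iff)
  have "AE \<omega> in M. k < ny \<longrightarrow> l < ny \<longrightarrow>
    (\<lambda>n. qC n \<omega> a b k l) \<longlonglongrightarrow> (if k = l \<and> b = a then \<nu>C * \<nu>W ^ b else 0)" for a b k l
    using GC.qform_AE[of k l a True b, unfolded mat] by (cases "k < ny \<and> l < ny") (auto simp: qC_def)
  then show ?thesis unfolding AE_all_countable by blast
qed

text \<open>The exceptional null set comes only from the countably many forms in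
  \<open>qF_AE\<close> and \<open>qC_AE\<close>; outside it the kernel is a fixed finite combination
  of convergent forms.\<close>

theorem rnn_ntk_AE:
  "AE \<omega> in M. \<forall>t<T. \<forall>k<ny. \<forall>s<T. \<forall>l<ny.
     (\<lambda>n. rnn_ntk n nx ny (Wn n \<omega>) (Fn n \<omega>) (Cn n \<omega>) x x' t k s l)
     \<longlonglongrightarrow> ntk_limit T nx \<nu>W \<nu>F \<nu>C x x' t k s l"
  using qF_AE qC_AE
proof eventually_elim
  case (elim \<omega>)
  show ?case
  proof (intro allI impI)
    fix t k s l assume tk: "t < T" "k < ny" "s < T" "l < ny"
    let ?LF = "\<lambda>a b m m'. if m = m' \<and> b = a then \<nu>F * \<nu>W ^ b else 0"
    let ?LC = "\<lambda>a b k l. if k = l \<and> b = a then \<nu>C * \<nu>W ^ b else 0"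
    have "(\<lambda>n. ntk_sum T nx (qC n \<omega>) (qF n \<omega>) x x' t k s l) \<longlonglongrightarrow> ntk_sum T nx ?LC ?LF x x' t k s l"
      using elim tk by (intro ntk_sum_tendsto) blast+
    then show "(\<lambda>n. rnn_ntk n nx ny (Wn n \<omega>) (Fn n \<omega>) (Cn n \<omega>) x x' t k s l) \<longlonglongrightarrow> ntk_limit T nx \<nu>W \<nu>F \<nu>C x x' t k s l"
      unfolding ntk_limit_eq[OF tk(1,3)]
    proof (rule tendsto_cong_ge1)
      fix n :: nat assume "n \<ge> 1"
      from rnn_ntk_eq[OF this tk(1,3,2)]
      show "rnn_ntk n nx ny (Wn n \<omega>) (Fn n \<omega>) (Cn n \<omega>) x x' t k s l = ntk_sum T nx (qC n \<omega>) (qF n \<omega>) x x' t k s l"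
        unfolding qF_def[abs_def] qC_def[abs_def] .
    qed
  qed
qed

section \<open>The impulse response and its Gaussian limit\<close>

abbreviation "I \<equiv> {..<T} \<times> {..<ny} \<times> {..<nx}"
abbreviation "JM \<equiv> {..<T} \<times> {..<nx}"
abbreviation "hv n \<omega> \<alpha> i \<equiv> hvec n (An n \<omega>) (Fn n \<omega>) (fst \<alpha>) (snd \<alpha>) i"
abbreviation "proj s n \<omega> k i \<equiv> \<Sum>\<alpha>\<in>JM. s (fst \<alpha>, k, snd \<alpha>) * hv n \<omega> \<alpha> i"

text \<open>Outside the index range the limit is a point mass at 0, matching the default value of
  \<open>L\<close>.\<close>

definition N :: "nat \<times> nat \<times> nat \<Rightarrow> real measure" where
  "N p = (if p \<in> I then density lborel (normal_density 0 (sqrt (\<nu>C * \<nu>F * \<nu>W ^ fst p))) else return borel 0)"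

definition L :: "nat \<Rightarrow> 'a \<Rightarrow> nat \<times> nat \<times> nat \<Rightarrow> real" where
  "L n \<omega> = (\<lambda>(j, k, m). if j < T \<and> k < ny \<and> m < nx
      then impulse_coeff n (Wn n \<omega>) (Fn n \<omega>) (Cn n \<omega>) j k m else 0)"

lemma param_meas:
  assumes "n \<ge> 1"
  shows "i < n \<Longrightarrow> j < n \<Longrightarrow> W n i j \<in> borel_measurable M"
    "i < n \<Longrightarrow> m < nx \<Longrightarrow> F n i m \<in> borel_measurable M"
    "k < ny \<Longrightarrow> i < n \<Longrightarrow> C n k i \<in> borel_measurable M"
  using distributed_measurable[OF distW[OF assms]] distributed_measurable[OF distF[OF assms]]
    distributed_measurable[OF distC[OF assms]] by simp_all

lemma L_meas:
  assumes n: "n \<ge> 1" shows "(\<lambda>\<omega>. L n \<omega> p) \<in> borel_measurable M"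
proof -
  obtain j k m where p: "p = (j, k, m)" by (cases p) auto
  show ?thesis
  proof (cases "j < T \<and> k < ny \<and> m < nx")
    case True
    have "(\<lambda>\<omega>. 1 / sqrt (real n) * (\<Sum>i<n. C n k i \<omega> * hvec n (An n \<omega>) (Fn n \<omega>) j m i)) \<in> borel_measurable M"
      using True param_meas[OF n]
      by (intro borel_measurable_times borel_measurable_const borel_measurable_sum measurable_hvec) auto
    then show ?thesis using True by (simp add: p L_def impulse_coeff_eq)
  next
    case False
    then have "(\<lambda>\<omega>. L n \<omega> p) = (\<lambda>_. 0)" by (auto simp: p L_def)
    then show ?thesis by simp
  qed
qed

lemma sum_I: "(\<Sum>p\<in>I. f p) = (\<Sum>k<ny. \<Sum>(j, m)\<in>JM. f (j, k, m))"
proof -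
  have "(\<Sum>p\<in>I. f p) = (\<Sum>j<T. \<Sum>k<ny. \<Sum>m<nx. f (j, k, m))"
    by (simp add: sum.cartesian_product)
  also have "\<dots> = (\<Sum>k<ny. \<Sum>j<T. \<Sum>m<nx. f (j, k, m))" by (rule sum.swap)
  finally show ?thesis by (simp add: sum.cartesian_product)
qed

text \<open>Up to the factor \<nu>C this is the conditional variance, given W and F, of the linear
  combination of the impulse coefficients with weights s.\<close>

definition quad :: "(nat \<times> nat \<times> nat \<Rightarrow> real) \<Rightarrow> nat \<Rightarrow> 'a \<Rightarrow> real" where
  "quad s n \<omega> = (\<Sum>k<ny. \<Sum>\<alpha>\<in>JM. \<Sum>\<beta>\<in>JM.
     s (fst \<alpha>, k, snd \<alpha>) * s (fst \<beta>, k, snd \<beta>) * qF n \<omega> (fst \<alpha>) (fst \<beta>) (snd \<alpha>) (snd \<beta>))"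

text \<open>The expression as a sum of squares shows nonnegativity and is the form in which
  conditioning on W and F produces the variance.\<close>

lemma quad_eq:
  "quad s n \<omega> = (\<Sum>k<ny. \<Sum>i<n. (1 / sqrt (real n) * proj s n \<omega> k i)\<^sup>2)"
proof -
  have "(\<Sum>k<ny. \<Sum>i<n. (1 / sqrt (real n) * proj s n \<omega> k i)\<^sup>2)
    = (\<Sum>k<ny. \<Sum>i<n. 1 / real n * (proj s n \<omega> k i *
      proj s n \<omega> k i))"
    unfolding power_mult_distrib by (simp add: power_divide power2_eq_square)
  also have "\<dots> = (\<Sum>k<ny. 1 / real n * (\<Sum>\<alpha>\<in>JM. \<Sum>\<beta>\<in>JM. \<Sum>i<n.
      (s (fst \<alpha>, k, snd \<alpha>) * hv n \<omega> \<alpha> i) * (s (fst \<beta>, k, snd \<beta>) * hv n \<omega> \<beta> i)))"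
    unfolding sum_sum_product[symmetric] sum_distrib_left[symmetric] ..
  also have "\<dots> = (\<Sum>k<ny. 1 / real n * (\<Sum>\<alpha>\<in>JM. \<Sum>\<beta>\<in>JM.
      s (fst \<alpha>, k, snd \<alpha>) * s (fst \<beta>, k, snd \<beta>) * (\<Sum>i<n. hv n \<omega> \<alpha> i * hv n \<omega> \<beta> i)))"
    unfolding sum_distrib_left by (simp only: mult_ac)
  also have "\<dots> = quad s n \<omega>"
    unfolding quad_def qF_def qform_hvec by (simp add: sum_divide_distrib[symmetric])
  finally show ?thesis by (rule sym)
qed

lemma quad_nonneg: "quad s n \<omega> \<ge> 0"
  unfolding quad_eq by (intro sum_nonneg) auto

lemma quad_meas:
  assumes n: "n \<ge> 1" shows "quad s n \<in> borel_measurable M"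
proof -
  have "(\<lambda>\<omega>. \<Sum>k<ny. \<Sum>i<n. (1 / sqrt (real n) * proj s n \<omega> k i)\<^sup>2) \<in> borel_measurable M"
    using param_meas[OF n]
    by (intro borel_measurable_times borel_measurable_const borel_measurable_sum borel_measurable_power measurable_hvec) auto
  then show ?thesis unfolding quad_eq[symmetric] .
qed

text \<open>Given W and F, the impulse coefficients are linear in the entries of C. The lemma
  \<open>gaussian_block_char\<close> is applied with the entries of C as the block to be integrated
  out.\<close>

lemma L_char:
  assumes n: "n \<ge> 1"
  shows "expectation (\<lambda>\<omega>. \<Prod>p\<in>I. iexp (s p * L n \<omega> p))
       = expectation (\<lambda>\<omega>. of_real (exp (- (\<nu>C / 2) * quad s n \<omega>)))"
proof -
  define B where "B = (\<lambda>p. Inr (Inr p) :: (nat \<times> nat) + ((nat \<times> nat) + (nat \<times> nat))) ` ({..<ny} \<times> {..<n})"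
  define A where "A = J n - B"
  have inj: "inj_on (\<lambda>p. Inr (Inr p) :: (nat \<times> nat) + ((nat \<times> nat) + (nat \<times> nat))) ({..<ny} \<times> {..<n})"
    by (auto simp: inj_on_def)
  have BJ: "A \<union> B = J n" by (auto simp: A_def B_def)
  \<comment> \<open>The coefficient of the (k, i) entry of C, written as a function of the other
    parameters alone so that it can be evaluated on the restricted vector \<open>U\<close>.\<close>
  define \<beta> where "\<beta> = (\<lambda>k i (u :: (nat \<times> nat) + ((nat \<times> nat) + (nat \<times> nat)) \<Rightarrow> real).
     1 / sqrt (real n) * (\<Sum>\<alpha>\<in>JM. s (fst \<alpha>, k, snd \<alpha>) *
        hvec n (\<lambda>i j. 1 / sqrt (real n) * u (Inl (i, j))) (\<lambda>i m. u (Inr (Inl (i, m)))) (fst \<alpha>) (snd \<alpha>) i))"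
  define b where "b y = (case y of Inr (Inr (k, i)) \<Rightarrow> \<beta> k i | _ \<Rightarrow> (\<lambda>_. 0))" for y :: "(nat \<times> nat) + ((nat \<times> nat) + (nat \<times> nat))"
  define U where "U \<omega> = restrict (\<lambda>y. params n y \<omega>) A" for \<omega>
  have \<beta>U: "\<beta> k i (U \<omega>) = 1 / sqrt (real n) * proj s n \<omega> k i" if "i < n" for k i \<omega>
  proof -
    have U1: "U \<omega> (Inl (i, j)) = W n i j \<omega>" if "i < n" "j < n" for i j
      using that by (auto simp: U_def A_def B_def params_def)
    have U2: "U \<omega> (Inr (Inl (i, m))) = F n i m \<omega>" if "i < n" "m < nx" for i m
      using that by (auto simp: U_def A_def B_def params_def)
    have "hvec n (\<lambda>i j. 1 / sqrt (real n) * U \<omega> (Inl (i, j))) (\<lambda>i m. U \<omega> (Inr (Inl (i, m)))) (fst \<alpha>) (snd \<alpha>) i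
       = hv n \<omega> \<alpha> i" if "\<alpha> \<in> JM" for \<alpha>
      using that \<open>i < n\<close> by (intro hvec_cong) (auto simp: U1 U2)
    then show ?thesis by (simp add: \<beta>_def)
  qed
  have sumB: "(\<Sum>y\<in>B. f y) = (\<Sum>k<ny. \<Sum>i<n. f (Inr (Inr (k, i))))" for f :: "_ \<Rightarrow> real"
    unfolding B_def sum.reindex[OF inj] by (simp add: sum.cartesian_product case_prod_unfold)
  have "expectation (\<lambda>\<omega>. \<Prod>p\<in>I. iexp (s p * L n \<omega> p)) = expectation (\<lambda>\<omega>. \<Prod>y\<in>B. iexp (b y (U \<omega>) * params n y \<omega>))"
  proof (intro Bochner_Integration.integral_cong refl)
    fix \<omega>
    have "(\<Sum>p\<in>I. s p * L n \<omega> p) = (\<Sum>k<ny. \<Sum>\<alpha>\<in>JM. \<Sum>i<n. s (fst \<alpha>, k, snd \<alpha>) *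
        (1 / sqrt (real n) * (C n k i \<omega> * hv n \<omega> \<alpha> i)))"
      unfolding sum_I by (intro sum.cong refl) (auto simp: L_def impulse_coeff_eq sum_distrib_left)
    also have "\<dots> = (\<Sum>k<ny. \<Sum>i<n. \<Sum>\<alpha>\<in>JM. s (fst \<alpha>, k, snd \<alpha>) *
        (1 / sqrt (real n) * (C n k i \<omega> * hv n \<omega> \<alpha> i)))"
      by (intro sum.cong refl sum.swap)
    also have "\<dots> = (\<Sum>k<ny. \<Sum>i<n. \<beta> k i (U \<omega>) * C n k i \<omega>)"
    proof (intro sum.cong refl)
      fix k i assume "i \<in> {..<n}"
      then have i: "i < n" by simp
      show "(\<Sum>\<alpha>\<in>JM. s (fst \<alpha>, k, snd \<alpha>) *
        (1 / sqrt (real n) * (C n k i \<omega> * hv n \<omega> \<alpha> i))) = \<beta> k i (U \<omega>) * C n k i \<omega>"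
        unfolding \<beta>U[OF i] sum_distrib_left sum_distrib_right by (simp only: mult_ac)
    qed
    also have "\<dots> = (\<Sum>y\<in>B. b y (U \<omega>) * params n y \<omega>)"
      unfolding sumB by (simp add: b_def params_def)
    finally have eq: "(\<Sum>p\<in>I. s p * L n \<omega> p) = (\<Sum>y\<in>B. b y (U \<omega>) * params n y \<omega>)" .
    show "(\<Prod>p\<in>I. iexp (s p * L n \<omega> p)) = (\<Prod>y\<in>B. iexp (b y (U \<omega>) * params n y \<omega>))"
      by (subst prod_iexp, simp, subst prod_iexp, simp add: B_def, subst eq, rule refl)
  qed
  also have "\<dots> = expectation (\<lambda>\<omega>. of_real (exp (- (\<nu>C / 2) * (\<Sum>y\<in>B. (b y (U \<omega>))\<^sup>2))))"
    unfolding U_def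
  proof (rule gaussian_block_char)
    show "indep_vars (\<lambda>_. borel) (params n) (A \<union> B)" unfolding BJ by (rule params_indep[OF n])
    show "A \<inter> B = {}" by (auto simp: A_def)
    show "finite B" by (simp add: B_def)
    show "\<nu>C > 0" by (rule \<nu>C)
    fix y assume y: "y \<in> B"
    then obtain k i where ki: "y = Inr (Inr (k, i))" "k < ny" "i < n" by (auto simp: B_def)
    show "distributed M lborel (params n y) (normal_density 0 (sqrt \<nu>C))"
      using distC[OF n] ki by (simp add: params_def)
    have "\<beta> k i \<in> borel_measurable (PiM A (\<lambda>_. borel))"
      unfolding \<beta>_def
    proof (intro borel_measurable_times borel_measurable_const borel_measurable_sum measurable_hvec ki(3))
      fix i j assume "i < n" "j < n"
      then have "Inl (i, j) \<in> A" by (auto simp: A_def B_def)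
      then show "(\<lambda>u. u (Inl (i, j))) \<in> borel_measurable (PiM A (\<lambda>_. borel))" by (rule measurable_component_singleton)
    next
      fix \<alpha> i assume "\<alpha> \<in> JM" "i < n"
      then have "Inr (Inl (i, snd \<alpha>)) \<in> A" by (auto simp: A_def B_def)
      then show "(\<lambda>u. u (Inr (Inl (i, snd \<alpha>)))) \<in> borel_measurable (PiM A (\<lambda>_. borel))" by (rule measurable_component_singleton)
    qed
    then show "b y \<in> borel_measurable (PiM A (\<lambda>_. borel))" by (simp add: b_def ki)
  qed
  also have "(\<lambda>\<omega>. \<Sum>y\<in>B. (b y (U \<omega>))\<^sup>2) = quad s n"
    unfolding quad_eq sumB by (simp add: b_def \<beta>U fun_eq_iff)
  finally show ?thesis .
qed

lemma N_real_distribution: "real_distribution (N p)"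
proof (cases "p \<in> I")
  case True
  have "sqrt (\<nu>C * \<nu>F * \<nu>W ^ fst p) > 0" using \<nu>C \<nu>F \<nu>W by simp
  from prob_space_normal_density[OF this] show ?thesis
    using True by (auto simp: N_def real_distribution_def real_distribution_axioms_def)
next
  case False
  have "prob_space (return borel (0 :: real))" by (rule prob_space_return) simp
  then show ?thesis
    using False by (auto simp: N_def real_distribution_def real_distribution_axioms_def)
qed

lemma N_char_prod:
  "(\<Prod>p\<in>I. char (N p) (s p)) = of_real (exp (- (\<nu>C / 2) *
      (\<Sum>k<ny. \<Sum>\<alpha>\<in>JM. (s (fst \<alpha>, k, snd \<alpha>))\<^sup>2 * (\<nu>F * \<nu>W ^ fst \<alpha>))))"
proof -
  have "char (N p) (s p) = of_real (exp (- (\<nu>C / 2) * ((s p)\<^sup>2 * (\<nu>F * \<nu>W ^ fst p))))" if "p \<in> I" for p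
  proof -
    have "sqrt (\<nu>C * \<nu>F * \<nu>W ^ fst p) > 0" using \<nu>C \<nu>F \<nu>W by simp
    from char_normal[OF this, of "s p"] show ?thesis
      using that \<nu>C \<nu>F \<nu>W by (simp add: N_def power_mult_distrib mult_ac)
  qed
  then have "(\<Prod>p\<in>I. char (N p) (s p)) = of_real (\<Prod>p\<in>I. exp (- (\<nu>C / 2) * ((s p)\<^sup>2 * (\<nu>F * \<nu>W ^ fst p))))"
    by simp
  also have "(\<Prod>p\<in>I. exp (- (\<nu>C / 2) * ((s p)\<^sup>2 * (\<nu>F * \<nu>W ^ fst p)))) = exp (- (\<nu>C / 2) * (\<Sum>p\<in>I. (s p)\<^sup>2 * (\<nu>F * \<nu>W ^ fst p)))"
    unfolding sum_distrib_left by (rule exp_sum[symmetric]) simp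
  finally show ?thesis unfolding sum_I by (simp add: case_prod_unfold)
qed

text \<open>The conditional variance converges almost surely to a constant, because only the
  diagonal terms of the double sum have a nonzero limit; this removes the conditioning and makes the
  limit a product. Dominated convergence applies since the exponentials are at most 1.\<close>

lemma L_char_conv:
  "(\<lambda>n. expectation (\<lambda>\<omega>. \<Prod>p\<in>I. iexp (s p * L (Suc n) \<omega> p))) \<longlonglongrightarrow> (\<Prod>p\<in>I. char (N p) (s p))"
proof -
  define q where "q = (\<Sum>k<ny. \<Sum>\<alpha>\<in>JM. (s (fst \<alpha>, k, snd \<alpha>))\<^sup>2 * (\<nu>F * \<nu>W ^ fst \<alpha>))"
  have quad: "AE \<omega> in M. (\<lambda>n. quad s n \<omega>) \<longlonglongrightarrow> q"
    using qF_AE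
  proof eventually_elim
    case (elim \<omega>)
    have "(\<lambda>n. quad s n \<omega>) \<longlonglongrightarrow> (\<Sum>k<ny. \<Sum>\<alpha>\<in>JM. \<Sum>\<beta>\<in>JM.
        s (fst \<alpha>, k, snd \<alpha>) * s (fst \<beta>, k, snd \<beta>) *
        (if snd \<alpha> = snd \<beta> \<and> fst \<beta> = fst \<alpha> then \<nu>F * \<nu>W ^ fst \<beta> else 0))"
      unfolding quad_def by (intro tendsto_sum tendsto_mult_left) (rule elim[rule_format], auto)
    also have "(\<Sum>k<ny. \<Sum>\<alpha>\<in>JM. \<Sum>\<beta>\<in>JM.
        s (fst \<alpha>, k, snd \<alpha>) * s (fst \<beta>, k, snd \<beta>) *
        (if snd \<alpha> = snd \<beta> \<and> fst \<beta> = fst \<alpha> then \<nu>F * \<nu>W ^ fst \<beta> else 0)) = q"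
      unfolding q_def
    proof (intro sum.cong refl)
      fix k \<alpha> assume \<alpha>: "\<alpha> \<in> JM"
      have "(\<Sum>\<beta>\<in>JM. s (fst \<alpha>, k, snd \<alpha>) * s (fst \<beta>, k, snd \<beta>) *
          (if snd \<alpha> = snd \<beta> \<and> fst \<beta> = fst \<alpha> then \<nu>F * \<nu>W ^ fst \<beta> else 0))
        = (\<Sum>\<beta>\<in>JM. if \<beta> = \<alpha> then (s (fst \<alpha>, k, snd \<alpha>))\<^sup>2 * (\<nu>F * \<nu>W ^ fst \<alpha>) else 0)"
        by (intro sum.cong refl) (auto simp: prod_eq_iff power2_eq_square split: if_splits)
      also have "\<dots> = (s (fst \<alpha>, k, snd \<alpha>))\<^sup>2 * (\<nu>F * \<nu>W ^ fst \<alpha>)"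
        using \<alpha> by (intro sum_delta_pair) auto
      finally show "(\<Sum>\<beta>\<in>JM. s (fst \<alpha>, k, snd \<alpha>) * s (fst \<beta>, k, snd \<beta>) *
          (if snd \<alpha> = snd \<beta> \<and> fst \<beta> = fst \<alpha> then \<nu>F * \<nu>W ^ fst \<beta> else 0))
        = (s (fst \<alpha>, k, snd \<alpha>))\<^sup>2 * (\<nu>F * \<nu>W ^ fst \<alpha>)" .
    qed
    finally show ?case .
  qed
  have "(\<lambda>n. expectation (\<lambda>\<omega>. complex_of_real (exp (- (\<nu>C / 2) * quad s (Suc n) \<omega>)))) \<longlonglongrightarrow> expectation (\<lambda>\<omega>. complex_of_real (exp (- (\<nu>C / 2) * q)))"
  proof (rule integral_dominated_convergence[where w = "\<lambda>_. 1"])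
    show "AE \<omega> in M. (\<lambda>n. complex_of_real (exp (- (\<nu>C / 2) * quad s (Suc n) \<omega>))) \<longlonglongrightarrow> complex_of_real (exp (- (\<nu>C / 2) * q))"
      using quad
    proof eventually_elim
      case (elim \<omega>)
      show ?case by (intro tendsto_intros LIMSEQ_Suc elim)
    qed
    show "AE \<omega> in M. norm (complex_of_real (exp (- (\<nu>C / 2) * quad s (Suc n) \<omega>))) \<le> 1" for n
      using quad_nonneg \<nu>C by (intro AE_I2) (simp add: mult_nonneg_nonneg)
    show "(\<lambda>\<omega>. complex_of_real (exp (- (\<nu>C / 2) * quad s (Suc n) \<omega>))) \<in> borel_measurable M" for n
    proof -
      have [measurable]: "quad s (Suc n) \<in> borel_measurable M" by (rule quad_meas) simp
      show ?thesis by measurable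
    qed
  qed auto
  moreover have "expectation (\<lambda>\<omega>. \<Prod>p\<in>I. iexp (s p * L (Suc n) \<omega> p))
      = expectation (\<lambda>\<omega>. complex_of_real (exp (- (\<nu>C / 2) * quad s (Suc n) \<omega>)))" for n
    by (rule L_char) simp
  ultimately show ?thesis
    unfolding N_char_prod q_def[symmetric] by (simp only: lebesgue_integral_const prob_space scaleR_one)
qed

text \<open>Measurability is required at every index, whereas the parameters are controlled only for
  n \<ge> 1; hence the shift to \<open>Suc n\<close>.\<close>

sublocale char_convergence M I N "\<lambda>n. L (Suc n)"
proof (rule char_convergence.intro[OF prob_space_axioms char_convergence_axioms.intro])
  show "finite I" by simp
  show "(\<lambda>n. expectation (\<lambda>\<omega>. \<Prod>p\<in>I. iexp (s p * L (Suc n) \<omega> p))) \<longlonglongrightarrow> (\<Prod>p\<in>I. char (N p) (s p))" for s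
    by (rule L_char_conv)
qed (simp_all add: N_real_distribution L_meas)

lemma L_zero: "p \<notin> I \<Longrightarrow> L n \<omega> p = 0"
  by (cases p) (auto simp: L_def split: if_splits)

lemma limit_zero: "AE v in \<mu>. \<forall>p. p \<notin> I \<longrightarrow> v p = 0"
  unfolding AE_all_countable
proof
  fix p
  have "AE v in \<mu>. p \<notin> I \<longrightarrow> v p = 0" if "p \<notin> I"
  proof -
    have "AE x in N p. x = 0" unfolding N_def if_not_P[OF that] by (subst AE_return) auto
    then have "AE v in \<mu>. v p = 0"
      by (intro AE_PiM_component[where P = "\<lambda>x. x = 0"] N_prob) auto
    then show ?thesis by eventually_elim simp
  qed
  then show "AE v in \<mu>. p \<notin> I \<longrightarrow> v p = 0" by (cases "p \<in> I") auto
qed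

lemma limit_normal:
  assumes "p \<in> I"
  shows "distributed \<mu> lborel (\<lambda>v. v p) (normal_density 0 (sqrt (\<nu>C * \<nu>F * \<nu>W ^ fst p)))"
proof -
  have "distr \<mu> lborel (\<lambda>v. v p) = distr \<mu> borel (\<lambda>v. v p)" by (rule distr_cong) auto
  then show ?thesis
    using assms unfolding distributed_def distr_coord by (auto simp: N_def)
qed

theorem L_converges: "converges_in_distribution M L \<mu>"
  unfolding converges_in_distribution_def
proof (intro allI impI)
  fix f :: "(nat \<times> nat \<times> nat \<Rightarrow> real) \<Rightarrow> real"
  assume f: "continuous_on UNIV f \<and> bounded (range f)"
  have "(\<lambda>n. expectation (\<lambda>\<omega>. f (L (Suc n) \<omega>))) \<longlonglongrightarrow> (\<integral>v. f v \<partial>\<mu>)"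
    using f limit_zero by (intro expectation_convergence L_zero) auto
  then show "(\<lambda>n. expectation (\<lambda>\<omega>. f (L n \<omega>))) \<longlonglongrightarrow> (\<integral>v. f v \<partial>\<mu>)"
    by (rule LIMSEQ_imp_Suc)
qed

end

theorem theorem2:
  fixes M :: "'a measure"
    and T nx ny :: nat
    and \<nu>W \<nu>F \<nu>C :: real
    and W F C :: "nat \<Rightarrow> nat \<Rightarrow> nat \<Rightarrow> 'a \<Rightarrow> real"
  assumes "prob_space M"
    and "T \<ge> 1"
    and "\<nu>W > 0" and "\<nu>F > 0" and "\<nu>C > 0"
    and indep: "\<And>n. n \<ge> 1 \<Longrightarrow> prob_space.indep_vars M (\<lambda>_. borel)
        (\<lambda>p. case p of Inl (i, j) \<Rightarrow> W n i j
                    | Inr (Inl (i, m)) \<Rightarrow> F n i m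
                    | Inr (Inr (k, i)) \<Rightarrow> C n k i)
        (({..<n} \<times> {..<n}) <+> (({..<n} \<times> {..<nx}) <+> ({..<ny} \<times> {..<n})))"
    and distW: "\<And>n i j. n \<ge> 1 \<Longrightarrow> i < n \<Longrightarrow> j < n \<Longrightarrow>
        distributed M lborel (W n i j) (normal_density 0 (sqrt \<nu>W))"
    and distF: "\<And>n i m. n \<ge> 1 \<Longrightarrow> i < n \<Longrightarrow> m < nx \<Longrightarrow>
        distributed M lborel (F n i m) (normal_density 0 (sqrt \<nu>F))"
    and distC: "\<And>n k i. n \<ge> 1 \<Longrightarrow> k < ny \<Longrightarrow> i < n \<Longrightarrow>
        distributed M lborel (C n k i) (normal_density 0 (sqrt \<nu>C))"
  shows
    "(\<exists>\<mu> :: (nat \<times> nat \<times> nat \<Rightarrow> real) measure.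
        prob_space \<mu> \<and> sets \<mu> = sets borel
      \<and> prob_space.indep_vars \<mu> (\<lambda>_. borel) (\<lambda>p v. v p) ({..<T} \<times> {..<ny} \<times> {..<nx})
      \<and> (\<forall>j<T. \<forall>k<ny. \<forall>m<nx. distributed \<mu> lborel (\<lambda>v. v (j, k, m))
            (normal_density 0 (sqrt (\<nu>C * \<nu>F * \<nu>W ^ j))))
      \<and> (AE v in \<mu>. \<forall>p. p \<notin> {..<T} \<times> {..<ny} \<times> {..<nx} \<longrightarrow> v p = 0)
      \<and> converges_in_distribution M
          (\<lambda>n \<omega> (j, k, m). if j < T \<and> k < ny \<and> m < nx
              then impulse_coeff n (\<lambda>i i'. W n i i' \<omega>) (\<lambda>i m'. F n i m' \<omega>)
                     (\<lambda>k' i. C n k' i \<omega>) j k m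
              else 0) \<mu>)
   \<and> (\<forall>x x' :: nat \<Rightarrow> nat \<Rightarrow> real.
        AE \<omega> in M. \<forall>t<T. \<forall>k<ny. \<forall>s<T. \<forall>l<ny.
          (\<lambda>n. rnn_ntk n nx ny (\<lambda>i i'. W n i i' \<omega>) (\<lambda>i m. F n i m \<omega>) (\<lambda>k' i. C n k' i \<omega>)
                  x x' t k s l)
          \<longlonglongrightarrow> ntk_limit T nx \<nu>W \<nu>F \<nu>C x x' t k s l)"
proof -
  interpret rnn_init M T nx ny \<nu>W \<nu>F \<nu>C W F C
    by (rule rnn_init.intro[OF assms(1)], rule rnn_init_axioms.intro)
       (use assms in \<open>auto\<close>)
  show ?thesis
  proof (intro conjI exI[of _ \<mu>])
    show "prob_space \<mu>" by (rule prob_space_\<mu>)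
    show "sets \<mu> = sets borel" by (rule sets_\<mu>)
    show "prob_space.indep_vars \<mu> (\<lambda>_. borel) (\<lambda>p v. v p) ({..<T} \<times> {..<ny} \<times> {..<nx})"
      by (rule indep_coord)
    show "\<forall>j<T. \<forall>k<ny. \<forall>m<nx. distributed \<mu> lborel (\<lambda>v. v (j, k, m))
        (normal_density 0 (sqrt (\<nu>C * \<nu>F * \<nu>W ^ j)))"
      using limit_normal by force
    show "AE v in \<mu>. \<forall>p. p \<notin> {..<T} \<times> {..<ny} \<times> {..<nx} \<longrightarrow> v p = 0"
      by (rule limit_zero)
    show "converges_in_distribution M
          (\<lambda>n \<omega> (j, k, m). if j < T \<and> k < ny \<and> m < nx
              then impulse_coeff n (\<lambda>i i'. W n i i' \<omega>) (\<lambda>i m'. F n i m' \<omega>)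
                     (\<lambda>k' i. C n k' i \<omega>) j k m
              else 0) \<mu>"
      using L_converges unfolding L_def[abs_def] .
  qed (use rnn_ntk_AE in blast)
qed

end
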